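(* Let $m,n\ge1$ and let $\mathbf r=(r_1,\dots,r_n)$ be positive real numbers. Let $\widetilde\Sigma_{\mathbf r}\subset\widetilde M_{\mathbf r}$ be the set of decomposable closed polygons with side-lengths $\mathbf r$, and let $\Sigma_{\mathbf r}$ be its image in $M_{\mathbf r}=\widetilde M_{\mathbf r}/U(m+1)$. Then: (i) $\widetilde M_{\mathbf r}\setminus\widetilde\Sigma_{\mathbf r}$ is a smooth manifold; (ii) the group $SU(m+1)$ acts freely on $\widetilde M_{\mathbf r}\setminus\widetilde\Sigma_{\mathbf r}$, hence the quotient $M_{\mathbf r}\setminus\Sigma_{\mathbf r}$ is a smooth manifold.
   Context: For a unit vector $w\in\mathbb C^{m+1}$, $w\otimes w^*$ is the projection $v\mapsto(v,w)w$. For $r>0$, $\mathcal O_r=\{r\,w\otimes w^*:\|w\|=1\}$, an orbit of $U(m+1)$ acting by conjugation on the Hermitian $(m+1)\times(m+1)$ matrices. $\Lambda=\frac1{m+1}\sum_i r_i$, $\widetilde N_{\mathbf r}=\prod_i\mathcal O_{r_i}$, and $\widetilde M_{\mathbf r}=\{(e_1,\dots,e_n)\in\widetilde N_{\mathbf r}:\sum_i e_i=\Lambda\mathbb I\}$ is the set of closed polygons with side-lengths $\mathbf r$. $U(m+1)$ and its subgroup $SU(m+1)$ act on $\widetilde M_{\mathbf r}$ by simultaneous conjugation of all $e_i$. Decomposable: $\mathbf e\in\widetilde M_{\mathbf r}$ is decomposable if there are $1\le k\le m$, an orthogonal decomposition $\mathbb C^{m+1}=V_1\oplus V_2$ with $\dim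 V_1=m-k+1$, $\dim V_2=k$, and a partition $\{1,\dots,n\}=I\sqcup J$ into nonempty subsets such that $e_i$ has image in $V_1$ for $i\in I$, $e_j$ has image in $V_2$ for $j\in J$, $\sum_{i\in I}e_i|_{V_1}$ is a scalar multiple of $\mathrm{id}_{V_1}$ and $\sum_{j\in J}e_j|_{V_2}$ is a scalar multiple of $\mathrm{id}_{V_2}$.
   Formalization: "SU(m+1) acts freely" is false literally, since the scalar matrices in SU(m+1) fix every polygon; it is proved instead that every stabilizer in SU(m+1) is exactly its group of scalar matrices, i.e. SU(m+1) modulo its centre acts freely. *)

theory Defs
  imports "HOL-Analysis.Analysis" "HOL-Algebra.Group_Action"
begin

section \<open>Smooth maps and manifolds\<close>

primrec Ck_on :: "nat \<Rightarrow> 'a set \<Rightarrow> ('a::real_normed_vector \<Rightarrow> 'b::real_normed_vector) \<Rightarrow> bool" where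
  "Ck_on 0 U f \<longleftrightarrow> continuous_on U f"
| "Ck_on (Suc k) U f \<longleftrightarrow> (\<forall>x\<in>U. f differentiable (at x)) \<and>
     (\<forall>v. Ck_on k U (\<lambda>x. frechet_derivative f (at x) v))"

text \<open>Smoothness on an arbitrary subset \<open>S\<close> of a Euclidean space means, as usual, that locally there
  is a smooth extension to an open subset of the ambient space.  If \<open>S\<close> is open in a linear
  subspace, this is ordinary smoothness with respect to that subspace.\<close>

definition smooth_map_on :: "'a::euclidean_space set \<Rightarrow> ('a \<Rightarrow> 'b::euclidean_space) \<Rightarrow> bool" where
  "smooth_map_on S f \<longleftrightarrow>
     (\<forall>x\<in>S. \<exists>U g. open U \<and> x \<in> U \<and> (\<forall>k. Ck_on k U g) \<and> (\<forall>y\<in>S \<inter> U. f y = g y))"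

text \<open>Manifolds are modelled on a linear subspace \<open>L\<close> of some Euclidean space instead of
  \<open>\<real>\<^sup>d\<close> with \<open>d = dim L\<close>: in this way the dimension is not tied to a type
  and may be \<open>0\<close>.\<close>

definition smooth_submanifold :: "'b::euclidean_space set \<Rightarrow> 'a::euclidean_space set \<Rightarrow> bool" where
  "smooth_submanifold L S \<longleftrightarrow>
     subspace L \<and>
     (\<forall>p\<in>S. \<exists>W V f g. p \<in> W \<and> openin (top_of_set S) W \<and> openin (top_of_set L) V \<and>
        homeomorphism W V f g \<and> smooth_map_on W f \<and> smooth_map_on V g)"

definition smooth_atlas ::
    "'b::euclidean_space set \<Rightarrow> 'x topology \<Rightarrow> ('x set \<times> ('x \<Rightarrow> 'b)) set \<Rightarrow> bool" where
  "smooth_atlas L X \<A> \<longleftrightarrow>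
     subspace L \<and>
     (\<forall>(U, \<phi>)\<in>\<A>. openin X U \<and> openin (top_of_set L) (\<phi> ` U) \<and>
        homeomorphic_map (subtopology X U) (top_of_set (\<phi> ` U)) \<phi>) \<and>
     (\<Union>(U, \<phi>)\<in>\<A>. U) = topspace X \<and>
     (\<forall>(U, \<phi>)\<in>\<A>. \<forall>(V, \<psi>)\<in>\<A>. smooth_map_on (\<phi> ` (U \<inter> V)) (\<lambda>y. \<psi> (inv_into U \<phi> y)))"

definition smooth_manifold ::
    "'b::euclidean_space set \<Rightarrow> 'x topology \<Rightarrow> ('x set \<times> ('x \<Rightarrow> 'b)) set \<Rightarrow> bool" where
  "smooth_manifold L X \<A> \<longleftrightarrow> Hausdorff_space X \<and> second_countable X \<and> smooth_atlas L X \<A>"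

text \<open>A smooth submersion from a submanifold \<open>S\<close> of a Euclidean space to a manifold with atlas
  \<open>\<A>\<close> modelled on \<open>L\<close>.  Surjectivity of the differential at \<open>p\<close>
  is expressed with tangent vectors at \<open>p\<close> represented by smooth curves in \<open>S\<close>.\<close>

definition smooth_submersion ::
    "'a::euclidean_space set \<Rightarrow> 'b::euclidean_space set \<Rightarrow> ('x set \<times> ('x \<Rightarrow> 'b)) set \<Rightarrow> ('a \<Rightarrow> 'x) \<Rightarrow> bool"
  where
  "smooth_submersion S L \<A> \<pi> \<longleftrightarrow>
     \<pi> ` S \<subseteq> (\<Union>(U, \<phi>)\<in>\<A>. U) \<and>
     (\<forall>(U, \<phi>)\<in>\<A>.
        openin (top_of_set S) (S \<inter> \<pi> -` U) \<and>
        smooth_map_on (S \<inter> \<pi> -` U) (\<lambda>x. \<phi> (\<pi> x)) \<and>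
        (\<forall>p\<in>S \<inter> \<pi> -` U. \<forall>v\<in>L. \<exists>\<gamma> \<epsilon>. \<epsilon> > (0::real) \<and> \<gamma> 0 = p \<and>
           smooth_map_on {-\<epsilon><..<\<epsilon>} \<gamma> \<and> \<gamma> ` {-\<epsilon><..<\<epsilon>} \<subseteq> S \<inter> \<pi> -` U \<and>
           ((\<lambda>t. \<phi> (\<pi> (\<gamma> t))) has_vector_derivative v) (at 0)))"

definition quotient_topology :: "'a topology \<Rightarrow> ('a \<Rightarrow> 'x) \<Rightarrow> 'x topology" where
  "quotient_topology X q =
     topology (\<lambda>U. U \<subseteq> q ` topspace X \<and> openin X {x \<in> topspace X. q x \<in> U})"

lemma openin_quotient_topology:
  "openin (quotient_topology X q) U \<longleftrightarrow>
     U \<subseteq> q ` topspace X \<and> openin X {x \<in> topspace X. q x \<in> U}"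
proof -
  have "istopology (\<lambda>U. U \<subseteq> q ` topspace X \<and> openin X {x \<in> topspace X. q x \<in> U})"
    unfolding istopology_def
  proof (intro conjI allI impI)
    fix S T
    assume "S \<subseteq> q ` topspace X \<and> openin X {x \<in> topspace X. q x \<in> S}"
      and "T \<subseteq> q ` topspace X \<and> openin X {x \<in> topspace X. q x \<in> T}"
    moreover have "{x \<in> topspace X. q x \<in> S \<inter> T} =
        {x \<in> topspace X. q x \<in> S} \<inter> {x \<in> topspace X. q x \<in> T}" by blast
    ultimately show "S \<inter> T \<subseteq> q ` topspace X" "openin X {x \<in> topspace X. q x \<in> S \<inter> T}"
      by (auto simp del: Int_iff)
  next
    fix \<K>
    assume *: "\<forall>K\<in>\<K>. K \<subseteq> q ` topspace X \<and> openin X {x \<in> topspace X. q x \<in> K}"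
    then show "\<Union>\<K> \<subseteq> q ` topspace X" by blast
    have "{x \<in> topspace X. q x \<in> \<Union>\<K>} = (\<Union>K\<in>\<K>. {x \<in> topspace X. q x \<in> K})" by blast
    with * show "openin X {x \<in> topspace X. q x \<in> \<Union>\<K>}" by auto
  qed
  then show ?thesis
    by (simp add: quotient_topology_def topology_inverse')
qed

lemma topspace_quotient_topology [simp]: "topspace (quotient_topology X q) = q ` topspace X"
proof -
  have "{x \<in> topspace X. q x \<in> q ` topspace X} = topspace X" by blast
  then have "openin (quotient_topology X q) (q ` topspace X)"
    by (simp add: openin_quotient_topology)
  then show ?thesis
    by (metis openin_quotient_topology openin_subset openin_topspace subset_antisym)
qed

lemma quotient_map_quotient_topology: "quotient_map X (quotient_topology X q) q"
  by (simp add: quotient_map_def openin_quotient_topology)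


section \<open>Unitary groups and group actions\<close>

definition conj_transpose :: "complex^'d^'d \<Rightarrow> complex^'d^'d" where
  "conj_transpose A = (\<chi> i j. cnj (A $ j $ i))"

definition unitary :: "complex^'d^'d \<Rightarrow> bool" where
  "unitary A \<longleftrightarrow> A ** conj_transpose A = mat 1 \<and> conj_transpose A ** A = mat 1"

definition unitary_group :: "(complex^'d^'d) monoid" where
  "unitary_group = \<lparr>carrier = {A. unitary A}, mult = (**), one = mat 1\<rparr>"

definition special_unitary_group :: "(complex^'d^'d) monoid" where
  "special_unitary_group = unitary_group\<lparr>carrier := {A. unitary A \<and> det A = 1}\<rparr>"

definition scalar_special_unitaries :: "(complex^'d^'d) set" where
  "scalar_special_unitaries = {A \<in> carrier special_unitary_group. \<exists>c. A = mat c}"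

text \<open>The group \<open>G\<close> acts on \<open>E\<close> and all stabilizers are equal to \<open>N\<close>.  Then \<open>N\<close>
  acts trivially, so this says that \<open>G/N\<close> acts freely on \<open>E\<close>; for
  \<open>N = {\<one>\<^bsub>G\<^esub>}\<close> it says that \<open>G\<close> acts freely on \<open>E\<close>.\<close>

definition acts_freely_modulo :: "('g, 'more) monoid_scheme \<Rightarrow> 'g set \<Rightarrow> 'e set \<Rightarrow> ('g \<Rightarrow> 'e \<Rightarrow> 'e) \<Rightarrow> bool" where
  "acts_freely_modulo G N E act \<longleftrightarrow> group_action G E act \<and> (\<forall>x\<in>E. stabilizer G act x = N)"


section \<open>Closed polygons\<close>

text \<open>The space \<open>\<complex>\<^sup>m\<^sup>+\<^sup>1\<close> is \<^typ>\<open>complex^'d\<close> with \<open>CARD('d) = m + 1\<close>;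
  an \<open>n\<close>-tuple of matrices has type \<^typ>\<open>complex^'d^'d^'n\<close> with \<open>CARD('n) = n\<close>.\<close>

definition herm_inner :: "complex^'d \<Rightarrow> complex^'d \<Rightarrow> complex" where
  "herm_inner v w = (\<Sum>i\<in>UNIV. v $ i * cnj (w $ i))"

text \<open>The matrix of \<open>v \<mapsto> (v, w) w\<close>, cf. the lemma below.\<close>

definition rank_one :: "complex^'d \<Rightarrow> complex^'d^'d" where
  "rank_one w = (\<chi> i j. w $ i * cnj (w $ j))"

lemma rank_one_mult: "rank_one w *v v = herm_inner v w *s w"
  by (simp add: vec_eq_iff rank_one_def herm_inner_def matrix_vector_mult_def sum_distrib_left
      mult.commute mult.left_commute)

definition orbit_O :: "real \<Rightarrow> (complex^'d^'d) set" where
  "orbit_O r = {r *\<^sub>R rank_one w | w. norm w = 1}"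

definition polygons :: "real^'n \<Rightarrow> (complex^'d^'d^'n) set" where
  "polygons r = {e. \<forall>i. e $ i \<in> orbit_O (r $ i)}"

definition closed_polygons :: "real^'n \<Rightarrow> (complex^'d^'d^'n) set" where
  "closed_polygons r =
     {e \<in> polygons r. (\<Sum>i\<in>UNIV. e $ i) = mat (of_real ((\<Sum>i\<in>UNIV. r $ i) / real CARD('d)))}"

definition decomposable :: "complex^'d^'d^'n \<Rightarrow> bool" where
  "decomposable e \<longleftrightarrow>
     (\<exists>k V1 V2 I J.
        1 \<le> k \<and> k \<le> CARD('d) - 1 \<and>
        vec.subspace V1 \<and> vec.subspace V2 \<and>
        (\<forall>v\<in>V1. \<forall>w\<in>V2. herm_inner v w = 0) \<and> (\<forall>x. \<exists>v\<in>V1. \<exists>w\<in>V2. x = v + w) \<and>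
        vec.dim V1 = CARD('d) - k \<and> vec.dim V2 = k \<and>
        I \<union> J = UNIV \<and> I \<inter> J = {} \<and> I \<noteq> {} \<and> J \<noteq> {} \<and>
        (\<forall>i\<in>I. range ((*v) (e $ i)) \<subseteq> V1) \<and> (\<forall>j\<in>J. range ((*v) (e $ j)) \<subseteq> V2) \<and>
        (\<exists>c. \<forall>v\<in>V1. (\<Sum>i\<in>I. e $ i) *v v = c *s v) \<and>
        (\<exists>c. \<forall>v\<in>V2. (\<Sum>j\<in>J. e $ j) *v v = c *s v))"

definition decomposable_polygons :: "real^'n \<Rightarrow> (complex^'d^'d^'n) set" where
  "decomposable_polygons r = {e \<in> closed_polygons r. decomposable e}"

text \<open>Simultaneous conjugation, as a map on \<open>E\<close>; actions in \<^locale>\<open>group_action\<close>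
  are by extensional bijections of \<open>E\<close>.\<close>

definition conj_action ::
    "(complex^'d^'d^'n) set \<Rightarrow> complex^'d^'d \<Rightarrow> complex^'d^'d^'n \<Rightarrow> complex^'d^'d^'n" where
  "conj_action E A = (\<lambda>e\<in>E. \<chi> i. A ** e $ i ** conj_transpose A)"

definition polygon_class :: "real^'n \<Rightarrow> complex^'d^'d^'n \<Rightarrow> (complex^'d^'d^'n) set" where
  "polygon_class r e = orbit unitary_group (conj_action (closed_polygons r)) e"

definition moduli :: "real^'n \<Rightarrow> (complex^'d^'d^'n) set set" where
  "moduli r = orbits unitary_group (closed_polygons r) (conj_action (closed_polygons r))"

definition moduli_topology :: "real^'n \<Rightarrow> (complex^'d^'d^'n) set topology" where
  "moduli_topology r = quotient_topology (top_of_set (closed_polygons r)) (polygon_class r)"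

lemma topspace_moduli_topology: "topspace (moduli_topology r) = moduli r"
  by (auto simp: moduli_topology_def moduli_def orbits_def polygon_class_def)

definition decomposable_moduli :: "real^'n \<Rightarrow> (complex^'d^'d^'n) set set" where
  "decomposable_moduli r = polygon_class r ` decomposable_polygons r"

end

theory Submission
  imports Defs
begin

text \<open>A closed polygon is decomposable iff its index set splits into two nonempty parts such that
  \<open>e $ i ** e $ j = 0\<close> for \<open>i\<close>, \<open>j\<close> in different parts.  Hence a matrix commuting with every edge of
  a nondecomposable polygon is scalar, which determines the stabilizers.  The same fact, applied to
  the Hermitian matrices orthogonal to the range of the derivative of the moment map
  \<open>w \<mapsto> \<Sum>i. rank_one (w i)\<close>, shows that this range is independent of the polygon, and the
  inverse function theorem provides charts.

  For the quotient, words in the edges, applied to a vector in the range of one edge, give a basis of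
  the whole space.  Orthonormalising it by Gram-Schmidt yields a unitary matrix that moves the polygon to a
  normal form depending only on its orbit.  Thus an invariant open neighbourhood retracts smoothly
  onto a slice meeting each of its orbits once, and the slices serve as charts of the quotient.\<close>

text \<open>\<open>smooth_submanifold\<close> and \<open>smooth_atlas\<close> demand one model space
  for all charts, but charts arise in kernels and ranges of derivatives that vary with the polygon.
  No dimension is computed numerically: rank-nullity expresses each one through
  \<open>moment_range\<close>, \<open>skew_hermitian\<close> and the scalar matrices alone, hence
  uniformly. An edge determines its vector only up to a phase, so the moment map lives on lifts; the
  phase is fixed by asking the inner product with a reference vector to be real and positive. On
  lifts the equations are dependent, since the norms force the trace of the sum. The level set lemma
  therefore asks for values in the range of the derivative instead of surjectivity. Scalar matrices
  act trivially, so freeness is meant modulo them. For the same reason no unitary matrix can be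
  attached to a polygon equivariantly without ambiguity: the line of an edge has no distinguished
  vector. Another vector multiplies the whole frame by a scalar, which alters the Gram-Schmidt
  matrix by a phase, and phases cancel in conjugation.\<close>

section \<open>Calculus of C^k maps\<close>

lemma Ck_on_subset: "Ck_on k U f \<Longrightarrow> V \<subseteq> U \<Longrightarrow> Ck_on k V f"
proof (induction k arbitrary: f)
  case (Suc k)
  then show ?case
    by (metis Ck_on.simps(2) subsetD)
qed (auto intro: continuous_on_subset)

text \<open>Openness of \<open>U\<close> lets agreement on \<open>U\<close> pass to the Frechet
  derivatives, which see a full neighbourhood of each point; the induction continues with
  these.\<close>

lemma Ck_on_cong:
  assumes "open U" "\<And>x. x \<in> U \<Longrightarrow> f x = g x" "Ck_on k U f"
  shows "Ck_on k U g"
  using assms(2,3)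
proof (induction k arbitrary: f g)
  case 0
  then show ?case by (metis Ck_on.simps(1) continuous_on_cong)
next
  case (Suc k)
  have d: "frechet_derivative f (at x) = frechet_derivative g (at x)" if "x \<in> U" for x
    using frechet_derivative_transform_within_open[of f x U g] Suc.prems that assms(1) by auto
  have "g differentiable (at x)" if "x \<in> U" for x
    using Suc.prems that assms(1) unfolding Ck_on.simps differentiable_def
    by (metis has_derivative_transform_within_open)
  moreover have "Ck_on k U (\<lambda>x. frechet_derivative g (at x) v)" for v
    by (rule Suc.IH[of "\<lambda>x. frechet_derivative f (at x) v"]) (use Suc.prems d in auto)
  ultimately show ?case by simp
qed

lemma Ck_on_locally:
  assumes "\<And>x. x \<in> S \<Longrightarrow> \<exists>U. open U \<and> x \<in> U \<and> Ck_on k U f"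
  shows "Ck_on k S f"
  using assms
proof (induction k arbitrary: f)
  case 0
  show ?case
    unfolding Ck_on.simps
  proof (rule continuous_at_imp_continuous_on, rule)
    fix x assume "x \<in> S"
    then obtain U where "open U" "x \<in> U" "continuous_on U f" using 0 by auto
    then show "isCont f x" using continuous_on_eq_continuous_at by blast
  qed
next
  case (Suc k)
  have "f differentiable (at x)" if "x \<in> S" for x using Suc.prems[OF that] by auto
  moreover have "Ck_on k S (\<lambda>x. frechet_derivative f (at x) v)" for v
  proof (rule Suc.IH)
    fix x assume "x \<in> S"
    then obtain U where "open U" "x \<in> U" "Ck_on (Suc k) U f" using Suc.prems by blast
    then show "\<exists>U. open U \<and> x \<in> U \<and> Ck_on k U (\<lambda>x. frechet_derivative f (at x) v)" by auto
  qed
  ultimately show ?case by simp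
qed

lemma Ck_on_SucD: "Ck_on (Suc k) U f \<Longrightarrow> Ck_on k U f"
proof (induction k arbitrary: f)
  case 0
  then show ?case
    by (auto intro!: continuous_at_imp_continuous_on differentiable_imp_continuous_within)
next
  case (Suc k)
  then show ?case by (metis Ck_on.simps(2))
qed

text \<open>Trades the operator \<open>frechet_derivative\<close> of the recursion for any explicit
  formula for the derivative; most closure rules below enter the induction step through it.\<close>

lemma Ck_on_SucI:
  assumes "open U" "\<And>x. x \<in> U \<Longrightarrow> (f has_derivative f' x) (at x)"
    and "\<And>v. Ck_on k U (\<lambda>x. f' x v)"
  shows "Ck_on (Suc k) U f"
proof -
  have "Ck_on k U (\<lambda>x. frechet_derivative f (at x) v)" for v
    by (rule Ck_on_cong[OF \<open>open U\<close> _ assms(3)[of v]])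
       (metis assms(2) frechet_derivative_at)
  then show ?thesis using assms(2) by (auto simp: differentiable_def)
qed

lemma Ck_on_has_derivative:
  "Ck_on (Suc k) U f \<Longrightarrow> x \<in> U \<Longrightarrow> (f has_derivative frechet_derivative f (at x)) (at x)"
  by (auto simp: frechet_derivative_works[symmetric])

lemma Ck_on_const: "Ck_on k U (\<lambda>_. c)"
  by (induction k arbitrary: c) auto

lemma Ck_on_bounded_linear:
  assumes "bounded_linear L" "open U" shows "Ck_on k U L"
proof (cases k)
  case 0
  then show ?thesis by (simp add: assms linear_continuous_on)
next
  case (Suc j)
  show ?thesis unfolding Suc
    by (rule Ck_on_SucI[OF \<open>open U\<close> bounded_linear_imp_has_derivative[OF assms(1)]])
       (rule Ck_on_const)
qed

lemma Ck_on_add: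
  assumes "open U" "Ck_on k U f" "Ck_on k U g"
  shows "Ck_on k U (\<lambda>x. f x + g x)"
  using assms(2,3)
proof (induction k arbitrary: f g)
  case 0
  then show ?case by (auto intro: continuous_on_add)
next
  case (Suc k)
  show ?case
    by (rule Ck_on_SucI[OF \<open>open U\<close> has_derivative_add[OF Ck_on_has_derivative Ck_on_has_derivative]])
       (use Suc in auto)
qed

lemma Ck_on_sum:
  assumes "open U" "\<And>i. i \<in> I \<Longrightarrow> Ck_on k U (f i)"
  shows "Ck_on k U (\<lambda>x. \<Sum>i\<in>I. f i x)"
  using assms(2)
  by (induction I rule: infinite_finite_induct) (auto intro!: Ck_on_const Ck_on_add[OF assms(1)])

text \<open>By the Leibniz rule the derivative is a sum of two terms of the same bilinear form, so
  the induction runs with both factors arbitrary.\<close>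

lemma (in bounded_bilinear) Ck_on:
  assumes "open U" "Ck_on k U f" "Ck_on k U g"
  shows "Ck_on k U (\<lambda>x. prod (f x) (g x))"
  using assms(2,3)
proof (induction k arbitrary: f g)
  case 0
  then show ?case by (auto intro: continuous_on)
next
  case (Suc k)
  show ?case
    by (rule Ck_on_SucI[OF \<open>open U\<close> FDERIV[OF Ck_on_has_derivative Ck_on_has_derivative]])
       (use Suc.prems in \<open>auto intro!: Ck_on_add[OF \<open>open U\<close>] Suc.IH Ck_on_SucD[OF Suc.prems(1)]
         Ck_on_SucD[OF Suc.prems(2)]\<close>)
qed

lemma Ck_on_linear_compose:
  assumes "open U" "bounded_linear L" "Ck_on k U f"
  shows "Ck_on k U (\<lambda>x. L (f x))"
  using assms(3)
proof (induction k arbitrary: f)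
  case 0
  then show ?case using assms by (auto intro: bounded_linear.continuous_on)
next
  case (Suc k)
  show ?case
    by (rule Ck_on_SucI[OF \<open>open U\<close> bounded_linear.has_derivative[OF assms(2) Ck_on_has_derivative]])
       (use Suc in auto)
qed

text \<open>The recursion controls derivatives of \<open>g\<close> only in fixed directions, whereas
  the chain rule evaluates them in the moving direction given by the derivative of \<open>f\<close>.
  Expanding that direction in \<open>Basis\<close> separates the two, whence the Euclidean
  intermediate space.\<close>

lemma Ck_on_compose:
  fixes f :: "'a::real_normed_vector \<Rightarrow> 'b::euclidean_space"
  assumes "open U" "open V" "f ` U \<subseteq> V" "Ck_on k U f" "Ck_on k V g"
  shows "Ck_on k U (\<lambda>x. g (f x))"
  using assms(4,5)
proof (induction k arbitrary: g)
  case 0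
  then show ?case using assms by (auto intro: continuous_on_compose2)
next
  case (Suc k)
  let ?D = "\<lambda>x v. \<Sum>b\<in>Basis. (frechet_derivative f (at x) v \<bullet> b) *\<^sub>R frechet_derivative g (at (f x)) b"
  show ?case
  proof (rule Ck_on_SucI[OF \<open>open U\<close>, where f' = ?D])
    fix x assume x: "x \<in> U"
    then have f: "(f has_derivative frechet_derivative f (at x)) (at x)"
      using Suc.prems(1) by (rule Ck_on_has_derivative[rotated])
    have g: "(g has_derivative frechet_derivative g (at (f x))) (at (f x))"
      using Suc.prems(2) by (rule Ck_on_has_derivative) (use x assms in auto)
    interpret bounded_linear "frechet_derivative g (at (f x))"
      using g by (rule has_derivative_bounded_linear)
    have "frechet_derivative g (at (f x)) (frechet_derivative f (at x) v) = ?D x v" for v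
      by (subst euclidean_representation[of "frechet_derivative f (at x) v", symmetric])
         (simp only: sum scaleR)
    then show "((\<lambda>x. g (f x)) has_derivative ?D x) (at x)"
      using has_derivative_compose[OF f g] by simp
  next
    fix v
    have "Ck_on k U (\<lambda>x. frechet_derivative g (at (f x)) b)" for b
      by (rule Suc.IH) (use Suc.prems Ck_on_SucD[OF Suc.prems(1)] in auto)
    moreover have "Ck_on k U (\<lambda>x. frechet_derivative f (at x) v \<bullet> b)" for b
      by (rule Ck_on_linear_compose[OF \<open>open U\<close> bounded_linear_inner_left]) (use Suc.prems in auto)
    ultimately show "Ck_on k U (\<lambda>x. ?D x v)"
      by (intro Ck_on_sum[OF \<open>open U\<close>] bounded_bilinear.Ck_on[OF bounded_bilinear_scaleR \<open>open U\<close>])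
  qed
qed

lemma Ck_on_inverse: "Ck_on k (- {0}) (inverse :: real \<Rightarrow> real)"
proof (induction k)
  case 0
  then show ?case by (auto intro!: continuous_intros)
next
  case (Suc k)
  have o: "open (- {0::real})" by auto
  note mult = bounded_bilinear.Ck_on[OF bounded_bilinear_mult o]
  show ?case
  proof (rule Ck_on_SucI[OF o])
    show "(inverse has_derivative (\<lambda>h. - 1 * (inverse x * h * inverse x))) (at x)" if "x \<in> - {0::real}" for x
      using that by (auto intro!: derivative_eq_intros)
    show "Ck_on k (- {0}) (\<lambda>x. - 1 * (inverse x * v * inverse x))" for v :: real
      by (intro mult Ck_on_const Suc)
  qed
qed

text \<open>The derivative is again built from \<open>sqrt\<close>, through its reciprocal, so each
  order follows from the previous one and the smoothness of \<open>inverse\<close>.\<close>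

lemma Ck_on_sqrt: "Ck_on k {0<..} sqrt"
proof (induction k)
  case 0
  then show ?case by (auto intro!: continuous_intros)
next
  case (Suc k)
  have o: "open {0::real<..}" by auto
  note mult = bounded_bilinear.Ck_on[OF bounded_bilinear_mult o]
  show ?case
  proof (rule Ck_on_SucI[OF o])
    show "(sqrt has_derivative (\<lambda>h. inverse (sqrt x) * (h / 2))) (at x)" if "x \<in> {0<..}" for x
      using that by (auto intro!: derivative_eq_intros simp: field_simps)
    show "Ck_on k {0<..} (\<lambda>x. inverse (sqrt x) * (v / 2))" for v :: real
      by (intro mult Ck_on_const Ck_on_compose[OF o _ _ Suc Ck_on_inverse]) auto
  qed
qed

text \<open>In finite dimension an operator is a finite sum of rank one operators built from its
  values on \<open>Basis\<close>; smoothness in each direction thus upgrades to smoothness in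
  operator norm.\<close>

lemma Ck_on_blinfun:
  fixes A :: "'c::real_normed_vector \<Rightarrow> 'a::euclidean_space \<Rightarrow>\<^sub>L 'b::real_normed_vector"
  assumes "open U" "\<And>v. Ck_on k U (\<lambda>x. A x v)"
  shows "Ck_on k U A"
proof -
  have "A = (\<lambda>x. \<Sum>b\<in>Basis. blinfun_scaleR_left (A x b) o\<^sub>L blinfun_inner_left b)"
  proof (rule ext, rule blinfun_eqI)
    fix x v
    have "A x v = A x (\<Sum>b\<in>Basis. (v \<bullet> b) *\<^sub>R b)" by (simp add: euclidean_representation)
    then show "A x v = (\<Sum>b\<in>Basis. blinfun_scaleR_left (A x b) o\<^sub>L blinfun_inner_left b) v"
      by (simp add: blinfun.sum_left blinfun.sum_right blinfun.scaleR_right inner_commute)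
  qed
  moreover have "Ck_on k U (\<lambda>x. \<Sum>b\<in>Basis. blinfun_scaleR_left (A x b) o\<^sub>L blinfun_inner_left b)"
    by (intro Ck_on_sum[OF \<open>open U\<close>] bounded_bilinear.Ck_on[OF bounded_bilinear_blinfun_compose \<open>open U\<close>]
        Ck_on_linear_compose[OF \<open>open U\<close> bounded_linear_blinfun_scaleR_left] Ck_on_const assms)
  ultimately show ?thesis by simp
qed

section \<open>Smooth inverse functions\<close>

text \<open>Since the right factor vanishes at \<open>x\<close>, continuity of the left one is
  enough. This breaks the circle in differentiating an operator inverse, where the left factor is
  the inverse itself.\<close>

lemma (in bounded_bilinear) has_derivative_at_zero_right:
  assumes f: "isCont f x" and g: "(g has_derivative g') (at x)" and gx: "g x = 0"
  shows "((\<lambda>y. prod (f y) (g y)) has_derivative (\<lambda>h. prod (f x) (g' h))) (at x)"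
proof -
  obtain K where K: "\<And>a b. norm (prod a b) \<le> norm a * norm b * K" "K > 0"
    using pos_bounded by blast
  have lin: "bounded_linear g'" using g by (rule has_derivative_bounded_linear)
  \<comment> \<open>Replacing \<open>f y\<close> by its increment leaves a product of a null
    function and \<open>g y\<close>, which is of order \<open>norm (y - x)\<close>.\<close>
  have "((\<lambda>y. prod (f y - f x) (g y)) has_derivative (\<lambda>h. 0)) (at x)"
    unfolding has_derivative_iff_norm
  proof (intro conjI bounded_linear_zero)
    let ?e = "\<lambda>y. norm (g y - g x - g' (y - x)) / norm (y - x)"
    have e: "(?e \<longlongrightarrow> 0) (at x)"
      using g by (simp add: has_derivative_iff_norm)
    have fx: "((\<lambda>y. norm (f y - f x)) \<longlongrightarrow> 0) (at x)"
      using f by (simp add: isCont_def tendsto_norm_zero LIM_zero)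
    show "((\<lambda>y. norm (prod (f y - f x) (g y) - prod (f x - f x) (g x) - 0) / norm (y - x)) \<longlongrightarrow> 0) (at x)"
    proof (rule tendsto_sandwich[OF _ _ tendsto_const])
      show "((\<lambda>y. norm (f y - f x) * (?e y + onorm g') * K) \<longlongrightarrow> 0) (at x)"
        using tendsto_mult[OF tendsto_mult[OF fx tendsto_add[OF e tendsto_const]] tendsto_const]
        by simp
      show "\<forall>\<^sub>F y in at x. norm (prod (f y - f x) (g y) - prod (f x - f x) (g x) - 0) / norm (y - x)
          \<le> norm (f y - f x) * (?e y + onorm g') * K"
      proof (intro always_eventually allI)
        fix y
        have "norm (g y) \<le> norm (g y - g x - g' (y - x)) + onorm g' * norm (y - x)"
          using onorm[OF lin, of "y - x"] norm_triangle_sub[of "g y" "g' (y - x)"] gx by simp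
        then have "norm (g y) / norm (y - x) \<le> ?e y + onorm g'"
          by (cases "y = x") (auto simp: field_simps gx onorm_pos_le[OF lin])
        then have "norm (f y - f x) * (norm (g y) / norm (y - x)) * K
            \<le> norm (f y - f x) * (?e y + onorm g') * K"
          using K(2) by (intro mult_right_mono mult_left_mono) auto
        moreover have "norm (prod (f y - f x) (g y)) / norm (y - x)
            \<le> norm (f y - f x) * (norm (g y) / norm (y - x)) * K"
          using divide_right_mono[OF K(1)[of "f y - f x" "g y"], of "norm (y - x)"]
          by (simp add: field_simps)
        ultimately show "norm (prod (f y - f x) (g y) - prod (f x - f x) (g x) - 0) / norm (y - x)
          \<le> norm (f y - f x) * (?e y + onorm g') * K"
          by (simp add: gx zero_right)
      qed
    qed auto
  qed
  from has_derivative_add[OF bounded_linear.has_derivative[OF bounded_linear_right g, of "f x"] this]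
  show ?thesis by (simp add: diff_left)
qed

lemma blinfun_compose_id:
  "C o\<^sub>L id_blinfun = C" "id_blinfun o\<^sub>L C = C"
  by (auto intro!: blinfun_eqI)

text \<open>The resolvent identity for \<open>B y - B x\<close> gives continuity once
  \<open>norm (B y)\<close> is bounded near \<open>x\<close>; the bound comes from absorbing half of
  \<open>norm (B y v)\<close> into the left side.\<close>

lemma isCont_blinfun_inverse:
  fixes A B :: "'c::real_normed_vector \<Rightarrow> ('a::real_normed_vector \<Rightarrow>\<^sub>L 'a)"
  assumes U: "open U" "x \<in> U" and A: "isCont A x"
    and AB: "\<And>y. y \<in> U \<Longrightarrow> A y o\<^sub>L B y = id_blinfun"
    and BA: "\<And>y. y \<in> U \<Longrightarrow> B y o\<^sub>L A y = id_blinfun"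
  shows "isCont B x"
proof -
  define b where "b = norm (B x) + 1"
  have b: "b > 0" by (simp add: b_def add_nonneg_pos)
  have diff: "B y - B x = B y o\<^sub>L (A x - A y) o\<^sub>L B x" if "y \<in> U" for y
  proof -
    have "B y o\<^sub>L (A x - A y) o\<^sub>L B x = (B y o\<^sub>L (A x o\<^sub>L B x)) - ((B y o\<^sub>L A y) o\<^sub>L B x)"
      by (auto intro!: blinfun_eqI simp: blinfun.bilinear_simps)
    then show ?thesis using that U AB BA by (simp add: blinfun_compose_id)
  qed
  have bd: "norm (B y) \<le> 2 * b" if y: "y \<in> U" and n: "norm (A x - A y) \<le> 1 / (2 * b)" for y
  proof (rule norm_blinfun_bound)
    fix v
    let ?u = "B y v"
    have Au: "A y ?u = v"
      using AB[OF y] by (metis blinfun_apply_blinfun_compose blinfun_apply_id_blinfun)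
    have "?u = B x (A x ?u)"
      using BA[OF U(2)] by (metis blinfun_apply_blinfun_compose blinfun_apply_id_blinfun)
    then have "norm ?u \<le> norm (B x) * norm (A x ?u)" by (metis norm_blinfun)
    also have "\<dots> \<le> b * norm (A x ?u)" by (simp add: b_def mult_right_mono)
    also have "norm (A x ?u) \<le> norm (A y ?u) + norm ((A x - A y) ?u)"
      by (metis blinfun.diff_left norm_triangle_sub)
    also have "norm ((A x - A y) ?u) \<le> 1 / (2 * b) * norm ?u"
      using norm_blinfun[of "A x - A y" ?u] mult_right_mono[OF n, of "norm ?u"] by simp
    finally have "norm ?u \<le> b * (norm v + 1 / (2 * b) * norm ?u)"
      using b Au by (simp add: mult_left_mono)
    also have "\<dots> = b * norm v + norm ?u / 2" using b by (simp add: field_simps)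
    finally show "norm ?u \<le> 2 * b * norm v" by simp
  qed (use b in simp)
  have A0: "((\<lambda>y. norm (A x - A y)) \<longlongrightarrow> 0) (at x)"
    using tendsto_norm_zero[OF LIM_zero[OF A[unfolded isCont_def]]] by (subst norm_minus_commute)
  have "((\<lambda>y. B y - B x) \<longlongrightarrow> 0) (at x)"
  proof (rule Lim_null_comparison)
    have "\<forall>\<^sub>F y in at x. y \<in> U" using U by (rule eventually_at_in_open')
    moreover have "\<forall>\<^sub>F y in at x. norm (A x - A y) < 1 / (2 * b)"
      using A0 by (rule order_tendstoD) (use b in simp)
    ultimately show "\<forall>\<^sub>F y in at x. norm (B y - B x) \<le> 2 * b * norm (A x - A y) * norm (B x)"
    proof eventually_elim
      case (elim y)
      have "norm (B y - B x) \<le> norm (B y o\<^sub>L (A x - A y)) * norm (B x)"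
        using diff[OF elim(1)] norm_blinfun_compose by metis
      also have "\<dots> \<le> (norm (B y) * norm (A x - A y)) * norm (B x)"
        by (intro mult_right_mono norm_blinfun_compose) auto
      also have "\<dots> \<le> (2 * b * norm (A x - A y)) * norm (B x)"
        using bd elim by (intro mult_right_mono) auto
      finally show ?case .
    qed
    show "((\<lambda>y. 2 * b * norm (A x - A y) * norm (B x)) \<longlongrightarrow> 0) (at x)"
      using tendsto_mult[OF tendsto_mult[OF tendsto_const A0] tendsto_const, of "2*b" "norm (B x)"] by simp
  qed
  then show ?thesis by (simp add: isCont_def LIM_zero_iff)
qed

text \<open>The resolvent identity writes \<open>B y\<close> as a constant plus a product whose
  right factor vanishes at \<open>x\<close>, so continuity of \<open>B\<close> suffices to
  differentiate it.\<close>

lemma has_derivative_blinfun_inverse: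
  fixes A B :: "'c::real_normed_vector \<Rightarrow> ('a::real_normed_vector \<Rightarrow>\<^sub>L 'a)"
  assumes U: "open U" "x \<in> U" and A: "(A has_derivative A') (at x)"
    and AB: "\<And>y. y \<in> U \<Longrightarrow> A y o\<^sub>L B y = id_blinfun"
    and BA: "\<And>y. y \<in> U \<Longrightarrow> B y o\<^sub>L A y = id_blinfun"
  shows "(B has_derivative (\<lambda>h. - (B x o\<^sub>L (A' h o\<^sub>L B x)))) (at x)"
proof -
  have "isCont B x"
    using isCont_blinfun_inverse[OF U _ AB BA] has_derivative_continuous[OF A] by simp
  moreover have "((\<lambda>y. (A x - A y) o\<^sub>L B x) has_derivative (\<lambda>h. (0 - A' h) o\<^sub>L B x)) (at x)"
    by (rule bounded_linear.has_derivative[OF bounded_bilinear.bounded_linear_left[OF bounded_bilinear_blinfun_compose]])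
       (rule has_derivative_diff[OF has_derivative_const A])
  ultimately have "((\<lambda>y. B y o\<^sub>L ((A x - A y) o\<^sub>L B x)) has_derivative
      (\<lambda>h. B x o\<^sub>L ((0 - A' h) o\<^sub>L B x))) (at x)"
    by (rule bounded_bilinear.has_derivative_at_zero_right[OF bounded_bilinear_blinfun_compose])
       (simp add: bounded_bilinear.zero_left[OF bounded_bilinear_blinfun_compose])
  then have "((\<lambda>y. B x + (B y o\<^sub>L ((A x - A y) o\<^sub>L B x))) has_derivative
      (\<lambda>h. 0 + (B x o\<^sub>L ((0 - A' h) o\<^sub>L B x)))) (at x)"
    by (rule has_derivative_add[OF has_derivative_const])
  then have "(B has_derivative (\<lambda>h. 0 + (B x o\<^sub>L ((0 - A' h) o\<^sub>L B x)))) (at x)"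
  proof (rule has_derivative_transform_within_open[OF _ U])
    fix y assume y: "y \<in> U"
    have "B y o\<^sub>L ((A x - A y) o\<^sub>L B x) = (B y o\<^sub>L (A x o\<^sub>L B x)) - ((B y o\<^sub>L A y) o\<^sub>L B x)"
      by (auto intro!: blinfun_eqI simp: blinfun.bilinear_simps)
    then show "B x + (B y o\<^sub>L ((A x - A y) o\<^sub>L B x)) = B y" using y U AB BA by (simp add: blinfun_compose_id)
  qed
  then show ?thesis
    by (rule has_derivative_eq_rhs)
       (auto intro!: blinfun_eqI simp: blinfun.bilinear_simps)
qed

text \<open>The derivative of \<open>B\<close> is a product of \<open>B\<close>, a derivative of
  \<open>A\<close>, and \<open>B\<close> again, so each order of smoothness yields the next.\<close>

lemma Ck_on_blinfun_inverse:
  fixes A B :: "'c::real_normed_vector \<Rightarrow> ('a::real_normed_vector \<Rightarrow>\<^sub>L 'a)"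
  assumes U: "open U" and A: "Ck_on k U A"
    and AB: "\<And>y. y \<in> U \<Longrightarrow> A y o\<^sub>L B y = id_blinfun"
    and BA: "\<And>y. y \<in> U \<Longrightarrow> B y o\<^sub>L A y = id_blinfun"
  shows "Ck_on k U B"
  using A
proof (induction k)
  case 0
  then have "isCont A x" if "x \<in> U" for x
    using that U by (simp add: continuous_on_eq_continuous_at)
  then show ?case
    using isCont_blinfun_inverse[OF U _ _ AB BA]
    by (auto intro!: continuous_at_imp_continuous_on)
next
  case (Suc k)
  show ?case
  proof (rule Ck_on_SucI[OF U has_derivative_blinfun_inverse[OF U _ Ck_on_has_derivative AB BA]])
    fix v
    have B: "Ck_on k U B" using Suc.IH Ck_on_SucD[OF Suc.prems] .
    have "Ck_on k U (\<lambda>x. frechet_derivative A (at x) v)" using Suc.prems by simp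
    with B show "Ck_on k U (\<lambda>x. - (B x o\<^sub>L (frechet_derivative A (at x) v o\<^sub>L B x)))"
      by (intro Ck_on_linear_compose[OF U bounded_linear_minus[OF bounded_linear_ident]]
          bounded_bilinear.Ck_on[OF bounded_bilinear_blinfun_compose U])
  qed (use Suc.prems in auto)
qed

text \<open>The C^1 theorem makes the derivative of \<open>g\<close> at \<open>y\<close> the inverse
  of the derivative of \<open>f\<close> at \<open>g y\<close>. Bootstrapping: if \<open>g\<close> is
  C^k, so is that operator, hence its inverse, hence \<open>g\<close> is C^(k+1).\<close>

theorem smooth_inverse_function:
  fixes f :: "'a::euclidean_space \<Rightarrow> 'a"
  assumes U: "open U" "x0 \<in> U" and f: "\<And>k. Ck_on k U f"
    and inj: "inj (frechet_derivative f (at x0))"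
  obtains U' V g where "open U'" "U' \<subseteq> U" "x0 \<in> U'" "open V" "homeomorphism U' V f g"
    "\<And>k. Ck_on k V g"
proof -
  define f' where "f' = (\<lambda>x. Blinfun (frechet_derivative f (at x)))"
  have der: "(f has_derivative frechet_derivative f (at x)) (at x)" if "x \<in> U" for x
    using f[of 1] that Ck_on_has_derivative[of 0 U f x] by simp
  have f'_apply: "blinfun_apply (f' x) = frechet_derivative f (at x)" if "x \<in> U" for x
    unfolding f'_def by (rule bounded_linear_Blinfun_apply[OF has_derivative_bounded_linear[OF der[OF that]]])
  have derf: "(f has_derivative blinfun_apply (f' x)) (at x)" if "x \<in> U" for x
    using der that by (simp add: f'_apply)
  have f'_Ck: "Ck_on k U f'" for k
  proof (rule Ck_on_blinfun[OF U(1)])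
    fix v
    show "Ck_on k U (\<lambda>x. blinfun_apply (f' x) v)"
      by (rule Ck_on_cong[OF U(1), of "\<lambda>x. frechet_derivative f (at x) v"])
         (use f'_apply f[of "Suc k"] in auto)
  qed
  have "linear (frechet_derivative f (at x0))"
    using der[OF U(2)] has_derivative_linear by blast
  then obtain h where h: "linear h" "h \<circ> frechet_derivative f (at x0) = id"
    using inj linear_injective_left_inverse by blast
  \<comment> \<open>\<open>inverse_function_theorem\<close> takes invertibility at \<open>x0\<close>
    in the form of a bounded left inverse.\<close>
  have "Blinfun h o\<^sub>L f' x0 = id_blinfun"
  proof (rule blinfun_eqI)
    fix v
    have "bounded_linear h" using h linear_conv_bounded_linear by blast
    then show "blinfun_apply (Blinfun h o\<^sub>L f' x0) v = blinfun_apply id_blinfun v"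
      using h(2) U(2) by (simp add: f'_apply bounded_linear_Blinfun_apply fun_eq_iff)
  qed
  moreover have "continuous_on U f'" using f'_Ck[of 0] by simp
  ultimately obtain U' V g g' where *: "open U'" "U' \<subseteq> U" "x0 \<in> U'" "open V" "homeomorphism U' V f g"
    and g: "\<And>y. y \<in> V \<Longrightarrow> (g has_derivative (g' y)) (at y)"
    "\<And>y. y \<in> V \<Longrightarrow> g' y = inv_into UNIV (blinfun_apply (f'(g y)))"
    "\<And>y. y \<in> V \<Longrightarrow> bij (blinfun_apply (f'(g y)))"
    using inverse_function_theorem[OF U(1) derf, of x0 "Blinfun h"] U(2) by metis
  define A where "A = (\<lambda>y. f' (g y))"
  define B where "B = (\<lambda>y. Blinfun (g' y))"
  have Bv: "blinfun_apply (B y) = g' y" if "y \<in> V" for y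
    unfolding B_def by (rule bounded_linear_Blinfun_apply[OF has_derivative_bounded_linear[OF g(1)[OF that]]])
  have AB: "A y o\<^sub>L B y = id_blinfun" "B y o\<^sub>L A y = id_blinfun" if "y \<in> V" for y
    using g(2,3)[OF that] by (auto intro!: blinfun_eqI simp: Bv[OF that] A_def bij_is_surj surj_f_inv_f
        bij_is_inj inv_f_f)
  have gV: "g ` V \<subseteq> U" using *(2,5) by (auto simp: homeomorphism_def)
  have "Ck_on k V g" for k
  proof (induction k)
    case 0
    then show ?case using *(5) by (simp add: homeomorphism_def)
  next
    case (Suc k)
    have "Ck_on k V A" unfolding A_def
      by (rule Ck_on_compose[OF *(4) U(1) gV Suc f'_Ck])
    then have B: "Ck_on k V B" by (rule Ck_on_blinfun_inverse[OF *(4)]) (fact AB)+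
    show ?case
    proof (rule Ck_on_SucI[OF *(4) g(1)])
      fix v
      show "Ck_on k V (\<lambda>y. g' y v)"
        by (rule Ck_on_cong[OF *(4) _ Ck_on_linear_compose[OF *(4) _ B, of "\<lambda>b. blinfun_apply b v"]])
           (auto simp: Bv blinfun.bounded_linear_left)
    qed
  qed
  then show thesis using that * by blast
qed

section \<open>Smooth maps on subsets and charts\<close>

lemma smooth_map_onI:
  assumes "\<And>x. x \<in> S \<Longrightarrow> \<exists>U g. open U \<and> x \<in> U \<and> (\<forall>k. Ck_on k U g) \<and> (\<forall>y\<in>S \<inter> U. f y = g y)"
  shows "smooth_map_on S f"
  using assms by (auto simp: smooth_map_on_def)

lemma smooth_map_onE:
  assumes "smooth_map_on S f" "x \<in> S"
  obtains U g where "open U" "x \<in> U" "\<And>k. Ck_on k U g" "\<And>y. y \<in> S \<Longrightarrow> y \<in> U \<Longrightarrow> f y = g y"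
  using assms by (auto simp: smooth_map_on_def) (metis IntI)

lemma smooth_map_on_Ck:
  "open U \<Longrightarrow> (\<And>k. Ck_on k U f) \<Longrightarrow> smooth_map_on U f"
  by (intro smooth_map_onI exI[of _ U] exI[of _ f]) auto

lemma smooth_map_on_imp_Ck:
  assumes "open S" "smooth_map_on S f" shows "Ck_on k S f"
proof (rule Ck_on_locally)
  fix x assume "x \<in> S"
  with assms(2) obtain U g where U: "open U" "x \<in> U" "\<And>k. Ck_on k U g"
    "\<And>y. y \<in> S \<Longrightarrow> y \<in> U \<Longrightarrow> f y = g y" using smooth_map_onE by blast
  then have "Ck_on k (S \<inter> U) f"
    by (intro Ck_on_cong[OF open_Int[OF assms(1) U(1)] _ Ck_on_subset[OF U(3)]]) (auto simp: U(4))
  then show "\<exists>U. open U \<and> x \<in> U \<and> Ck_on k U f"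
    using \<open>x \<in> S\<close> U assms(1) by (intro exI[of _ "S \<inter> U"]) auto
qed

lemma smooth_map_on_subset:
  assumes "smooth_map_on S f" "T \<subseteq> S" shows "smooth_map_on T f"
proof (rule smooth_map_onI)
  fix x assume "x \<in> T"
  then obtain U g where "open U" "x \<in> U" "\<And>k. Ck_on k U g" "\<And>y. y \<in> S \<Longrightarrow> y \<in> U \<Longrightarrow> f y = g y"
    using smooth_map_onE[OF assms(1), of x] assms(2) by blast
  then show "\<exists>U g. open U \<and> x \<in> U \<and> (\<forall>k. Ck_on k U g) \<and> (\<forall>y\<in>T \<inter> U. f y = g y)"
    using assms(2) by (intro exI[of _ U] exI[of _ g]) auto
qed

lemma smooth_map_on_cong:
  assumes "\<And>x. x \<in> S \<Longrightarrow> f x = g x" "smooth_map_on S f" shows "smooth_map_on S g"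
proof (rule smooth_map_onI)
  fix x assume "x \<in> S"
  then obtain U h where "open U" "x \<in> U" "\<And>k. Ck_on k U h" "\<And>y. y \<in> S \<Longrightarrow> y \<in> U \<Longrightarrow> f y = h y"
    using smooth_map_onE[OF assms(2), of x] by blast
  then show "\<exists>U h. open U \<and> x \<in> U \<and> (\<forall>k. Ck_on k U h) \<and> (\<forall>y\<in>S \<inter> U. g y = h y)"
    using assms(1) by (intro exI[of _ U] exI[of _ h]) auto
qed

lemma smooth_map_on_locally:
  assumes "\<And>x. x \<in> S \<Longrightarrow> \<exists>U. open U \<and> x \<in> U \<and> smooth_map_on (S \<inter> U) f"
  shows "smooth_map_on S f"
proof (rule smooth_map_onI)
  fix x assume "x \<in> S"
  then obtain U where U: "open U" "x \<in> U" "smooth_map_on (S \<inter> U) f" using assms by blast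
  with \<open>x \<in> S\<close> obtain V g where "open V" "x \<in> V" "\<And>k. Ck_on k V g"
    "\<And>y. y \<in> S \<inter> U \<Longrightarrow> y \<in> V \<Longrightarrow> f y = g y" using smooth_map_onE[OF U(3), of x] by blast
  then show "\<exists>U g. open U \<and> x \<in> U \<and> (\<forall>k. Ck_on k U g) \<and> (\<forall>y\<in>S \<inter> U. f y = g y)"
    using U by (intro exI[of _ "U \<inter> V"] exI[of _ g]) (auto intro: Ck_on_subset)
qed

lemma smooth_map_on_continuous: "smooth_map_on S f \<Longrightarrow> continuous_on S f"
proof (rule continuous_on_eq_continuous_within[THEN iffD2], rule)
  fix x assume "smooth_map_on S f" "x \<in> S"
  then obtain U g where U: "open U" "x \<in> U" "\<And>k. Ck_on k U g"
    "\<And>y. y \<in> S \<Longrightarrow> y \<in> U \<Longrightarrow> f y = g y" using smooth_map_onE by blast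
  obtain d where d: "d > 0" "ball x d \<subseteq> U" using U openE by blast
  have "isCont g x"
    using U(1,2) U(3)[of 0] by (simp add: continuous_on_eq_continuous_at)
  then have "continuous (at x within S) g" by (rule continuous_at_imp_continuous_at_within)
  then show "continuous (at x within S) f"
    by (rule continuous_transform_within[OF _ d(1)])
       (use U \<open>x \<in> S\<close> d in \<open>auto simp: dist_commute subset_iff\<close>)
qed

lemma smooth_map_on_differentiable:
  "open S \<Longrightarrow> smooth_map_on S f \<Longrightarrow> x \<in> S \<Longrightarrow> f differentiable (at x)"
  using smooth_map_on_imp_Ck[of S f 1] by simp

lemma smooth_map_on_compose:
  assumes "smooth_map_on S f" "smooth_map_on T g" "f ` S \<subseteq> T"
  shows "smooth_map_on S (\<lambda>x. g (f x))"
proof (rule smooth_map_onI)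
  fix x assume x: "x \<in> S"
  obtain U f' where U: "open U" "x \<in> U" "\<And>k. Ck_on k U f'"
    "\<And>y. y \<in> S \<Longrightarrow> y \<in> U \<Longrightarrow> f y = f' y" using smooth_map_onE[OF assms(1) x] by blast
  obtain V g' where V: "open V" "f x \<in> V" "\<And>k. Ck_on k V g'"
    "\<And>y. y \<in> T \<Longrightarrow> y \<in> V \<Longrightarrow> g y = g' y"
    using smooth_map_onE[OF assms(2), of "f x"] assms(3) x by blast
  have o: "open (U \<inter> f' -` V)"
    using U(1) V(1) U(3)[of 0] by (auto intro: continuous_open_preimage)
  have "Ck_on k (U \<inter> f' -` V) (\<lambda>x. g' (f' x))" for k
    by (rule Ck_on_compose[OF o V(1)]) (auto intro: Ck_on_subset[OF U(3)] V)
  moreover have "x \<in> U \<inter> f' -` V" using U(2) V(2) U(4)[OF x] by auto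
  moreover have "g (f y) = g' (f' y)" if "y \<in> S \<inter> (U \<inter> f' -` V)" for y
    using that U(4)[of y] V(4)[of "f y"] assms(3) by auto
  ultimately show "\<exists>U h. open U \<and> x \<in> U \<and> (\<forall>k. Ck_on k U h) \<and> (\<forall>y\<in>S \<inter> U. g (f y) = h y)"
    using o by blast
qed

lemma smooth_map_on_const: "smooth_map_on S (\<lambda>_. c)"
  by (rule smooth_map_on_subset[OF smooth_map_on_Ck[OF open_UNIV]]) (auto intro: Ck_on_const)

lemma smooth_map_on_linear: "linear L \<Longrightarrow> smooth_map_on S L"
  by (rule smooth_map_on_subset[OF smooth_map_on_Ck[OF open_UNIV]])
     (auto intro!: Ck_on_bounded_linear simp: linear_conv_bounded_linear)

lemma smooth_map_on_ident: "smooth_map_on S (\<lambda>x. x)"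
  by (rule smooth_map_on_linear[OF linear_ident])

lemma smooth_map_on_linear_compose:
  "linear L \<Longrightarrow> smooth_map_on S f \<Longrightarrow> smooth_map_on S (\<lambda>x. L (f x))"
  by (rule smooth_map_on_compose[OF _ smooth_map_on_linear]) auto

lemma smooth_map_on_bilinear:
  assumes "bounded_bilinear B" "smooth_map_on S f" "smooth_map_on S g"
  shows "smooth_map_on S (\<lambda>x. B (f x) (g x))"
proof (rule smooth_map_onI)
  fix x assume x: "x \<in> S"
  obtain U f' where U: "open U" "x \<in> U" "\<And>k. Ck_on k U f'"
    "\<And>y. y \<in> S \<Longrightarrow> y \<in> U \<Longrightarrow> f y = f' y" using smooth_map_onE[OF assms(2) x] by blast
  obtain V g' where V: "open V" "x \<in> V" "\<And>k. Ck_on k V g'"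
    "\<And>y. y \<in> S \<Longrightarrow> y \<in> V \<Longrightarrow> g y = g' y" using smooth_map_onE[OF assms(3) x] by blast
  have "Ck_on k (U \<inter> V) (\<lambda>x. B (f' x) (g' x))" for k
    by (intro bounded_bilinear.Ck_on[OF assms(1)] Ck_on_subset[OF U(3)] Ck_on_subset[OF V(3)] open_Int U V) auto
  then show "\<exists>U h. open U \<and> x \<in> U \<and> (\<forall>k. Ck_on k U h) \<and> (\<forall>y\<in>S \<inter> U. B (f y) (g y) = h y)"
    using U V by (intro exI[of _ "U \<inter> V"] exI[of _ "\<lambda>x. B (f' x) (g' x)"]) auto
qed

lemma smooth_map_on_add:
  assumes "smooth_map_on S f" "smooth_map_on S g"
  shows "smooth_map_on S (\<lambda>x. f x + g x)"
proof (rule smooth_map_onI)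
  fix x assume x: "x \<in> S"
  obtain U f' where U: "open U" "x \<in> U" "\<And>k. Ck_on k U f'"
    "\<And>y. y \<in> S \<Longrightarrow> y \<in> U \<Longrightarrow> f y = f' y" using smooth_map_onE[OF assms(1) x] by blast
  obtain V g' where V: "open V" "x \<in> V" "\<And>k. Ck_on k V g'"
    "\<And>y. y \<in> S \<Longrightarrow> y \<in> V \<Longrightarrow> g y = g' y" using smooth_map_onE[OF assms(2) x] by blast
  have "Ck_on k (U \<inter> V) (\<lambda>x. f' x + g' x)" for k
    by (intro Ck_on_add Ck_on_subset[OF U(3)] Ck_on_subset[OF V(3)] open_Int U V) auto
  then show "\<exists>U h. open U \<and> x \<in> U \<and> (\<forall>k. Ck_on k U h) \<and> (\<forall>y\<in>S \<inter> U. f y + g y = h y)"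
    using U V by (intro exI[of _ "U \<inter> V"] exI[of _ "\<lambda>x. f' x + g' x"]) auto
qed

lemma smooth_map_on_minus: "smooth_map_on S f \<Longrightarrow> smooth_map_on S (\<lambda>x. - f x)"
  by (rule smooth_map_on_linear_compose[OF bounded_linear.linear[OF bounded_linear_minus[OF bounded_linear_ident]]])

lemma smooth_map_on_diff:
  "smooth_map_on S f \<Longrightarrow> smooth_map_on S g \<Longrightarrow> smooth_map_on S (\<lambda>x. f x - g x)"
  using smooth_map_on_add[OF _ smooth_map_on_minus] by fastforce

lemma smooth_map_on_sum:
  "(\<And>i. i \<in> I \<Longrightarrow> smooth_map_on S (f i)) \<Longrightarrow> smooth_map_on S (\<lambda>x. \<Sum>i\<in>I. f i x)"
  by (induction I rule: infinite_finite_induct) (auto intro!: smooth_map_on_const smooth_map_on_add)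

lemmas smooth_map_on_scaleR = smooth_map_on_bilinear[OF bounded_bilinear_scaleR]
lemmas smooth_map_on_inner = smooth_map_on_bilinear[OF bounded_bilinear_inner]
lemmas smooth_map_on_mult = smooth_map_on_bilinear[OF bounded_bilinear_mult]

lemma smooth_map_on_vec_nth: "smooth_map_on S f \<Longrightarrow> smooth_map_on S (\<lambda>x. f x $ i)"
  by (rule smooth_map_on_linear_compose[OF bounded_linear.linear[OF bounded_linear_vec_nth]])

lemma smooth_map_on_vec_lambda:
  fixes f :: "'a::euclidean_space \<Rightarrow> 'i::finite \<Rightarrow> 'b::euclidean_space"
  assumes "\<And>i. smooth_map_on S (\<lambda>x. f x i)"
  shows "smooth_map_on S (\<lambda>x. \<chi> i. f x i)"
proof -
  have "(\<chi> i. f x i) = (\<Sum>i\<in>UNIV. axis i (f x i))" for x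
    by (auto simp: vec_eq_iff axis_def if_distrib sum.delta cong: if_cong)
  moreover have "linear (axis i :: 'b \<Rightarrow> 'b^'i)" for i
    by (rule linearI) (auto simp: vec_eq_iff axis_def)
  ultimately show ?thesis
    by (simp only:) (intro smooth_map_on_sum smooth_map_on_linear_compose[of "axis _"] assms)
qed

lemma smooth_map_on_Pair:
  assumes "smooth_map_on S f" "smooth_map_on S g"
  shows "smooth_map_on S (\<lambda>x. (f x, g x))"
proof -
  have "smooth_map_on S (\<lambda>x. (f x, 0) + (0, g x))"
    by (intro smooth_map_on_add smooth_map_on_linear_compose[of "\<lambda>y. (y, 0)"]
        smooth_map_on_linear_compose[of "\<lambda>y. (0, y)"] assms linearI) auto
  then show ?thesis by simp
qed

lemma smooth_map_on_inverse:
  fixes f :: "'a::euclidean_space \<Rightarrow> real"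
  assumes "smooth_map_on S f" "\<And>x. x \<in> S \<Longrightarrow> f x \<noteq> 0"
  shows "smooth_map_on S (\<lambda>x. inverse (f x))"
  by (rule smooth_map_on_compose[OF assms(1) smooth_map_on_Ck[of "- {0}"]])
     (use assms(2) Ck_on_inverse in auto)

lemma smooth_map_on_sqrt:
  fixes f :: "'a::euclidean_space \<Rightarrow> real"
  assumes "smooth_map_on S f" "\<And>x. x \<in> S \<Longrightarrow> f x > 0"
  shows "smooth_map_on S (\<lambda>x. sqrt (f x))"
  by (rule smooth_map_on_compose[OF assms(1) smooth_map_on_Ck[of "{0<..}"]])
     (use assms(2) Ck_on_sqrt in auto)

lemma smooth_map_on_norm:
  assumes "smooth_map_on S f" "\<And>x. x \<in> S \<Longrightarrow> f x \<noteq> 0"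
  shows "smooth_map_on S (\<lambda>x. norm (f x))"
  unfolding norm_eq_sqrt_inner using assms
  by (intro smooth_map_on_sqrt smooth_map_on_inner) auto

lemma smooth_map_on_extendE:
  assumes "smooth_map_on S f" "x \<in> S"
  obtains U g where "open U" "x \<in> U" "smooth_map_on U g" "\<And>y. y \<in> S \<Longrightarrow> y \<in> U \<Longrightarrow> f y = g y"
  using smooth_map_onE[OF assms] smooth_map_on_Ck by metis

text \<open>The submanifold condition at one point, with the model set as a parameter: every point
  may use its own \<open>K\<close> first, to be exchanged for a common one afterwards.\<close>

definition chart_at :: "'b::euclidean_space set \<Rightarrow> 'a::euclidean_space set \<Rightarrow> 'a \<Rightarrow> bool" where
  "chart_at K S p \<longleftrightarrow>
     (\<exists>W V f g. p \<in> W \<and> openin (top_of_set S) W \<and> openin (top_of_set K) V \<and>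
        homeomorphism W V f g \<and> smooth_map_on W f \<and> smooth_map_on V g)"

lemma chart_atI:
  assumes "p \<in> W" "openin (top_of_set S) W" "openin (top_of_set K) V"
    and "smooth_map_on W f" "smooth_map_on V g" "f ` W \<subseteq> V" "g ` V \<subseteq> W"
    and "\<And>x. x \<in> W \<Longrightarrow> g (f x) = x" "\<And>y. y \<in> V \<Longrightarrow> f (g y) = y"
  shows "chart_at K S p"
proof -
  have "homeomorphism W V f g"
    by (rule homeomorphismI) (use assms smooth_map_on_continuous in auto)
  then show ?thesis using assms unfolding chart_at_def by blast
qed

lemma chart_atE:
  assumes "chart_at K S p"
  obtains W V f g where "p \<in> W" "openin (top_of_set S) W" "openin (top_of_set K) V"
    "smooth_map_on W f" "smooth_map_on V g" "f ` W \<subseteq> V" "g ` V \<subseteq> W"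
    "\<And>x. x \<in> W \<Longrightarrow> g (f x) = x" "\<And>y. y \<in> V \<Longrightarrow> f (g y) = y"
  using assms unfolding chart_at_def homeomorphism_def by (metis order_refl)

lemma smooth_submanifold_chart_at:
  "smooth_submanifold L S \<longleftrightarrow> subspace L \<and> (\<forall>p\<in>S. chart_at L S p)"
  by (simp add: smooth_submanifold_def chart_at_def)

text \<open>Subspaces of equal dimension are isomorphic by restrictions of linear maps of the
  ambient spaces, which are smooth. This is how the point-dependent model spaces are
  unified.\<close>

lemma chart_at_change_space:
  fixes K :: "'b::euclidean_space set" and L :: "'c::euclidean_space set"
  assumes K: "chart_at K S p" "subspace K" and L: "subspace L" "dim K = dim L"
  shows "chart_at L S p"
proof -
  obtain W V f g where c: "p \<in> W" "openin (top_of_set S) W" "openin (top_of_set K) V"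
    "smooth_map_on W f" "smooth_map_on V g" "f ` W \<subseteq> V" "g ` V \<subseteq> W"
    "\<And>x. x \<in> W \<Longrightarrow> g (f x) = x" "\<And>y. y \<in> V \<Longrightarrow> f (g y) = y"
    using chart_atE[OF K(1)] by blast
  obtain a b where ab: "linear a" "linear b" "a ` K = L" "b ` L = K"
    "\<And>x. x \<in> K \<Longrightarrow> b (a x) = x" "\<And>x. x \<in> L \<Longrightarrow> a (b x) = x"
    by (rule isometries_subspaces[OF K(2) L]) blast
  have VK: "V \<subseteq> K" using c(3) openin_imp_subset by blast
  have aV: "a ` V = L \<inter> b -` V" using VK ab by (auto simp: image_iff)
  show ?thesis
  proof (rule chart_atI[of p W S L "a ` V" "\<lambda>x. a (f x)" "\<lambda>y. g (b y)"])
    show "openin (top_of_set L) (a ` V)" unfolding aV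
      by (rule continuous_openin_preimage[OF _ _ c(3)])
         (use ab in \<open>auto simp: linear_continuous_on linear_conv_bounded_linear\<close>)
    show "smooth_map_on W (\<lambda>x. a (f x))" by (rule smooth_map_on_linear_compose[OF ab(1) c(4)])
    show "smooth_map_on (a ` V) (\<lambda>y. g (b y))"
      by (rule smooth_map_on_compose[OF smooth_map_on_linear[OF ab(2)] c(5)]) (auto simp: aV)
    show "(\<lambda>x. a (f x)) ` W \<subseteq> a ` V" using c(6) by auto
    show "(\<lambda>y. g (b y)) ` a ` V \<subseteq> W" using c(7) by (auto simp: aV)
    show "g (b (a (f x))) = x" if "x \<in> W" for x
      using that c(6,8) VK ab(5)[of "f x"] by (auto simp: image_subset_iff subset_iff)
    show "a (f (g (b y))) = y" if "y \<in> a ` V" for y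
      using that VK ab(5,6) c(9) by (auto simp: subset_iff)
  qed (use c in auto)
qed

text \<open>Lets a chart be found on a better parametrised set \<open>Z\<close>, such as the lifts
  of polygons to vectors, and brought back to \<open>E\<close>.\<close>

lemma chart_at_transfer:
  assumes "chart_at K Z (f p)" "openin (top_of_set E) E'" "p \<in> E'"
    and fg: "smooth_map_on E' f" "smooth_map_on Z g" "f ` E' \<subseteq> Z" "g ` Z \<subseteq> E'"
    "\<And>x. x \<in> E' \<Longrightarrow> g (f x) = x" "\<And>y. y \<in> Z \<Longrightarrow> f (g y) = y"
  shows "chart_at K E p"
proof -
  obtain W V f' g' where c: "f p \<in> W" "openin (top_of_set Z) W" "openin (top_of_set K) V"
    "smooth_map_on W f'" "smooth_map_on V g'" "f' ` W \<subseteq> V" "g' ` V \<subseteq> W"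
    "\<And>x. x \<in> W \<Longrightarrow> g' (f' x) = x" "\<And>y. y \<in> V \<Longrightarrow> f' (g' y) = y"
    using chart_atE[OF assms(1)] by blast
  have WZ: "W \<subseteq> Z" using c(2) openin_imp_subset by blast
  let ?W = "E' \<inter> f -` W"
  show ?thesis
  proof (rule chart_atI[of p ?W E K V "\<lambda>x. f' (f x)" "\<lambda>y. g (g' y)"])
    have "openin (top_of_set E') ?W"
      by (rule continuous_openin_preimage[OF _ _ c(2)])
         (use fg smooth_map_on_continuous in auto)
    then show "openin (top_of_set E) ?W" using assms(2) openin_trans by blast
    show "smooth_map_on ?W (\<lambda>x. f' (f x))"
      by (rule smooth_map_on_compose[OF smooth_map_on_subset[OF fg(1)] c(4)]) auto
    show "smooth_map_on V (\<lambda>y. g (g' y))"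
      by (rule smooth_map_on_compose[OF c(5) fg(2)]) (use c(7) WZ in auto)
    show "(\<lambda>x. f' (f x)) ` ?W \<subseteq> V" using c(6) by auto
    show "(\<lambda>y. g (g' y)) ` V \<subseteq> ?W"
    proof (rule image_subsetI)
      fix y assume "y \<in> V"
      then have "g' y \<in> W" "g' y \<in> Z" using c(7) WZ by auto
      then show "g (g' y) \<in> ?W" using fg(4) fg(6)[of "g' y"] by auto
    qed
    show "g (g' (f' (f x))) = x" if "x \<in> ?W" for x using that c(8) fg(5) by simp
    show "f' (f (g (g' y))) = y" if "y \<in> V" for y
      using that c(7,9) WZ fg(6)[of "g' y"] by (auto simp: image_subset_iff subset_iff)
    show "p \<in> ?W" using assms(3) c(1) by simp
  qed (fact c(3))
qed

text \<open>Restricts an ambient diffeomorphism that straightens \<open>S\<close>; both the level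
  set and the retract case end here.\<close>

lemma chart_at_flat:
  assumes "open B" "homeomorphism B C H G" "open C" "\<And>k. Ck_on k B H" "\<And>k. Ck_on k C G"
    and p: "p \<in> S" "p \<in> B" and H: "\<And>x. x \<in> B \<Longrightarrow> H x \<in> K \<longleftrightarrow> x \<in> S"
  shows "chart_at K S p"
proof -
  have h: "\<And>x. x \<in> B \<Longrightarrow> H x \<in> C" "\<And>y. y \<in> C \<Longrightarrow> G y \<in> B"
    "\<And>x. x \<in> B \<Longrightarrow> G (H x) = x" "\<And>y. y \<in> C \<Longrightarrow> H (G y) = y"
    using assms(2) by (auto simp: homeomorphism_def)
  show ?thesis
  proof (rule chart_atI[of p "S \<inter> B" S K "K \<inter> C" H G])
    show "smooth_map_on (S \<inter> B) H" "smooth_map_on (K \<inter> C) G"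
      using assms by (auto intro: smooth_map_on_subset[OF smooth_map_on_Ck])
    show "G ` (K \<inter> C) \<subseteq> S \<inter> B"
    proof (rule image_subsetI)
      fix y assume y: "y \<in> K \<inter> C"
      then have "H (G y) \<in> K" using h(4) by simp
      then show "G y \<in> S \<inter> B" using y H[of "G y"] h(2)[of y] by auto
    qed
    show "H ` (S \<inter> B) \<subseteq> K \<inter> C" using h H by auto
  qed (use assms h in auto)
qed

section \<open>Level sets, retracts and slices\<close>

text \<open>The image of a right inverse is a complement of the kernel in \<open>K\<close>, which
  turns rank-nullity into the dimension formula for a direct sum.\<close>

lemma dim_image_kernel_subspace:
  fixes f :: "'a::euclidean_space \<Rightarrow> 'b::euclidean_space"
  assumes f: "linear f" and K: "subspace K"
  shows "dim (f ` K) + dim {v \<in> K. f v = 0} = dim K"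
proof -
  obtain g where g: "range g \<subseteq> K" "linear g" "\<And>v. v \<in> f ` K \<Longrightarrow> f (g v) = v"
    using linear_exists_right_inverse_on[OF f K] by blast
  let ?N = "{v \<in> K. f v = 0}" and ?C = "g ` f ` K"
  have fK: "subspace (f ` K)" using f K by (rule linear_subspace_image)
  have C: "subspace ?C" using g(2) fK by (rule linear_subspace_image)
  have N: "subspace ?N"
    using K f by (auto simp: subspace_def linear_0 linear_add linear_scale)
  have "inj_on g (f ` K)" by (metis g(3) inj_on_inverseI)
  then have "dim ?C = dim (f ` K)"
    by (intro dim_image_eq g(2)) (simp add: span_eq_iff[THEN iffD2, OF fK])
  moreover have "?N \<inter> ?C = {0}"
  proof
    show "?N \<inter> ?C \<subseteq> {0}" using g(3) linear_0[OF g(2)] by auto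
    show "{0} \<subseteq> ?N \<inter> ?C" using subspace_0[OF N] subspace_0[OF C] by simp
  qed
  moreover have "{x + y |x y. x \<in> ?N \<and> y \<in> ?C} = K"
  proof (intro equalityI subsetI)
    fix x assume "x \<in> {x + y |x y. x \<in> ?N \<and> y \<in> ?C}"
    then obtain a b where "x = a + g b" "a \<in> K" by auto
    then show "x \<in> K" using g(1) K by (auto intro: subspace_add)
  next
    fix x assume x: "x \<in> K"
    have "g (f x) \<in> K" using g(1) by auto
    then have "x - g (f x) \<in> ?N" using x K f g(3) by (auto simp: subspace_diff linear_diff)
    then show "x \<in> {x + y |x y. x \<in> ?N \<and> y \<in> ?C}"
      using x by (intro CollectI exI[of _ "x - g (f x)"] exI[of _ "g (f x)"]) auto
  qed
  ultimately show ?thesis using dim_sums_Int[OF N C] by simp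
qed

text \<open>With \<open>R\<close> a generalised inverse of the derivative \<open>D\<close> of \<open>F\<close>, the map
  \<open>x - p - R (D (x - p)) + R (F x)\<close> has the identity as its derivative, and \<open>D\<close> maps
  it to \<open>F x\<close>.\<close>

lemma chart_at_level_set:
  fixes F :: "'a::euclidean_space \<Rightarrow> 'b::euclidean_space"
  assumes U: "open U" "p \<in> U" and F: "smooth_map_on U F" and D: "(F has_derivative D) (at p)"
    and range: "\<And>x. x \<in> U \<Longrightarrow> F x \<in> range D"
    and S: "p \<in> S" "\<And>x. x \<in> U \<Longrightarrow> x \<in> S \<longleftrightarrow> F x = 0"
  shows "chart_at {v. D v = 0} S p"
proof -
  have lD: "linear D" using D by (rule has_derivative_linear)
  obtain R where R: "linear R" "\<And>v. D (R (D v)) = D v"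
    using linear_exists_right_inverse_on[OF lD subspace_UNIV] by auto
  define H where "H = (\<lambda>x. (x - p) - R (D (x - p)) + R (F x))"
  have lRD: "linear (\<lambda>v. R (D v))" using linear_compose[OF lD R(1)] by (simp add: o_def)
  have "smooth_map_on U H" unfolding H_def
    by (intro smooth_map_on_add smooth_map_on_diff smooth_map_on_ident smooth_map_on_const
        smooth_map_on_linear_compose[OF lRD] smooth_map_on_linear_compose[OF R(1)] F)
  then have H: "Ck_on k U H" for k by (rule smooth_map_on_imp_Ck[OF U(1)])
  have RF: "((\<lambda>x. R (F x)) has_derivative (\<lambda>v. R (D v))) (at p)"
    using bounded_linear.has_derivative[OF _ D] R(1) linear_conv_bounded_linear by blast
  have "((\<lambda>x. R (D (x - p))) has_derivative (\<lambda>v. R (D (v - 0)))) (at p)"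
    using lRD by (intro bounded_linear.has_derivative[of "\<lambda>v. R (D v)"]
        has_derivative_diff has_derivative_ident has_derivative_const)
      (simp add: linear_conv_bounded_linear)
  then have "(H has_derivative (\<lambda>v. (v - 0) - R (D (v - 0)) + R (D v))) (at p)"
    unfolding H_def by (intro has_derivative_add has_derivative_diff has_derivative_ident
        has_derivative_const RF)
  then have "(H has_derivative (\<lambda>v. v)) (at p)" by simp
  then have "frechet_derivative H (at p) = (\<lambda>v. v)" by (metis frechet_derivative_at)
  then have "inj (frechet_derivative H (at p))" by simp
  then obtain U' V g where *: "open U'" "U' \<subseteq> U" "p \<in> U'" "open V" "homeomorphism U' V H g"
    "\<And>k. Ck_on k V g"
    by (rule smooth_inverse_function[OF U H]) blast
  \<comment> \<open>\<open>D\<close> kills the affine part because \<open>D R D = D\<close>, and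
    \<open>D R\<close> fixes \<open>F x\<close> because it lies in the range of \<open>D\<close>. So
    the zeros of \<open>F\<close> are the points that \<open>H\<close> sends into the kernel of
    \<open>D\<close>.\<close>
  have DH: "D (H x) = F x" if "x \<in> U" for x
    using range[OF that] R(2)
    by (auto simp: H_def linear_add[OF lD] linear_diff[OF lD, of "x - p" "R (D (x - p))"])
  show ?thesis
  proof (rule chart_at_flat[OF *(1) *(5) *(4) _ *(6) S(1) *(3)])
    show "Ck_on k U' H" for k using H *(2) Ck_on_subset by blast
    show "(H x \<in> {v. D v = 0}) = (x \<in> S)" if "x \<in> U'" for x
      using that *(2) S(2) DH by auto
  qed
qed

text \<open>The map \<open>D (T x) + (I - D) (x - T x)\<close> has the identity as its derivative
  at \<open>q\<close> and straightens the set of fixed points of \<open>T\<close>.\<close>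

lemma chart_at_retract:
  fixes T :: "'a::euclidean_space \<Rightarrow> 'a"
  assumes U: "open U" "q \<in> U" and T: "smooth_map_on U T" "T ` U \<subseteq> U" "\<And>x. x \<in> U \<Longrightarrow> T (T x) = T x"
    "T q = q" and D: "(T has_derivative D) (at q)"
  shows "chart_at (range D) {x \<in> U. T x = x} q"
proof -
  have lD: "linear D" using D by (rule has_derivative_linear)
  \<comment> \<open>Differentiating idempotence at the fixed point shows that \<open>D\<close> is a
    projection.\<close>
  have "((\<lambda>x. T (T x)) has_derivative (\<lambda>v. D (D v))) (at q)"
    using has_derivative_compose[OF D, of T D] D T(4) by simp
  then have "(T has_derivative (\<lambda>v. D (D v))) (at q)"
    by (rule has_derivative_transform_within_open[OF _ U]) (use T in auto)
  with D have "D = (\<lambda>v. D (D v))" by (rule has_derivative_unique)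
  then have DD: "D (D v) = D v" for v by (rule fun_cong[symmetric])
  define H where "H = (\<lambda>x. D (T x) + ((x - T x) - D (x - T x)))"
  have "smooth_map_on U H" unfolding H_def
    by (intro smooth_map_on_add smooth_map_on_diff smooth_map_on_ident
        smooth_map_on_linear_compose[OF lD] T)
  then have H: "Ck_on k U H" for k by (rule smooth_map_on_imp_Ck[OF U(1)])
  have bD: "bounded_linear D" using lD linear_conv_bounded_linear by blast
  have "(H has_derivative (\<lambda>v. D (D v) + ((v - D v) - D (v - D v)))) (at q)"
    unfolding H_def
    by (intro has_derivative_add has_derivative_diff has_derivative_ident
        bounded_linear.has_derivative[OF bD] D)
  then have "(H has_derivative (\<lambda>v. v)) (at q)" by (simp add: DD linear_diff[OF lD])
  then have "frechet_derivative H (at q) = (\<lambda>v. v)" by (metis frechet_derivative_at)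
  then have "inj (frechet_derivative H (at q))" by simp
  then obtain U' V g where *: "open U'" "U' \<subseteq> U" "q \<in> U'" "open V" "homeomorphism U' V H g"
    "\<And>k. Ck_on k V g"
    by (rule smooth_inverse_function[OF U H]) blast
  \<comment> \<open>If \<open>H x\<close> lies in the range of \<open>D\<close>, then
    \<open>H\<close> takes the same value at \<open>x\<close> and \<open>T x\<close>; both must lie
    in \<open>U'\<close> for injectivity to give \<open>T x = x\<close>.\<close>
  define B where "B = U' \<inter> T -` U'"
  have cT: "continuous_on U' T" using smooth_map_on_continuous[OF T(1)] *(2) continuous_on_subset by blast
  have oB: "open B" unfolding B_def using *(1) cT by (intro continuous_open_preimage)
  define C where "C = V \<inter> g -` B"
  have oC: "open C" unfolding C_def
    using *(4,5) oB by (intro continuous_open_preimage) (auto simp: homeomorphism_def)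
  have hom: "homeomorphism B C H g"
    by (rule homeomorphism_of_subsets[OF *(5)]) (use *(5) in \<open>auto simp: B_def C_def homeomorphism_def image_iff\<close>)
  have inj: "x = y" if "x \<in> U'" "y \<in> U'" "H x = H y" for x y
    using that *(5) by (metis homeomorphism_apply1)
  show ?thesis
  proof (rule chart_at_flat[OF oB hom oC])
    show "Ck_on k B H" for k using H *(2) by (auto intro: Ck_on_subset simp: B_def)
    show "Ck_on k C g" for k using *(6) by (auto intro: Ck_on_subset simp: C_def)
    show "q \<in> B" using *(3) T(4) by (simp add: B_def)
    show "(H x \<in> range D) = (x \<in> {x \<in> U. T x = x})" if x: "x \<in> B" for x
    proof
      assume "H x \<in> range D"
      then have "H x = D (H x)" using DD by auto
      also have "\<dots> = D (T x)"
        by (simp add: H_def linear_add[OF lD] linear_diff[OF lD] DD)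
      also have "\<dots> = H (T x)" using T(3)[of x] x *(2) linear_0[OF lD] by (auto simp: H_def B_def)
      finally have "x = T x" using inj x by (auto simp: B_def)
      then show "x \<in> {x \<in> U. T x = x}" using x *(2) by (auto simp: B_def)
    next
      assume "x \<in> {x \<in> U. T x = x}"
      then show "H x \<in> range D" by (auto simp: H_def linear_0[OF lD])
    qed
  qed (use U T in auto)
qed

lemma has_vector_derivative_chain:
  assumes "(c has_vector_derivative v) (at t)" "(F has_derivative F') (at (c t))"
  shows "((\<lambda>t. F (c t)) has_vector_derivative F' v) (at t)"
  using has_derivative_compose[OF assms(1)[unfolded has_vector_derivative_def] assms(2)]
    linear_scale[OF has_derivative_linear[OF assms(2)]]
  by (simp add: has_vector_derivative_def)

lemma smooth_map_on_imp_has_derivative: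
  assumes "open S" "smooth_map_on S f" "x \<in> S"
  obtains D where "(f has_derivative D) (at x)"
  using smooth_map_on_differentiable[OF assms] unfolding differentiable_def by blast

text \<open>A linear projection onto \<open>K\<close> fixes the curve near 0, hence fixes its
  velocity.\<close>

lemma has_vector_derivative_subspace:
  fixes K :: "'a::euclidean_space set"
  assumes K: "subspace K" and c: "(c has_vector_derivative v) (at (0::real))"
    and I: "open I" "0 \<in> I" "\<And>t. t \<in> I \<Longrightarrow> c t \<in> K"
  shows "v \<in> K"
proof -
  obtain \<pi> where pi: "linear \<pi>" "range \<pi> \<subseteq> K" "\<And>x. x \<in> K \<Longrightarrow> \<pi> x = x"
    using linear_exists_left_inverse_on[OF linear_id K] by auto
  have "(\<pi> has_derivative \<pi>) (at (c 0))"
    using pi(1) by (simp add: linear_conv_bounded_linear bounded_linear_imp_has_derivative)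
  from has_vector_derivative_chain[OF c this]
  have "(c has_vector_derivative \<pi> v) (at 0)"
    by (rule has_vector_derivative_transform_within_open[OF _ I(1,2)]) (simp add: I pi)
  then have "v = \<pi> v" using c vector_derivative_unique_at by blast
  then show ?thesis using pi(2) by auto
qed

lemma real_open_interval_0:
  assumes "open (I::real set)" "0 \<in> I"
  obtains \<epsilon> where "\<epsilon> > 0" "{-\<epsilon><..<\<epsilon>} \<subseteq> I"
proof -
  obtain \<epsilon> where "\<epsilon> > 0" "ball 0 \<epsilon> \<subseteq> I" using assms openE by blast
  moreover have "ball 0 \<epsilon> = {-\<epsilon><..<\<epsilon>}" by (auto simp: ball_def dist_real_def)
  ultimately show thesis using that by auto
qed


text \<open>A slice \<open>{x \<in> U. s x = x}\<close> is the image of the smooth retraction \<open>s\<close>, hence flat in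
  a chart.  Its dimension is found by identifying the kernel of the derivative of \<open>s\<close> with
  the span of \<open>G\<close>, the tangent space of the fibre of \<open>s\<close> through \<open>q\<close>.\<close>

lemma chart_at_slice:
  fixes E :: "'a::euclidean_space set" and K :: "'b::euclidean_space set" and L :: "'c::euclidean_space set"
  assumes E: "chart_at K E q" and K: "subspace K"
    and U: "openin (top_of_set E) U" "q \<in> U" and s: "smooth_map_on U s" "s ` U \<subseteq> U"
      "\<And>x. x \<in> U \<Longrightarrow> s (s x) = s x" "s q = q"
    and fibre: "\<And>v. v \<in> G \<Longrightarrow> \<exists>c \<epsilon>. \<epsilon> > (0::real) \<and> continuous_on {-\<epsilon><..<\<epsilon>} c \<and> c ` {-\<epsilon><..<\<epsilon>} \<subseteq> U \<and> c 0 = q \<and>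
      (\<forall>t\<in>{-\<epsilon><..<\<epsilon>}. s (c t) = q) \<and> (c has_vector_derivative v) (at 0)"
    and kernel: "\<And>y \<epsilon> v. \<epsilon> > (0::real) \<Longrightarrow> smooth_map_on {-\<epsilon><..<\<epsilon>} y \<Longrightarrow> y ` {-\<epsilon><..<\<epsilon>} \<subseteq> U \<Longrightarrow>
      y 0 = q \<Longrightarrow> (y has_vector_derivative v) (at 0) \<Longrightarrow>
      ((\<lambda>t. s (y t)) has_vector_derivative 0) (at 0) \<Longrightarrow> v \<in> span G"
    and L: "subspace L" "dim L = dim K - dim G"
  shows "chart_at L {x \<in> U. s x = x} q"
proof -
  obtain W V f g where c: "q \<in> W" "openin (top_of_set E) W" "openin (top_of_set K) V"
    "smooth_map_on W f" "smooth_map_on V g" "f ` W \<subseteq> V" "g ` V \<subseteq> W"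
    "\<And>x. x \<in> W \<Longrightarrow> g (f x) = x" "\<And>y. y \<in> V \<Longrightarrow> f (g y) = y"
    using chart_atE[OF E] by blast
  have VK: "V \<subseteq> K" using c(3) openin_imp_subset by blast
  obtain \<pi> where pi: "linear \<pi>" "range \<pi> \<subseteq> K" "\<And>x. x \<in> K \<Longrightarrow> \<pi> x = x"
    using linear_exists_left_inverse_on[OF linear_id K] by auto
  \<comment> \<open>Coordinates of points of \<open>U\<close> whose retract falls back into the
    chart domain, so that \<open>s\<close> can be written in coordinates.\<close>
  define V' where "V' = {y \<in> V. g y \<in> U \<and> s (g y) \<in> W}"
  have "openin (top_of_set K) V'"
  proof -
    have "openin (top_of_set U) (U \<inter> s -` W)"
    proof -
      have "openin (top_of_set U) (U \<inter> W)"
        using c(2) U(1) by (metis inf_le1 openin_Int openin_imp_subset openin_subset_trans)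
      then have "openin (top_of_set U) (U \<inter> s -` (U \<inter> W))"
        by (intro continuous_openin_preimage[OF smooth_map_on_continuous[OF s(1)]]) (use s(2) in auto)
      moreover have "U \<inter> s -` (U \<inter> W) = U \<inter> s -` W" using s(2) by auto
      ultimately show ?thesis by simp
    qed
    then have "openin (top_of_set E) (U \<inter> s -` W)" using U(1) openin_trans by blast
    then have "openin (top_of_set W) (W \<inter> (U \<inter> s -` W))"
      by (metis c(2) inf_le1 openin_Int openin_imp_subset openin_subset_trans)
    then have "openin (top_of_set V) (V \<inter> g -` (W \<inter> (U \<inter> s -` W)))"
      by (intro continuous_openin_preimage[OF smooth_map_on_continuous[OF c(5)]]) (use c(7) in auto)
    moreover have "V \<inter> g -` (W \<inter> (U \<inter> s -` W)) = V'" using c(7) by (auto simp: V'_def)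
    ultimately show ?thesis using c(3) openin_trans by metis
  qed
  then obtain O' where O': "open O'" "V' = K \<inter> O'" by (auto simp: openin_open)
  \<comment> \<open>\<open>V'\<close> is open only relative to \<open>K\<close>; precomposing with
    the projection \<open>\<pi>\<close> gives a retraction on an open subset of the ambient space,
    as \<open>chart_at_retract\<close> demands.\<close>
  define \<Omega> where "\<Omega> = \<pi> -` O'"
  have cpi: "continuous_on UNIV \<pi>"
    using pi(1) linear_continuous_on linear_conv_bounded_linear by blast
  have \<Omega>: "open \<Omega>" unfolding \<Omega>_def by (rule open_vimage[OF O'(1) cpi])
  have \<Omega>_iff: "x \<in> \<Omega> \<longleftrightarrow> \<pi> x \<in> V'" for x using pi(2) O'(2) by (auto simp: \<Omega>_def)
  define T where "T = (\<lambda>x. f (s (g (\<pi> x))))"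
  have T_V: "T x = f (s (g x))" if "x \<in> V'" for x using that O'(2) pi(3) by (simp add: T_def)
  have V'\<Omega>: "V' \<subseteq> \<Omega>" using O'(2) pi(3) by (auto simp: \<Omega>_def)
  have fV': "f x \<in> V'" if "x \<in> W" "x \<in> U" "s x \<in> W" for x
    using that c(6,8) by (auto simp: V'_def image_subset_iff)
  have TV': "T x \<in> V'" "T (T x) = T x" if "x \<in> \<Omega>" for x
  proof -
    let ?y = "s (g (\<pi> x))"
    have "?y \<in> W" "?y \<in> U" "s ?y = ?y"
      using that s(2,3) by (auto simp: \<Omega>_iff V'_def image_subset_iff)
    moreover have "T x = f ?y" by (simp add: T_def)
    ultimately show "T x \<in> V'" "T (T x) = T x"
      using fV'[of ?y] c(8)[of ?y] T_V by auto
  qed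
  have sT: "smooth_map_on \<Omega> T" unfolding T_def
    by (rule smooth_map_on_compose[OF _ c(4)], rule smooth_map_on_compose[OF _ s(1)],
        rule smooth_map_on_compose[OF smooth_map_on_linear[OF pi(1)] c(5)])
      (auto simp: \<Omega>_iff V'_def)
  define q0 where "q0 = f q"
  have q0: "q0 \<in> V'" "g q0 = q" "q0 \<in> V" "q0 \<in> K" "q0 \<in> \<Omega>"
    using fV'[of q] c(1,8) U(2) s(4) V'\<Omega> O'(2) by (auto simp: q0_def V'_def)
  have Tq0: "T q0 = q0" using q0 s(4) by (simp add: T_V q0_def)
  obtain P where P: "(T has_derivative P) (at q0)"
    by (rule smooth_map_on_imp_has_derivative[OF \<Omega> sT q0(5)]) blast
  have lP: "linear P" using P by (rule has_derivative_linear)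
  have Z: "chart_at (range P) {x \<in> \<Omega>. T x = x} q0"
    by (rule chart_at_retract[OF \<Omega> q0(5) sT _ TV'(2) Tq0 P]) (use TV' V'\<Omega> in auto)
  have rP: "range P = P ` K"
  proof -
    have "(\<pi> has_derivative \<pi>) (at q0)"
      using pi(1) by (simp add: linear_conv_bounded_linear bounded_linear_imp_has_derivative)
    then have d: "((\<lambda>x. T (\<pi> x)) has_derivative (\<lambda>v. P (\<pi> v))) (at q0)"
      by (rule has_derivative_compose) (simp add: pi(3) q0 P)
    have "T (\<pi> x) = T x" for x using pi(3)[OF subsetD[OF pi(2) rangeI]] by (simp add: T_def)
    then have e: "(\<lambda>x. T (\<pi> x)) = T" by (rule ext)
    have "P = (\<lambda>v. P (\<pi> v))" by (rule has_derivative_unique[OF P d[unfolded e]])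
    then have "P v = P (\<pi> v)" for v by (rule fun_cong)
    then show ?thesis using pi(2) by blast
  qed
  \<comment> \<open>\<open>g\<close> and \<open>f\<close> live on relatively open sets and need not
    have ambient derivatives; velocities are computed with the local extensions
    \<open>\<Gamma>'\<close> and \<open>\<Phi>'\<close>.\<close>
  obtain A \<Gamma>' where A: "open A" "q0 \<in> A" "smooth_map_on A \<Gamma>'" "\<And>y. y \<in> V \<Longrightarrow> y \<in> A \<Longrightarrow> g y = \<Gamma>' y"
    using smooth_map_on_extendE[OF c(5) q0(3)] by metis
  obtain \<Gamma> where \<Gamma>: "(\<Gamma>' has_derivative \<Gamma>) (at q0)"
    by (rule smooth_map_on_imp_has_derivative[OF A(1,3,2)]) blast
  have l\<Gamma>: "linear \<Gamma>" using \<Gamma> by (rule has_derivative_linear)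
  obtain B \<Phi>' where B: "open B" "q \<in> B" "smooth_map_on B \<Phi>'" "\<And>y. y \<in> W \<Longrightarrow> y \<in> B \<Longrightarrow> f y = \<Phi>' y"
    using smooth_map_on_extendE[OF c(4,1)] by metis
  obtain \<Phi> where \<Phi>: "(\<Phi>' has_derivative \<Phi>) (at q)"
    by (rule smooth_map_on_imp_has_derivative[OF B(1,3,2)]) blast
  have line: "((\<lambda>t. q0 + t *\<^sub>R h) has_vector_derivative h) (at 0)" for h
    by (auto intro!: derivative_eq_intros)
  have sline: "smooth_map_on I (\<lambda>t::real. q0 + t *\<^sub>R h)" for I h
    by (intro smooth_map_on_add smooth_map_on_scaleR smooth_map_on_const smooth_map_on_ident)
  have open_line: "open ((\<lambda>t::real. q0 + t *\<^sub>R h) -` X)" if "open X" for h X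
    by (rule open_vimage[OF that]) (intro continuous_intros)
  have lineK: "q0 + t *\<^sub>R h \<in> K" if "h \<in> K" for t h
    using that K q0(4) by (simp add: subspace_add subspace_scale)
  have \<Gamma>' : "\<Gamma>' q0 = q" using A q0 by metis
  \<comment> \<open>Along a straight line inside \<open>K\<close> the two extensions reduce to the
    mutually inverse chart maps. This makes \<open>\<Gamma>\<close> injective on
    \<open>K\<close>.\<close>
  have \<Phi>\<Gamma>: "\<Phi> (\<Gamma> h) = h" if h: "h \<in> K" for h
  proof -
    let ?I = "(\<lambda>t::real. q0 + t *\<^sub>R h) -` (O' \<inter> (A \<inter> \<Gamma>' -` B))"
    have "open (A \<inter> \<Gamma>' -` B)"
      by (intro continuous_open_preimage smooth_map_on_continuous A B)
    then have I: "open ?I" by (intro open_line open_Int[OF O'(1)])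
    have 0: "0 \<in> ?I" using q0(1) O'(2) A(2) B(2) \<Gamma>' by simp
    have "((\<lambda>t. \<Phi>' (\<Gamma>' (q0 + t *\<^sub>R h))) has_vector_derivative \<Phi> (\<Gamma> h)) (at 0)"
      by (intro has_vector_derivative_chain[where F = \<Phi>'] has_vector_derivative_chain[where F = \<Gamma>'] line)
         (use \<Gamma> \<Phi> \<Gamma>' in simp_all)
    then have "((\<lambda>t. q0 + t *\<^sub>R h) has_vector_derivative \<Phi> (\<Gamma> h)) (at 0)"
    proof (rule has_vector_derivative_transform_within_open[OF _ I 0])
      fix t assume t: "t \<in> ?I"
      let ?y = "q0 + t *\<^sub>R h"
      have y: "?y \<in> V" "?y \<in> A" "\<Gamma>' ?y \<in> B" using lineK[OF h] t O'(2) by (auto simp: V'_def)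
      then have "\<Gamma>' ?y = g ?y" "g ?y \<in> W" using A(4) c(7) by auto
      then show "\<Phi>' (\<Gamma>' ?y) = ?y" using y B(4)[of "g ?y"] c(9) by simp
    qed
    then show ?thesis using line vector_derivative_unique_at by blast
  qed
  \<comment> \<open>Carried isomorphically onto \<open>span G\<close> by \<open>\<Gamma>\<close>;
    rank-nullity for \<open>P\<close> on \<open>K\<close> then gives the dimension of the
    slice.\<close>
  define N where "N = {v \<in> K. P v = 0}"
  have sN: "subspace N" unfolding N_def using K lP
    by (auto simp: subspace_def linear_0 linear_add linear_scale)
  have injN: "inj_on \<Gamma> N" by (rule inj_on_inverseI[of _ \<Phi>]) (auto simp: N_def \<Phi>\<Gamma>)
  have "\<Gamma> ` N = span G"
  proof
    show "\<Gamma> ` N \<subseteq> span G"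
    proof (rule image_subsetI)
      fix h assume "h \<in> N"
      then have h: "h \<in> K" "P h = 0" by (auto simp: N_def)
      \<comment> \<open>A line in a direction killed by \<open>P\<close> gives a curve whose retract
        has velocity \<open>\<Gamma> (P h) = 0\<close>, the situation of
        \<open>kernel\<close>.\<close>
      let ?l = "\<lambda>t::real. q0 + t *\<^sub>R h"
      have "continuous_on \<Omega> T" by (rule smooth_map_on_continuous[OF sT])
      then have "open (\<Omega> \<inter> T -` A)" by (rule continuous_open_preimage[OF _ \<Omega> A(1)])
      then have "open (?l -` (O' \<inter> A \<inter> (\<Omega> \<inter> T -` A)))"
        by (intro open_line open_Int[OF open_Int[OF O'(1) A(1)]])
      moreover have "0 \<in> ?l -` (O' \<inter> A \<inter> (\<Omega> \<inter> T -` A))" using q0 O'(2) A(2) Tq0 by simp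
      ultimately obtain \<epsilon> where e: "\<epsilon> > 0" "{-\<epsilon><..<\<epsilon>} \<subseteq> ?l -` (O' \<inter> A \<inter> (\<Omega> \<inter> T -` A))"
        by (rule real_open_interval_0)
      have t: "?l t \<in> V'" "?l t \<in> V" "?l t \<in> A" "?l t \<in> \<Omega>" "T (?l t) \<in> A" if "t \<in> {-\<epsilon><..<\<epsilon>}" for t
      proof -
        have "?l t \<in> O' \<inter> A \<inter> (\<Omega> \<inter> T -` A)" using that e by blast
        then show "?l t \<in> V'" "?l t \<in> V" "?l t \<in> A" "?l t \<in> \<Omega>" "T (?l t) \<in> A"
          using lineK[OF h(1)] O'(2) by (auto simp: V'_def)
      qed
      have I: "open {-\<epsilon><..<\<epsilon>}" "0 \<in> {-\<epsilon><..<\<epsilon>}" using e(1) by auto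
      show "\<Gamma> h \<in> span G"
      proof (rule kernel[OF e(1), of "\<lambda>t. g (?l t)"])
        show "smooth_map_on {- \<epsilon><..<\<epsilon>} (\<lambda>t. g (?l t))"
          by (rule smooth_map_on_compose[OF sline c(5)]) (use t in auto)
        show "(\<lambda>t. g (?l t)) ` {- \<epsilon><..<\<epsilon>} \<subseteq> U" using t(1) by (auto simp: V'_def)
        show "g (?l 0) = q" using q0 by simp
        have "((\<lambda>t. \<Gamma>' (?l t)) has_vector_derivative \<Gamma> h) (at 0)"
          by (rule has_vector_derivative_chain[OF line]) (simp add: \<Gamma>)
        then show "((\<lambda>t. g (?l t)) has_vector_derivative \<Gamma> h) (at 0)"
          by (rule has_vector_derivative_transform_within_open[OF _ I]) (simp add: A(4) t)
        have "((\<lambda>t. \<Gamma>' (T (?l t))) has_vector_derivative \<Gamma> (P h)) (at 0)"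
          by (intro has_vector_derivative_chain[where F = \<Gamma>'] has_vector_derivative_chain[where F = T] line)
             (use P \<Gamma> Tq0 in simp_all)
        then have "((\<lambda>t. s (g (?l t))) has_vector_derivative \<Gamma> (P h)) (at 0)"
        proof (rule has_vector_derivative_transform_within_open[OF _ I])
          fix u assume u: "u \<in> {- \<epsilon><..<\<epsilon>}"
          have "\<Gamma>' (T (?l u)) = g (T (?l u))"
            using A(4)[of "T (?l u)"] t[OF u] TV'(1)[of "?l u"] by (simp add: V'_def)
          then show "\<Gamma>' (T (?l u)) = s (g (?l u))"
            using t(1)[OF u] c(8) by (simp add: T_V) (simp add: V'_def)
        qed
        then show "((\<lambda>t. s (g (?l t))) has_vector_derivative 0) (at 0)"
          using h(2) linear_0[OF l\<Gamma>] by simp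
      qed
    qed
    have "G \<subseteq> \<Gamma> ` N"
    proof
      fix v assume "v \<in> G"
      then obtain a \<epsilon> where a: "\<epsilon> > (0::real)" "continuous_on {-\<epsilon><..<\<epsilon>} a" "a ` {-\<epsilon><..<\<epsilon>} \<subseteq> U" "a 0 = q"
        "\<And>t. t\<in>{-\<epsilon><..<\<epsilon>} \<Longrightarrow> s (a t) = q" "(a has_vector_derivative v) (at 0)"
        using fibre by meson
      obtain O2 where O2: "open O2" "W = E \<inter> O2" using c(2) by (auto simp: openin_open)
      have UE: "U \<subseteq> E" using U(1) openin_imp_subset by blast
      let ?J = "O2 \<inter> (B \<inter> \<Phi>' -` A)"
      let ?I = "{-\<epsilon><..<\<epsilon>} \<inter> a -` ?J"
      have "open (B \<inter> \<Phi>' -` A)"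
        by (intro continuous_open_preimage smooth_map_on_continuous A B)
      then have I: "open ?I"
        by (intro continuous_open_preimage[OF a(2)] open_Int[OF O2(1)]) auto
      have \<Phi>'q: "\<Phi>' q = q0" using B c(1) by (metis q0_def)
      have 0: "0 \<in> ?I" using a c(1) B(2) A(2) \<Phi>'q O2(2) by simp
      have t: "\<Phi>' (a t) = f (a t)" "f (a t) \<in> V'" "f (a t) \<in> A" "g (f (a t)) = a t" "s (a t) = q"
        if t: "t \<in> ?I" for t
      proof -
        have at: "a t \<in> U" "a t \<in> W" "a t \<in> B" "s (a t) = q" "\<Phi>' (a t) \<in> A"
          using t a(3,5) UE O2(2) by (auto simp: image_subset_iff subset_iff)
        then show "\<Phi>' (a t) = f (a t)" "f (a t) \<in> V'" "f (a t) \<in> A" "g (f (a t)) = a t" "s (a t) = q"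
          using B(4)[of "a t"] fV'[of "a t"] c(1) c(8)[of "a t"] by auto
      qed
      let ?h = "\<Phi> v"
      have d1: "((\<lambda>t. \<Phi>' (a t)) has_vector_derivative ?h) (at 0)"
        by (rule has_vector_derivative_chain[OF a(6)]) (simp add: \<Phi> a(4))
      have hK: "?h \<in> K"
        by (rule has_vector_derivative_subspace[OF K d1 I 0]) (use t O'(2) in auto)
      have "((\<lambda>t. \<Gamma>' (\<Phi>' (a t))) has_vector_derivative \<Gamma> ?h) (at 0)"
        by (rule has_vector_derivative_chain[OF d1]) (simp add: \<Gamma> a(4) \<Phi>'q)
      then have "(a has_vector_derivative \<Gamma> ?h) (at 0)"
        by (rule has_vector_derivative_transform_within_open[OF _ I 0])
           (use t A(4) in \<open>auto simp: V'_def\<close>)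
      then have \<Gamma>h: "\<Gamma> ?h = v" using a(6) vector_derivative_unique_at by blast
      \<comment> \<open>Along the fibre \<open>s\<close> is constantly \<open>q\<close>, so
        \<open>T\<close> is constantly \<open>q0\<close> in coordinates and \<open>P\<close>
        annihilates the velocity.\<close>
      have "((\<lambda>t. T (\<Phi>' (a t))) has_vector_derivative P ?h) (at 0)"
        by (rule has_vector_derivative_chain[OF d1]) (simp add: P a(4) \<Phi>'q)
      then have "((\<lambda>t. q0) has_vector_derivative P ?h) (at 0)"
      proof (rule has_vector_derivative_transform_within_open[OF _ I 0])
        fix u assume "u \<in> ?I"
        from t[OF this] show "T (\<Phi>' (a u)) = q0" by (simp add: T_V q0_def)
      qed
      then have "P ?h = 0" using has_vector_derivative_const vector_derivative_unique_at by blast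
      then show "v \<in> \<Gamma> ` N" using \<Gamma>h hK by (auto simp: N_def intro!: image_eqI[of v \<Gamma> ?h])
    qed
    then show "span G \<subseteq> \<Gamma> ` N"
      using linear_subspace_image[OF l\<Gamma> sN] by (rule span_minimal)
  qed
  then have "dim (span G) = dim N"
    using dim_image_eq[OF l\<Gamma>, of N] injN sN by (metis span_eq_iff)
  then have "dim (range P) = dim L"
    using dim_image_kernel_subspace[OF lP K] L(2) rP by (simp add: N_def)
  then have Z: "chart_at L {x \<in> \<Omega>. T x = x} q0"
    using chart_at_change_space[OF Z _ L(1)] lP linear_subspace_image subspace_UNIV by blast
  let ?S = "{x \<in> U. s x = x}"
  show ?thesis
  proof (rule chart_at_transfer[of L "{x \<in> \<Omega>. T x = x}" f q ?S "W \<inter> ?S" g])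
    show "chart_at L {x \<in> \<Omega>. T x = x} (f q)" using Z by (simp add: q0_def)
    have "?S \<subseteq> E" using U(1) openin_imp_subset by blast
    then show "openin (top_of_set ?S) (W \<inter> ?S)"
      using c(2) by (auto simp: openin_open)
    show "smooth_map_on (W \<inter> ?S) f" by (rule smooth_map_on_subset[OF c(4)]) auto
    have Z': "x \<in> V'" if "x \<in> \<Omega>" "T x = x" for x using TV'(1) that by metis
    then show "smooth_map_on {x \<in> \<Omega>. T x = x} g"
      by (intro smooth_map_on_subset[OF c(5)]) (auto simp: V'_def)
    show "f ` (W \<inter> ?S) \<subseteq> {x \<in> \<Omega>. T x = x}"
    proof (rule image_subsetI)
      fix x assume x: "x \<in> W \<inter> ?S"
      then have "f x \<in> V'" using fV' by simp
      then show "f x \<in> {x \<in> \<Omega>. T x = x}" using x V'\<Omega> c(8) by (auto simp: T_V)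
    qed
    show "g ` {x \<in> \<Omega>. T x = x} \<subseteq> W \<inter> ?S"
    proof (rule image_subsetI)
      fix y assume "y \<in> {x \<in> \<Omega>. T x = x}"
      then have y: "y \<in> V'" "T y = y" using Z' by auto
      then have "f (s (g y)) = y" by (simp add: T_V)
      then have "g y = s (g y)" using c(8)[of "s (g y)"] y(1) by (simp add: V'_def)
      then show "g y \<in> W \<inter> ?S" using y(1) c(7) by (auto simp: V'_def)
    qed
    show "f (g y) = y" if "y \<in> {x \<in> \<Omega>. T x = x}" for y
      using that Z' c(9) by (auto simp: V'_def)
  qed (use c U s in auto)
qed

section \<open>Matrices and the unitary action\<close>

lemma has_derivative_vec_lambda:
  fixes f :: "'a::euclidean_space \<Rightarrow> 'i::finite \<Rightarrow> 'b::euclidean_space"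
  assumes "\<And>i. ((\<lambda>x. f x i) has_derivative (\<lambda>h. f' h i)) (at x)"
  shows "((\<lambda>x. \<chi> i. f x i) has_derivative (\<lambda>h. \<chi> i. f' h i)) (at x)"
proof -
  have s: "(\<chi> i. g i) = (\<Sum>i\<in>UNIV. axis i (g i))" for g :: "'i \<Rightarrow> 'b"
    by (auto simp: vec_eq_iff axis_def if_distrib sum.delta cong: if_cong)
  have "linear (axis i :: 'b \<Rightarrow> 'b^'i)" for i
    by (rule linearI) (auto simp: vec_eq_iff axis_def)
  then have "bounded_linear (axis i :: 'b \<Rightarrow> 'b^'i)" for i
    by (simp add: linear_conv_bounded_linear)
  then show ?thesis unfolding s
    by (intro has_derivative_sum bounded_linear.has_derivative[of "axis _"] assms)
qed

text \<open>Only real bilinearity is demanded, so the criterion also covers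
  \<open>herm_inner\<close> and \<open>outer\<close>, which are conjugate linear in the second
  argument.\<close>

lemma bounded_bilinear_euclideanI:
  fixes B :: "'a::euclidean_space \<Rightarrow> 'b::euclidean_space \<Rightarrow> 'c::euclidean_space"
  assumes "\<And>x x' y. B (x + x') y = B x y + B x' y" "\<And>x y y'. B x (y + y') = B x y + B x y'"
    and "\<And>c x y. B (c *\<^sub>R x) y = c *\<^sub>R B x y" "\<And>c x y. B x (c *\<^sub>R y) = c *\<^sub>R B x y"
  shows "bounded_bilinear B"
  unfolding bilinear_conv_bounded_bilinear[symmetric] bilinear_def
  using assms by (auto intro!: linearI)

lemma bounded_bilinear_matrix_mult:
  "bounded_bilinear ((**) :: complex^'d^'d \<Rightarrow> complex^'d^'d \<Rightarrow> complex^'d^'d)"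
  by (rule bounded_bilinear_euclideanI)
     (simp_all add: matrix_matrix_mult_def vec_eq_iff sum.distrib distrib_left distrib_right scaleR_sum_right)

lemma bounded_bilinear_matrix_vector_mult:
  "bounded_bilinear ((*v) :: complex^'d^'d \<Rightarrow> complex^'d \<Rightarrow> complex^'d)"
  by (rule bounded_bilinear_euclideanI)
     (simp_all add: matrix_vector_mult_def vec_eq_iff sum.distrib distrib_left distrib_right scaleR_sum_right)

lemma bounded_bilinear_vec_scale:
  "bounded_bilinear ((*s) :: complex \<Rightarrow> complex^'d \<Rightarrow> complex^'d)"
  by (rule bounded_bilinear_euclideanI)
     (simp_all add: vec_eq_iff distrib_left distrib_right)

lemma bounded_bilinear_herm_inner:
  "bounded_bilinear (herm_inner :: complex^'d \<Rightarrow> complex^'d \<Rightarrow> complex)"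
  by (rule bounded_bilinear_euclideanI)
     (simp_all add: herm_inner_def sum.distrib distrib_left distrib_right scaleR_sum_right)

lemma linear_conj_transpose: "linear (conj_transpose :: complex^'d^'d \<Rightarrow> complex^'d^'d)"
  by (rule linearI) (simp_all add: conj_transpose_def vec_eq_iff)

lemmas smooth_map_on_matrix_mult = smooth_map_on_bilinear[OF bounded_bilinear_matrix_mult]
lemmas smooth_map_on_matrix_vector_mult = smooth_map_on_bilinear[OF bounded_bilinear_matrix_vector_mult]
lemmas smooth_map_on_vec_scale = smooth_map_on_bilinear[OF bounded_bilinear_vec_scale]
lemmas smooth_map_on_herm_inner = smooth_map_on_bilinear[OF bounded_bilinear_herm_inner]
lemmas smooth_map_on_conj_transpose = smooth_map_on_linear_compose[OF linear_conj_transpose]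

section \<open>The Hermitian inner product, adjoints and rank one matrices\<close>

lemma herm_inner_scale [simp]:
  "herm_inner (c *s v) w = c * herm_inner v w" "herm_inner v (c *s w) = cnj c * herm_inner v w"
  by (simp_all add: herm_inner_def sum_distrib_left mult_ac)

lemma herm_inner_zero [simp]: "herm_inner 0 w = 0" "herm_inner v 0 = 0"
  by (simp_all add: herm_inner_def)

lemma herm_inner_add: "herm_inner (u + v) w = herm_inner u w + herm_inner v w"
  "herm_inner w (u + v) = herm_inner w u + herm_inner w v"
  by (simp_all add: herm_inner_def distrib_left distrib_right sum.distrib)

lemma herm_inner_diff: "herm_inner (u - v) w = herm_inner u w - herm_inner v w"
  by (simp add: herm_inner_def left_diff_distrib sum_subtractf)

lemma herm_inner_sum: "herm_inner (\<Sum>i\<in>I. f i) w = (\<Sum>i\<in>I. herm_inner (f i) w)"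
  by (induction I rule: infinite_finite_induct) (simp_all add: herm_inner_add)

lemma cnj_herm_inner: "cnj (herm_inner v w) = herm_inner w v"
  by (simp add: herm_inner_def mult.commute)

lemma herm_inner_eq_0_commute: "herm_inner v w = 0 \<longleftrightarrow> herm_inner w v = 0"
  by (metis cnj_herm_inner complex_cnj_zero)

lemma Re_herm_inner: "Re (herm_inner v w) = v \<bullet> w"
  by (simp add: herm_inner_def inner_vec_def inner_complex_def)

lemma herm_inner_self: "herm_inner v v = of_real ((norm v)\<^sup>2)"
proof (rule complex_eqI)
  show "Re (herm_inner v v) = Re (of_real ((norm v)\<^sup>2))"
    by (simp add: Re_herm_inner power2_norm_eq_inner)
  show "Im (herm_inner v v) = Im (of_real ((norm v)\<^sup>2))"
    by (simp add: herm_inner_def)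
qed

lemma herm_inner_self_eq_0 [simp]: "herm_inner v v = 0 \<longleftrightarrow> v = 0"
  by (simp add: herm_inner_self)

text \<open>Turns the phase condition on a lift of an edge into a real linear equation.\<close>

lemma Im_herm_inner: "Im (herm_inner v w) = v \<bullet> (\<i> *s w)"
  by (simp flip: Re_herm_inner)

lemma conj_transpose_mult: "conj_transpose (A ** B) = conj_transpose B ** conj_transpose A"
  by (simp add: conj_transpose_def matrix_matrix_mult_def vec_eq_iff mult.commute)

lemma conj_transpose_conj_transpose [simp]: "conj_transpose (conj_transpose A) = A"
  by (simp add: conj_transpose_def vec_eq_iff)

lemma conj_transpose_mat [simp]: "conj_transpose (mat c) = mat (cnj c)"
  by (auto simp: conj_transpose_def mat_def vec_eq_iff)

lemma herm_inner_adjoint: "herm_inner (A *v x) y = herm_inner x (conj_transpose A *v y)"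
proof -
  have "herm_inner (A *v x) y = (\<Sum>i\<in>UNIV. \<Sum>j\<in>UNIV. A$i$j * x$j * cnj (y$i))"
    by (simp add: herm_inner_def matrix_vector_mult_def sum_distrib_right)
  also have "\<dots> = (\<Sum>j\<in>UNIV. \<Sum>i\<in>UNIV. A$i$j * x$j * cnj (y$i))" by (rule sum.swap)
  also have "\<dots> = herm_inner x (conj_transpose A *v y)"
    by (simp add: herm_inner_def matrix_vector_mult_def conj_transpose_def sum_distrib_left mult_ac)
  finally show ?thesis .
qed

lemma conj_transpose_rank_one [simp]: "conj_transpose (rank_one w) = rank_one w"
  by (simp add: conj_transpose_def rank_one_def vec_eq_iff mult.commute)

lemma mat_vector_mult: "mat c *v (x :: complex^'d) = c *s x"
  by (simp add: mat_def matrix_vector_mult_def vec_eq_iff if_distrib[of "\<lambda>a. a * _"] cong: if_cong)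

lemma mat_mult_commute: "mat c ** (A :: complex^'d^'d) = A ** mat c"
  by (simp add: matrix_eq matrix_vector_mul_assoc[symmetric] mat_vector_mult vector_scalar_commute)

lemma mat_mult_mat: "mat a ** mat b = (mat (a * b) :: complex^'d^'d)"
  by (simp add: matrix_eq matrix_vector_mul_assoc[symmetric] mat_vector_mult)

lemma mat_inject: "(mat a :: complex^'d^'d) = mat b \<longleftrightarrow> a = b"
  by (auto simp: mat_def vec_eq_iff)

lemma rank_one_conj: "A ** rank_one w ** conj_transpose A = rank_one (A *v w)"
  by (simp add: matrix_eq matrix_vector_mul_assoc[symmetric] rank_one_mult vector_scalar_commute
      herm_inner_adjoint)

lemma rank_one_scale: "rank_one (c *s w) = mat (of_real ((cmod c)\<^sup>2)) ** rank_one w"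
  by (simp add: matrix_eq matrix_vector_mul_assoc[symmetric] rank_one_mult mat_vector_mult
      complex_norm_square[of c] vector_scalar_commute mult_ac del: of_real_power)

lemma rank_one_scaleR: "rank_one (c *\<^sub>R w) = c\<^sup>2 *\<^sub>R rank_one w"
  by (simp add: rank_one_def vec_eq_iff power2_eq_square)

text \<open>Expresses orthogonality of two lines by the edges themselves, free of the phases of the
  vectors.\<close>

lemma rank_one_mult_rank_one_eq_0:
  "rank_one v ** rank_one w = 0 \<longleftrightarrow> herm_inner v w = 0 \<or> v = 0 \<or> w = 0"
proof
  assume "rank_one v ** rank_one w = 0"
  then have "rank_one v *v (rank_one w *v w) = 0"
    by (simp add: matrix_vector_mul_assoc)
  then have "herm_inner w w * herm_inner w v = 0 \<or> v = 0"
    by (simp add: rank_one_mult vector_scalar_commute)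
  then show "herm_inner v w = 0 \<or> v = 0 \<or> w = 0" using herm_inner_eq_0_commute by auto
next
  assume "herm_inner v w = 0 \<or> v = 0 \<or> w = 0"
  then have "herm_inner w v = 0 \<or> v = 0 \<or> w = 0" using herm_inner_eq_0_commute by blast
  then show "rank_one v ** rank_one w = 0"
    by (auto simp: matrix_eq matrix_vector_mul_assoc[symmetric] rank_one_mult vector_scalar_commute
        vec.scale_eq_0_iff)
qed

lemma smooth_map_on_rank_one: "smooth_map_on S f \<Longrightarrow> smooth_map_on S (\<lambda>x. rank_one (f x))"
proof -
  assume f: "smooth_map_on S f"
  have "linear cnj" by (rule linearI) auto
  then show ?thesis unfolding rank_one_def
    by (intro smooth_map_on_vec_lambda smooth_map_on_mult smooth_map_on_linear_compose[of cnj]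
        smooth_map_on_vec_nth f)
qed

lemma matrix_mult_sum_left:
  fixes f :: "'i \<Rightarrow> complex^'d^'d" and A :: "complex^'d^'d"
  shows "(\<Sum>i\<in>I. f i) ** A = (\<Sum>i\<in>I. f i ** A)"
  by (rule bounded_bilinear.sum_left[OF bounded_bilinear_matrix_mult])

lemma matrix_mult_sum_right:
  fixes f :: "'i \<Rightarrow> complex^'d^'d" and A :: "complex^'d^'d"
  shows "A ** (\<Sum>i\<in>I. f i) = (\<Sum>i\<in>I. A ** f i)"
  by (rule bounded_bilinear.sum_right[OF bounded_bilinear_matrix_mult])

lemma matrix_vector_mult_sum_left:
  fixes f :: "'i \<Rightarrow> complex^'d^'d"
  shows "(\<Sum>i\<in>I. f i) *v x = (\<Sum>i\<in>I. f i *v x)"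
  by (rule bounded_bilinear.sum_left[OF bounded_bilinear_matrix_vector_mult])

text \<open>Conjugation of arbitrary tuples; \<open>conj_action\<close> is its extensional
  restriction to a set, which is awkward for calculus and composition.\<close>

definition act :: "complex^'d^'d \<Rightarrow> complex^'d^'d^'n \<Rightarrow> complex^'d^'d^'n" where
  "act A e = (\<chi> i. A ** e $ i ** conj_transpose A)"

lemma act_act: "act A (act B e) = act (A ** B) e"
  by (simp add: act_def conj_transpose_mult matrix_mul_assoc vec_eq_iff)

lemma act_1 [simp]: "act (mat 1) e = e"
  by (simp add: act_def vec_eq_iff)

lemma act_nth: "act A e $ i = A ** e $ i ** conj_transpose A"
  by (simp add: act_def)

lemma unitary_conj_transpose: "unitary A \<Longrightarrow> unitary (conj_transpose A)"
  by (simp add: unitary_def)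

lemma unitary_mult: "unitary A \<Longrightarrow> unitary B \<Longrightarrow> unitary (A ** B)"
  unfolding unitary_def conj_transpose_mult
  by (metis matrix_mul_assoc matrix_mul_lid)

lemma unitaryI: "A ** conj_transpose A = mat 1 \<Longrightarrow> unitary A"
  by (simp add: unitary_def matrix_left_right_inverse)

lemma unitary_1: "unitary (mat 1)"
  by (simp add: unitary_def)

lemma act_inverse: "unitary A \<Longrightarrow> act (conj_transpose A) (act A e) = e"
  "unitary A \<Longrightarrow> act A (act (conj_transpose A) e) = e"
  by (simp_all add: act_act unitary_def)

lemma unitary_herm_inner: "unitary A \<Longrightarrow> herm_inner (A *v x) (A *v y) = herm_inner x y"
  by (simp add: herm_inner_adjoint matrix_vector_mul_assoc unitary_def)

lemma unitary_norm: "unitary A \<Longrightarrow> norm (A *v x) = norm x"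
  using unitary_herm_inner[of A x x]
  by (metis herm_inner_self norm_ge_zero of_real_eq_iff power2_eq_imp_eq)

text \<open>A factor \<open>sqrt a\<close> absorbs the side-length into the vector, so that edges
  become values of the quadratic map \<open>rank_one\<close>.\<close>

lemma polygons_rank_one:
  assumes "\<And>i. r $ i > 0"
  shows "e \<in> polygons r \<longleftrightarrow> (\<forall>i. \<exists>w. e $ i = rank_one w \<and> (norm w)\<^sup>2 = r $ i)"
proof -
  have "X \<in> orbit_O a \<longleftrightarrow> (\<exists>w. X = rank_one w \<and> (norm w)\<^sup>2 = a)" if "a > 0"
    for a and X :: "complex^'b^'b"
  proof
    assume "X \<in> orbit_O a"
    then obtain w where w: "X = a *\<^sub>R rank_one w" "norm w = 1" by (auto simp: orbit_O_def)
    then show "\<exists>w. X = rank_one w \<and> (norm w)\<^sup>2 = a"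
      using that by (intro exI[of _ "sqrt a *\<^sub>R w"]) (simp add: rank_one_scaleR)
  next
    assume "\<exists>w. X = rank_one w \<and> (norm w)\<^sup>2 = a"
    then obtain w where w: "X = rank_one w" "(norm w)\<^sup>2 = a" by blast
    then have "X = a *\<^sub>R rank_one ((1 / norm w) *\<^sub>R w)" "norm ((1 / norm w) *\<^sub>R w) = 1"
      using that by (auto simp: rank_one_scaleR power_one_over)
    then show "X \<in> orbit_O a" unfolding orbit_O_def by blast
  qed
  with assms show ?thesis by (simp add: polygons_def)
qed

lemma act_polygons:
  assumes r: "\<And>i. r $ i > 0" and A: "unitary A" and e: "e \<in> polygons r"
  shows "act A e \<in> polygons r"
  unfolding polygons_rank_one[OF r]
proof
  fix i
  obtain w where "e $ i = rank_one w" "(norm w)\<^sup>2 = r $ i" using e polygons_rank_one[OF r] by blast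
  then show "\<exists>w. act A e $ i = rank_one w \<and> (norm w)\<^sup>2 = r $ i"
    using A by (intro exI[of _ "A *v w"]) (simp add: act_nth rank_one_conj unitary_norm)
qed

lemma act_closed_polygons:
  assumes r: "\<And>i. r $ i > 0" and A: "unitary A" and e: "e \<in> closed_polygons r"
  shows "act A e \<in> closed_polygons r"
proof -
  have "(\<Sum>i\<in>UNIV. act A e $ i) = A ** (\<Sum>i\<in>UNIV. e $ i) ** conj_transpose A"
    by (simp add: act_nth matrix_mult_sum_left matrix_mult_sum_right)
  also have "\<dots> = (\<Sum>i\<in>UNIV. e $ i)"
    using e A by (simp add: closed_polygons_def mat_mult_commute[symmetric] matrix_mul_assoc[symmetric])
      (simp add: unitary_def)
  finally show ?thesis using act_polygons[OF r A] e by (simp add: closed_polygons_def)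
qed

section \<open>Decomposability and irreducibility\<close>

abbreviation nondecomposable_polygons :: "real^'n \<Rightarrow> (complex^'d^'d^'n) set" where
  "nondecomposable_polygons r \<equiv> closed_polygons r - decomposable_polygons r"

abbreviation scale_factor :: "real^'n \<Rightarrow> 'd::finite itself \<Rightarrow> real" where
  "scale_factor r T \<equiv> (\<Sum>i\<in>UNIV. r $ i) / real CARD('d)"

lemma scale_factor_pos:
  fixes r :: "real^'n"
  assumes "\<And>i. r $ i > 0" shows "scale_factor r TYPE('d::finite) > 0"
  using assms by (intro divide_pos_pos sum_pos) auto

lemma sum_polygon:
  fixes e :: "complex^'d^'d^'n"
  assumes "e \<in> closed_polygons r"
  shows "(\<Sum>i\<in>UNIV. e $ i *v x) = of_real (scale_factor r TYPE('d)) *s x"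
  using assms by (simp add: closed_polygons_def matrix_vector_mult_sum_left[symmetric] mat_vector_mult)

lemma closed_polygonsE:
  fixes e :: "complex^'d^'d^'n"
  assumes "\<And>i. r $ i > 0" "e \<in> closed_polygons r"
  obtains w where "\<And>i. e $ i = rank_one (w i)" "\<And>i. (norm (w i))\<^sup>2 = r $ i" "\<And>i. w i \<noteq> 0"
proof -
  have "\<forall>i. \<exists>w. e $ i = rank_one w \<and> (norm w)\<^sup>2 = r $ i"
    using assms polygons_rank_one[OF assms(1)] by (auto simp: closed_polygons_def)
  then obtain w where w: "\<And>i. e $ i = rank_one (w i)" "\<And>i. (norm (w i))\<^sup>2 = r $ i" by metis
  moreover have "w i \<noteq> 0" for i
    using w(2)[of i] assms(1)[of i] by auto
  ultimately show thesis using that by blast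
qed

text \<open>For polygons: disconnectedness of the graph that joins \<open>i\<close> and
  \<open>j\<close> when the lines of \<open>e $ i\<close> and \<open>e $ j\<close> are not
  orthogonal. Unlike \<open>decomposable\<close> it involves no subspaces, and its negation is
  visibly open.\<close>

definition splits :: "complex^'d^'d^'n \<Rightarrow> bool" where
  "splits e \<longleftrightarrow> (\<exists>I. I \<noteq> {} \<and> I \<noteq> UNIV \<and> (\<forall>i\<in>I. \<forall>j\<in>-I. e $ i ** e $ j = 0))"

lemma vec_subspace_orthogonal: "vec.subspace {v. \<forall>w\<in>S. herm_inner v w = 0}"
  by (auto simp: vec.subspace_def herm_inner_add)

lemma vec_subspace_scaleD:
  fixes x :: "complex^'d"
  assumes "vec.subspace S" "c *s x \<in> S" "c \<noteq> 0" shows "x \<in> S"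
  using vec.subspace_scale[OF assms(1,2), of "inverse c"] assms(3) by simp

text \<open>The spans of the vectors on the two sides are orthogonal. The closing condition, with
  nonzero scalar \<open>\<Lambda>\<close>, recovers each \<open>x\<close> from the two partial sums,
  so the spans fill the space. On either span the other partial sum vanishes, which makes its own
  one multiplication by \<open>\<Lambda>\<close>.\<close>

lemma decomposable_if_splits:
  fixes e :: "complex^'d^'d^'n"
  assumes r: "\<And>i. r $ i > 0" and e: "e \<in> closed_polygons r" and "splits e"
  shows "decomposable e"
proof -
  obtain w where w: "\<And>i. e $ i = rank_one (w i)" "\<And>i. w i \<noteq> 0"
    using closed_polygonsE[OF r e] by metis
  obtain I where I: "I \<noteq> {}" "I \<noteq> UNIV" "\<And>i j. i \<in> I \<Longrightarrow> j \<notin> I \<Longrightarrow> e $ i ** e $ j = 0"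
    using assms(3) by (auto simp: splits_def)
  have orth: "herm_inner (w i) (w j) = 0" if "i \<in> I" "j \<notin> I" for i j
    using I(3)[OF that] w by (simp add: rank_one_mult_rank_one_eq_0)
  define V1 where "V1 = vec.span (w ` I)"
  define V2 where "V2 = vec.span (w ` (-I))"
  have s: "vec.subspace V1" "vec.subspace V2" by (simp_all add: V1_def V2_def)
  have 1: "herm_inner v (w j) = 0" if "v \<in> V1" "j \<notin> I" for v j
    using vec.span_minimal[OF _ vec_subspace_orthogonal[of "w ` (- I)"], of "w ` I"] that orth
    unfolding V1_def by auto
  have 2: "herm_inner v u = 0" if "v \<in> V1" "u \<in> V2" for u v
  proof -
    have "w ` (- I) \<subseteq> {u. \<forall>v\<in>V1. herm_inner u v = 0}"
      using 1 herm_inner_eq_0_commute by fastforce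
    then have "V2 \<subseteq> {u. \<forall>v\<in>V1. herm_inner u v = 0}"
      unfolding V2_def by (rule vec.span_minimal[OF _ vec_subspace_orthogonal])
    then show ?thesis using that herm_inner_eq_0_commute by blast
  qed
  define \<Lambda> where "\<Lambda> = complex_of_real (scale_factor r TYPE('d))"
  have \<Lambda>: "\<Lambda> \<noteq> 0" using scale_factor_pos[OF r, where 'd='d] unfolding \<Lambda>_def of_real_eq_0_iff by (rule less_imp_neq[symmetric])
  have ran1: "e $ i *v x \<in> V1" if "i \<in> I" for i x
    using that by (simp add: w rank_one_mult V1_def vec.span_base vec.span_scale)
  have ran2: "e $ i *v x \<in> V2" if "i \<notin> I" for i x
    using that by (simp add: w rank_one_mult V2_def vec.span_base vec.span_scale)
  have split: "(\<Sum>i\<in>I. e $ i *v x) + (\<Sum>i\<in>-I. e $ i *v x) = \<Lambda> *s x" for x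
    using sum_polygon[OF e, of x] sum.union_disjoint[of I "-I" "\<lambda>i. e $ i *v x"]
    by (simp add: \<Lambda>_def Compl_partition)
  have dec: "\<exists>v\<in>V1. \<exists>u\<in>V2. x = v + u" for x
  proof (intro bexI)
    have "inverse \<Lambda> *s (\<Lambda> *s x) = x" using \<Lambda> by simp
    then show "x = inverse \<Lambda> *s (\<Sum>i\<in>I. e $ i *v x) + inverse \<Lambda> *s (\<Sum>i\<in>-I. e $ i *v x)"
      by (simp add: split[symmetric] vector_add_ldistrib)
    show "inverse \<Lambda> *s (\<Sum>i\<in>I. e $ i *v x) \<in> V1"
      by (intro vec.subspace_scale vec.subspace_sum s ran1)
    show "inverse \<Lambda> *s (\<Sum>i\<in>-I. e $ i *v x) \<in> V2"
      by (intro vec.subspace_scale vec.subspace_sum s ran2) auto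
  qed
  have "V1 \<inter> V2 = {0}"
  proof -
    have "v = 0" if "v \<in> V1 \<inter> V2" for v using 2[of v v] that by simp
    then show ?thesis using vec.subspace_0 s by blast
  qed
  moreover have "{x + y |x y. x \<in> V1 \<and> y \<in> V2} = UNIV" using dec by fastforce
  ultimately have dims: "vec.dim V1 + vec.dim V2 = CARD('d)"
    using vec.dim_sums_Int[OF s] by (simp add: card_cart_basis)
  have "vec.dim V1 \<noteq> 0" "vec.dim V2 \<noteq> 0"
  proof -
    obtain i j where "i \<in> I" "j \<notin> I" using I(1,2) by auto
    then have "w i \<in> V1" "w j \<in> V2" by (auto simp: V1_def V2_def intro: vec.span_base)
    then show "vec.dim V1 \<noteq> 0" "vec.dim V2 \<noteq> 0" using w(2) by auto
  qed
  with dims have d: "1 \<le> vec.dim V2" "vec.dim V2 \<le> CARD('d) - 1" "vec.dim V1 = CARD('d) - vec.dim V2"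
    by linarith+
  have c1: "(\<Sum>i\<in>I. e $ i) *v v = \<Lambda> *s v" if "v \<in> V1" for v
  proof -
    have "(\<Sum>i\<in>-I. e $ i *v v) = 0"
      by (intro sum.neutral) (simp add: w rank_one_mult 1[OF that])
    then show ?thesis using split[of v] by (simp add: matrix_vector_mult_sum_left)
  qed
  have c2: "(\<Sum>i\<in>-I. e $ i) *v v = \<Lambda> *s v" if "v \<in> V2" for v
  proof -
    have "herm_inner v (w i) = 0" if "i \<in> I" for i
      using 2[of "w i" v] that \<open>v \<in> V2\<close> herm_inner_eq_0_commute[of v "w i"]
      by (auto simp: V1_def intro: vec.span_base)
    then have "(\<Sum>i\<in>I. e $ i *v v) = 0"
      by (intro sum.neutral) (simp add: w rank_one_mult)
    then show ?thesis using split[of v] by (simp add: matrix_vector_mult_sum_left)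
  qed
  show ?thesis unfolding decomposable_def
  proof (intro exI conjI)
    show "I \<union> - I = UNIV" "I \<inter> - I = {}" "I \<noteq> {}" "- I \<noteq> {}" using I by auto
    show "\<forall>v\<in>V1. (\<Sum>i\<in>I. e $ i) *v v = \<Lambda> *s v" "\<forall>v\<in>V2. (\<Sum>i\<in>- I. e $ i) *v v = \<Lambda> *s v"
      using c1 c2 by auto
    show "\<forall>i\<in>I. range ((*v) (e $ i)) \<subseteq> V1" "\<forall>i\<in>-I. range ((*v) (e $ i)) \<subseteq> V2"
      using ran1 ran2 by auto
    show "\<forall>v\<in>V1. \<forall>w\<in>V2. herm_inner v w = 0" "\<forall>x. \<exists>v\<in>V1. \<exists>w\<in>V2. x = v + w"
      using 2 dec by auto
  qed (use d s in auto)
qed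

text \<open>\<open>e $ i\<close> maps \<open>w i\<close> to a nonzero multiple of itself, so
  \<open>w i\<close> lies in the subspace containing the range; orthogonality of \<open>V1\<close>
  and \<open>V2\<close> kills the mixed products.\<close>

lemma splits_if_decomposable:
  fixes e :: "complex^'d^'d^'n"
  assumes r: "\<And>i. r $ i > 0" and e: "e \<in> closed_polygons r" and "decomposable e"
  shows "splits e"
proof -
  obtain w where w: "\<And>i. e $ i = rank_one (w i)" "\<And>i. w i \<noteq> 0"
    using closed_polygonsE[OF r e] by metis
  obtain V1 V2 :: "(complex^'d) set" and I J where V: "vec.subspace V1" "vec.subspace V2"
    "\<forall>v\<in>V1. \<forall>w\<in>V2. herm_inner v w = 0" and I: "I \<union> J = UNIV" "I \<inter> J = {}" "I \<noteq> {}" "J \<noteq> {}"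
    "\<forall>i\<in>I. range ((*v) (e $ i)) \<subseteq> V1" "\<forall>j\<in>J. range ((*v) (e $ j)) \<subseteq> V2"
    using assms(3) unfolding decomposable_def by (elim exE conjE) (rule that; assumption)
  have *: "w i \<in> S" if "vec.subspace S" "range ((*v) (e $ i)) \<subseteq> S" for i S
  proof -
    have "herm_inner (w i) (w i) *s w i \<in> S" using that(2) by (auto simp: w rank_one_mult)
    then show ?thesis by (rule vec_subspace_scaleD[OF that(1)]) (simp add: w(2))
  qed
  have "herm_inner (w i) (w j) = 0" if "i \<in> I" "j \<in> J" for i j
  proof -
    have "w i \<in> V1" "w j \<in> V2" using * V(1,2) bspec[OF I(5) that(1)] bspec[OF I(6) that(2)] by auto
    then show ?thesis using V(3) by blast
  qed
  then have "e $ i ** e $ j = 0" if "i \<in> I" "j \<in> J" for i j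
    using that by (simp add: w rank_one_mult_rank_one_eq_0)
  then show ?thesis using I(1-4) unfolding splits_def by (intro exI[of _ I]) auto
qed

lemma nondecomposable_polygons_iff:
  assumes "\<And>i. r $ i > 0"
  shows "e \<in> nondecomposable_polygons r \<longleftrightarrow> e \<in> closed_polygons r \<and> \<not> splits e"
  using decomposable_if_splits[OF assms] splits_if_decomposable[OF assms]
  by (auto simp: decomposable_polygons_def)

text \<open>There are finitely many index sets, and each contributes an open condition. Hence
  nondecomposable polygons are relatively open among the closed ones.\<close>

lemma open_not_splits: "open {e :: complex^'d^'d^'n. \<not> splits e}"
proof -
  have "{e :: complex^'d^'d^'n. \<not> splits e} =
      (\<Inter>I\<in>{I. I \<noteq> {} \<and> I \<noteq> UNIV}. \<Union>i\<in>I. \<Union>j\<in>-I. {e. e $ i ** e $ j \<noteq> 0})"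
    by (auto simp: splits_def)
  moreover have "open {e :: complex^'d^'d^'n. e $ i ** e $ j \<noteq> 0}" for i j
    by (intro open_Collect_neq continuous_intros smooth_map_on_continuous smooth_map_on_matrix_mult
        smooth_map_on_vec_nth smooth_map_on_ident)
  ultimately show ?thesis by (simp only:) (intro open_INT open_UN ballI, auto)
qed

lemma act_mult: "unitary A \<Longrightarrow> act A e $ i ** act A e $ j = A ** (e $ i ** e $ j) ** conj_transpose A"
  unfolding act_nth unitary_def by (metis matrix_mul_assoc matrix_mul_lid)

lemma splits_act:
  assumes "unitary A" shows "splits (act A e) \<longleftrightarrow> splits e"
proof -
  have *: "splits (act A e)" if s: "splits e" and A: "unitary A" for e :: "complex^'d^'d^'n" and A
  proof -
    obtain I where "I \<noteq> {}" "I \<noteq> UNIV" "\<And>i j. i \<in> I \<Longrightarrow> j \<notin> I \<Longrightarrow> e $ i ** e $ j = 0"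
      using s unfolding splits_def by auto
    then show ?thesis unfolding splits_def act_mult[OF A] by (intro exI[of _ I]) auto
  qed
  show ?thesis
    using *[OF _ assms, of e] *[OF _ unitary_conj_transpose[OF assms], of "act A e"] assms
    by (auto simp: act_inverse)
qed

lemma act_nondecomposable_polygons:
  assumes "\<And>i. r $ i > 0" "unitary A" "e \<in> nondecomposable_polygons r"
  shows "act A e \<in> nondecomposable_polygons r"
  using assms(2,3) act_closed_polygons[OF assms(1,2)]
  unfolding nondecomposable_polygons_iff[OF assms(1)] by (simp add: splits_act)

section \<open>Connectedness, Schur's lemma and irreducibility\<close>

lemma connected_polygon:
  assumes "\<not> splits e" "I \<noteq> {}" "\<And>i j. i \<in> I \<Longrightarrow> j \<notin> I \<Longrightarrow> e $ i ** e $ j = 0"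
  shows "I = UNIV"
  using assms unfolding splits_def by auto

text \<open>Commuting with a rank one edge makes \<open>w i\<close> an eigenvector of
  \<open>Y\<close>. Different eigenvalues force orthogonal lines, so connectedness leaves a single
  one; the closing condition writes every vector as a combination of the \<open>w i\<close>.\<close>

lemma schur_polygon:
  fixes e :: "complex^'d^'d^'n"
  assumes r: "\<And>i. r $ i > 0" and e: "e \<in> nondecomposable_polygons r"
    and Y: "\<And>i. Y ** e $ i = e $ i ** Y"
  obtains c where "Y = mat c"
proof -
  have e': "e \<in> closed_polygons r" "\<not> splits e" using e nondecomposable_polygons_iff[OF r] by auto
  obtain w where w: "\<And>i. e $ i = rank_one (w i)" "\<And>i. w i \<noteq> 0"
    using closed_polygonsE[OF r e'(1)] by metis
  define l where "l i = herm_inner (Y *v w i) (w i) / herm_inner (w i) (w i)" for i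
  have Yw: "Y *v w i = l i *s w i" for i
  proof -
    have "herm_inner (w i) (w i) *s (Y *v w i) = Y *v (rank_one (w i) *v w i)"
      by (simp add: rank_one_mult vector_scalar_commute)
    also have "\<dots> = rank_one (w i) *v (Y *v w i)"
      using Y[of i] by (simp add: matrix_vector_mul_assoc w)
    finally have "herm_inner (w i) (w i) *s (Y *v w i) = herm_inner (Y *v w i) (w i) *s w i"
      by (simp add: rank_one_mult)
    then have "inverse (herm_inner (w i) (w i)) *s (herm_inner (w i) (w i) *s (Y *v w i)) =
        inverse (herm_inner (w i) (w i)) *s (herm_inner (Y *v w i) (w i) *s w i)" by simp
    then show ?thesis using w(2)[of i] by (simp add: l_def field_simps)
  qed
  have eq: "e $ i ** e $ j = 0" if "l i \<noteq> l j" for i j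
  proof -
    have "Y *v (rank_one (w i) *v w j) = rank_one (w i) *v (Y *v w j)"
      using Y[of i] by (simp add: matrix_vector_mul_assoc w)
    then have "(herm_inner (w j) (w i) * l i) *s w i = (l j * herm_inner (w j) (w i)) *s w i"
      by (simp add: rank_one_mult Yw vector_scalar_commute)
    then have "herm_inner (w j) (w i) = 0" using that w(2)[of i] by (simp add: vec.scale_right_imp_eq mult.commute)
    then show ?thesis using herm_inner_eq_0_commute by (auto simp: w rank_one_mult_rank_one_eq_0)
  qed
  fix i0 :: 'n
  have "{i. l i = l i0} = UNIV"
    by (rule connected_polygon[OF e'(2)]) (use eq in auto)
  then have l: "l i = l i0" for i by auto
  define \<Lambda> where "\<Lambda> = complex_of_real (scale_factor r TYPE('d))"
  have \<Lambda>: "\<Lambda> \<noteq> 0" using scale_factor_pos[OF r, where 'd='d] unfolding \<Lambda>_def of_real_eq_0_iff by (rule less_imp_neq[symmetric])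
  have Yl: "Y *v (e $ i *v x) = l i0 *s (e $ i *v x)" for i x
    using l[of i] by (simp add: w rank_one_mult vector_scalar_commute Yw mult.commute)
  have "Y *v x = mat (l i0) *v x" for x
  proof -
    have "\<Lambda> *s (Y *v x) = Y *v (\<Sum>i\<in>UNIV. e $ i *v x)"
      using sum_polygon[OF e'(1), of x] by (simp add: \<Lambda>_def vector_scalar_commute)
    also have "\<dots> = (\<Sum>i\<in>UNIV. Y *v (e $ i *v x))"
      by (rule bounded_bilinear.sum_right[OF bounded_bilinear_matrix_vector_mult])
    also have "\<dots> = (\<Sum>i\<in>UNIV. l i0 *s (e $ i *v x))"
      by (rule sum.cong) (auto simp: Yl)
    also have "\<dots> = l i0 *s (\<Sum>i\<in>UNIV. e $ i *v x)"
      by (rule bounded_bilinear.sum_right[OF bounded_bilinear_vec_scale, symmetric])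
    finally have "\<Lambda> *s (Y *v x) = \<Lambda> *s (l i0 *s x)"
      using sum_polygon[OF e'(1), of x] by (simp add: \<Lambda>_def mult.commute)
    then show ?thesis using \<Lambda> by (simp only: vec.scale_cancel_left mat_vector_mult) simp
  qed
  then have "Y = mat (l i0)" by (simp add: matrix_eq)
  then show thesis by (rule that)
qed

text \<open>For each \<open>i\<close>, either \<open>w i\<close> lies in \<open>V\<close> or
  \<open>V\<close> is orthogonal to it. The indices of the first kind form a nonempty set, since
  otherwise the sum of the edges would kill \<open>v\<close>; connectedness makes it everything, and
  the \<open>w i\<close> span.\<close>

lemma invariant_subspace_polygon:
  fixes e :: "complex^'d^'d^'n"
  assumes r: "\<And>i. r $ i > 0" and e: "e \<in> nondecomposable_polygons r"
    and V: "vec.subspace V" "\<And>i v. v \<in> V \<Longrightarrow> e $ i *v v \<in> V" "v \<in> V" "v \<noteq> 0"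
  shows "V = UNIV"
proof -
  have e': "e \<in> closed_polygons r" "\<not> splits e" using e nondecomposable_polygons_iff[OF r] by auto
  obtain w where w: "\<And>i. e $ i = rank_one (w i)" "\<And>i. w i \<noteq> 0"
    using closed_polygonsE[OF r e'(1)] by metis
  define \<Lambda> where "\<Lambda> = complex_of_real (scale_factor r TYPE('d))"
  have \<Lambda>: "\<Lambda> \<noteq> 0" using scale_factor_pos[OF r, where 'd='d] unfolding \<Lambda>_def of_real_eq_0_iff by (rule less_imp_neq[symmetric])
  \<comment> \<open>\<open>e $ i\<close> sends \<open>u\<close> to a multiple of \<open>w i\<close>,
    which invariance places in \<open>V\<close>; for \<open>w i\<close> outside \<open>V\<close> the
    multiple must vanish.\<close>
  have orth: "herm_inner u (w i) = 0" if "w i \<notin> V" "u \<in> V" for i u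
  proof (rule ccontr)
    assume h: "herm_inner u (w i) \<noteq> 0"
    have "herm_inner u (w i) *s w i \<in> V" using V(2)[OF that(2), of i] by (simp add: w rank_one_mult)
    then have "w i \<in> V" by (rule vec_subspace_scaleD[OF V(1) _ h])
    then show False using that(1) by simp
  qed
  let ?I = "{i. w i \<in> V}"
  have "?I \<noteq> {}"
  proof
    assume "?I = {}"
    then have "e $ i *v v = 0" for i using orth[OF _ V(3)] by (auto simp: w rank_one_mult)
    then have "\<Lambda> *s v = 0" using sum_polygon[OF e'(1), of v] by (simp add: \<Lambda>_def)
    then show False using \<Lambda> V(4) by (simp add: vec.scale_eq_0_iff)
  qed
  then have "?I = UNIV"
    by (rule connected_polygon[OF e'(2)]) (auto simp: w rank_one_mult_rank_one_eq_0 orth)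
  have "x \<in> V" for x
  proof -
    have "\<Lambda> *s x \<in> V"
      unfolding \<Lambda>_def sum_polygon[OF e'(1), of x, symmetric]
      using \<open>?I = UNIV\<close> V(1)
      by (intro vec.subspace_sum) (auto simp: w rank_one_mult intro!: vec.subspace_scale)
    then show ?thesis by (rule vec_subspace_scaleD[OF V(1) _ \<Lambda>])
  qed
  then show ?thesis by auto
qed

section \<open>Charts of the space of nondecomposable polygons\<close>

lemma norm_vec_scale: "norm (c *s (u :: complex^'d)) = cmod c * norm u"
  by (simp add: norm_vec_def L2_set_def norm_mult power_mult_distrib real_sqrt_mult
      flip: sum_distrib_left)

text \<open>Polarises the quadratic map \<open>rank_one\<close>, so that its derivative comes from
  the product rule.\<close>

definition outer :: "complex^'d \<Rightarrow> complex^'d \<Rightarrow> complex^'d^'d" where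
  "outer v w = (\<chi> i j. v $ i * cnj (w $ j))"

lemma rank_one_outer: "rank_one w = outer w w"
  by (simp add: rank_one_def outer_def)

lemma bounded_bilinear_outer: "bounded_bilinear (outer :: complex^'d \<Rightarrow> complex^'d \<Rightarrow> complex^'d^'d)"
  by (rule bounded_bilinear_euclideanI)
     (simp_all add: outer_def vec_eq_iff distrib_left distrib_right)

lemma conj_transpose_outer: "conj_transpose (outer v w) = outer w v"
  by (simp add: conj_transpose_def outer_def vec_eq_iff mult.commute)

lemma trace_outer: "trace (outer v w) = herm_inner v w"
  by (simp add: trace_def outer_def herm_inner_def)

lemma trace_sum: "trace (\<Sum>i\<in>I. f i) = (\<Sum>i\<in>I. trace (f i))"
  unfolding trace_def by (simp add: sum.swap[of _ I])

lemma trace_mat: "trace (mat c :: complex^'d^'d) = of_nat CARD('d) * c"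
  by (simp add: trace_def mat_def)

lemma inner_outer: "Y \<bullet> outer u w = u \<bullet> (Y *v w)"
proof -
  have "Y \<bullet> outer u w = Re (\<Sum>j\<in>UNIV. \<Sum>k\<in>UNIV. Y$j$k * w$k * cnj (u$j))"
    unfolding inner_vec_def outer_def Re_sum
    by (intro sum.cong refl) (simp add: inner_complex_def algebra_simps)
  also have "\<dots> = (Y *v w) \<bullet> u"
    by (simp add: Re_herm_inner[symmetric] herm_inner_def matrix_vector_mult_def sum_distrib_right
        del: times_complex.sel)
  finally show ?thesis by (simp add: inner_commute)
qed

lemma inner_conj_transpose: "conj_transpose A \<bullet> conj_transpose B = A \<bullet> B"
  unfolding inner_vec_def conj_transpose_def
  by (simp add: inner_complex_def) (rule sum.swap)

text \<open>The range of the derivative of the defining equations of a chart; the equation for the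
  trace records that the moment map has a fixed trace on polygons with given side-lengths.\<close>

definition moment_range :: "((real^'n) \<times> (real^'n) \<times> (complex^'d^'d)) set" where
  "moment_range = {(a, b, Y). conj_transpose Y = Y \<and> trace Y = of_real (\<Sum>i\<in>UNIV. a $ i)}"

lemma trace_scaleR: "trace (c *\<^sub>R Y) = of_real c * trace (Y :: complex^'d^'d)"
  by (simp add: trace_def flip: scaleR_sum_right) (simp add: scaleR_conv_of_real)

lemma subspace_moment_range: "subspace moment_range"
  by (auto simp: moment_range_def subspace_def linear_add[OF linear_conj_transpose] trace_add
      linear_scale[OF linear_conj_transpose] linear_0[OF linear_conj_transpose] sum.distrib
      sum_distrib_left zero_prod_def trace_scaleR trace_0[unfolded mat_0])

text \<open>Derivative at \<open>W\<close> of three systems of equations for lifts: the squared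
  norms, the phase condition relative to \<open>W\<close>, and the closing condition.\<close>

definition moment_derivative ::
    "('n \<Rightarrow> complex^'d) \<Rightarrow> complex^'d^'n \<Rightarrow> (real^'n) \<times> (real^'n) \<times> (complex^'d^'d)" where
  "moment_derivative W v = (\<chi> i. 2 * (v $ i \<bullet> W i), \<chi> i. v $ i \<bullet> (\<i> *s W i),
     \<Sum>i\<in>UNIV. outer (W i) (v $ i) + outer (v $ i) (W i))"

lemma moment_derivative_in_range: "moment_derivative W v \<in> moment_range"
proof -
  have "herm_inner x y + herm_inner y x = of_real (2 * (y \<bullet> x))" for x y :: "complex^'b"
    by (rule complex_eqI) (simp_all add: Re_herm_inner inner_commute flip: cnj_herm_inner[of y x])
  then have "trace (\<Sum>i\<in>UNIV. outer (W i) (v $ i) + outer (v $ i) (W i)) =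
      of_real (\<Sum>i\<in>UNIV. 2 * (v $ i \<bullet> W i))"
    by (simp add: trace_sum trace_add trace_outer)
  then show ?thesis
    by (simp add: moment_derivative_def moment_range_def linear_sum[OF linear_conj_transpose]
        linear_add[OF linear_conj_transpose] conj_transpose_outer add.commute)
qed

text \<open>If \<open>(a, b, Y)\<close> in \<open>moment_range\<close> is orthogonal to the range,
  every \<open>W i\<close> is an eigenvector of \<open>Y\<close>. As \<open>Y\<close> is Hermitian,
  the eigenvalues are real, so \<open>b = 0\<close>, and \<open>Y\<close> commutes with all edges.
  By Schur's lemma it is scalar, and the trace condition makes it zero.\<close>

lemma range_moment_derivative:
  fixes e :: "complex^'d^'d^'n"
  assumes r: "\<And>i. r $ i > 0" and e: "e \<in> nondecomposable_polygons r"
    and W: "\<And>i. e $ i = rank_one (W i)" "\<And>i. W i \<noteq> 0" and lin: "linear (moment_derivative W)"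
  shows "range (moment_derivative W) = moment_range"
proof (rule ccontr)
  let ?D = "moment_derivative W"
  assume "range ?D \<noteq> moment_range"
  moreover have s: "subspace (range ?D)"
    using linear_subspace_image[OF lin] subspace_UNIV by blast
  ultimately have "span (range ?D) \<subset> span moment_range"
    using moment_derivative_in_range[of W]
    unfolding span_eq_iff[THEN iffD2, OF s] span_eq_iff[THEN iffD2, OF subspace_moment_range] by blast
  then obtain y where y: "y \<noteq> 0" "y \<in> span moment_range" "\<And>x. x \<in> span (range ?D) \<Longrightarrow> orthogonal y x"
    by (rule orthogonal_to_subspace_exists_gen) blast
  then have y': "y \<in> moment_range" "\<And>v. y \<bullet> ?D v = 0"
    unfolding span_eq_iff[THEN iffD2, OF s] span_eq_iff[THEN iffD2, OF subspace_moment_range]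
    by (auto simp: orthogonal_def)
  obtain a b Y where ab: "y = (a, b, Y)" by (cases y)
  have Y: "conj_transpose Y = Y" "trace Y = of_real (\<Sum>i\<in>UNIV. a $ i)"
    using y'(1) by (auto simp: ab moment_range_def)
  \<comment> \<open>Varying the single vector \<open>W i\<close> gives \<open>?z = 0\<close> below;
    solving this equation for \<open>Y *v W i\<close> yields the eigenvalue.\<close>
  define \<mu> where "\<mu> i = - Complex (a $ i) (b $ i / 2)" for i
  have YW: "Y *v W i = \<mu> i *s W i" for i
  proof -
    let ?z = "(2 * a $ i) *\<^sub>R W i + (b $ i) *\<^sub>R (\<i> *s W i) + 2 *\<^sub>R (Y *v W i)"
    have "u \<bullet> ?z = 0" for u
    proof -
      have nth: "axis i u $ j = (if j = i then u else 0)" for j by (simp add: axis_def)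
      have o0: "outer (W j) 0 = 0" "outer 0 (W j) = 0" for j by (simp_all add: outer_def vec_eq_iff)
      have "?D (axis i u) = (\<chi> j. if j = i then 2 * (u \<bullet> W i) else 0,
          \<chi> j. if j = i then u \<bullet> (\<i> *s W i) else 0, outer (W i) u + outer u (W i))"
        unfolding moment_derivative_def nth
        by (auto simp: vec_eq_iff if_distrib[of "outer _"] if_distrib[of "\<lambda>x. outer x _"] o0
            sum.distrib cong: if_cong)
      moreover have "Y \<bullet> outer (W i) u = u \<bullet> (Y *v W i)"
        using inner_conj_transpose[of Y "outer (W i) u"] by (simp add: Y conj_transpose_outer inner_outer)
      ultimately have "y \<bullet> ?D (axis i u) = a $ i * (2 * (u \<bullet> W i)) + b $ i * (u \<bullet> (\<i> *s W i))
          + 2 * (u \<bullet> (Y *v W i))"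
        by (simp add: ab inner_vec_def[of a] inner_vec_def[of b] inner_add_right inner_outer
            if_distrib[of "\<lambda>x. _ * x"] cong: if_cong)
      then show ?thesis using y'(2)[of "axis i u"] by (simp add: inner_add_right)
    qed
    then have z: "?z = 0" by (metis inner_eq_zero_iff)
    have "2 *\<^sub>R (Y *v W i) = 2 *\<^sub>R (\<mu> i *s W i)"
    proof -
      have "2 *\<^sub>R (\<mu> i *s W i) = - ((2 * a $ i) *\<^sub>R W i + (b $ i) *\<^sub>R (\<i> *s W i))"
        by (simp add: vec_eq_iff \<mu>_def complex_eq_iff algebra_simps)
      then show ?thesis using z by (metis add.commute add_eq_0_iff)
    qed
    then show ?thesis by simp
  qed
  have \<mu>: "cnj (\<mu> i) = \<mu> i" for i
  proof -
    have "herm_inner (Y *v W i) (W i) = herm_inner (W i) (Y *v W i)"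
      using herm_inner_adjoint[of Y "W i" "W i"] Y(1) by simp
    then show ?thesis using W(2)[of i] by (simp add: YW)
  qed
  have "Y ** e $ i = e $ i ** Y" for i
  proof -
    have "Y *v (e $ i *v x) = e $ i *v (Y *v x)" for x
      using herm_inner_adjoint[of Y x "W i"]
      by (simp add: W rank_one_mult vector_scalar_commute YW Y(1) \<mu>)
    then show ?thesis by (simp add: matrix_eq matrix_vector_mul_assoc[symmetric])
  qed
  then obtain c where c: "Y = mat c" using schur_polygon[OF r e] by blast
  have mu_c: "\<mu> i = c" for i
  proof -
    have "c *s W i = \<mu> i *s W i" using YW[of i] by (simp add: c mat_vector_mult)
    then show ?thesis using W(2)[of i] by simp
  qed
  have b: "b $ i = 0" for i using \<mu>[of i] by (simp add: \<mu>_def complex_eq_iff)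
  have a: "a $ i = - Re c" for i using mu_c[of i] by (auto simp: \<mu>_def complex_eq_iff)
  \<comment> \<open>The trace of \<open>mat c\<close> is \<open>CARD('d) * c\<close>, while the sum
    of the \<open>a $ i\<close> is \<open>- CARD('n) * Re c\<close>; the opposite signs leave only
    \<open>Re c = 0\<close>.\<close>
  have "Re (of_nat CARD('d) * c) = (\<Sum>i\<in>(UNIV::'n set). - Re c)"
    using Y(2) by (simp add: c trace_mat a)
  then have "real (CARD('d) + CARD('n)) * Re c = 0" by (simp add: algebra_simps)
  then have "Re c = 0" by (simp only: mult_eq_0_iff of_nat_eq_0_iff) (simp add: card_eq_0_iff)
  moreover have "Im c = 0" using mu_c \<mu> by (metis complex_cnj_cancel_iff Reals_cnj_iff complex_is_Real_iff)
  ultimately have "c = 0" by (simp add: complex_eq_iff)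
  then have "y = 0" using a b by (simp add: ab c vec_eq_iff zero_prod_def mat_def)
  then show False using y(1) by simp
qed


text \<open>An edge whose line is not orthogonal to \<open>W i\<close> is \<open>rank_one z\<close>
  for exactly one \<open>z\<close> with real positive inner product with \<open>W i\<close>. On such
  lifts the polygon conditions become \<open>?F z = 0\<close>. The dimension equation refers only to
  \<open>moment_range\<close>, so it is the same at every \<open>p\<close>.\<close>

lemma nondecomposable_polygons_chart:
  fixes p :: "complex^'d^'d^'n"
  assumes r: "\<And>i. r $ i > 0" and p: "p \<in> nondecomposable_polygons r"
  obtains K :: "(complex^'d^'n) set" where "subspace K" "chart_at K (nondecomposable_polygons r) p"
    "dim (moment_range :: ((real^'n) \<times> (real^'n) \<times> (complex^'d^'d)) set) + dim K = DIM(complex^'d^'n)"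
proof -
  note ndp = nondecomposable_polygons_iff[OF r]
  have p': "p \<in> closed_polygons r" "\<not> splits p" using p ndp by auto
  obtain W where W: "\<And>i. p $ i = rank_one (W i)" "\<And>i. (norm (W i))\<^sup>2 = r $ i" "\<And>i. W i \<noteq> 0"
    using closed_polygonsE[OF r p'(1)] by metis
  define w0 where "w0 = (\<chi> i. W i)"
  define \<Lambda> where "\<Lambda> = scale_factor r TYPE('d)"
  let ?g = "\<lambda>z. \<chi> i. rank_one (z $ i)"
  let ?F = "\<lambda>z. (\<chi> i. z $ i \<bullet> z $ i - r $ i, \<chi> i. z $ i \<bullet> (\<i> *s W i),
    (\<Sum>i\<in>UNIV. rank_one (z $ i)) - (mat (of_real \<Lambda>) :: complex^'d^'d))"
  let ?D = "moment_derivative W"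
  \<comment> \<open>Positivity is the open half of the choice of phase; reality is left to the
    second component of \<open>?F\<close>. Nondecomposability is open too and stays out of the
    equations.\<close>
  define U where "U = {z :: complex^'d^'n. (\<forall>i. 0 < z $ i \<bullet> W i) \<and> \<not> splits (?g z)}"
  have sg: "smooth_map_on S ?g" for S
    by (intro smooth_map_on_vec_lambda smooth_map_on_rank_one smooth_map_on_vec_nth smooth_map_on_ident)
  have "open (?g -` {e. \<not> splits e})"
    by (rule open_vimage[OF open_not_splits smooth_map_on_continuous[OF sg]])
  moreover have "open {z :: complex^'d^'n. 0 < z $ i \<bullet> W i}" for i
    by (intro open_Collect_less continuous_intros)
  then have "open (\<Inter>i. {z :: complex^'d^'n. 0 < z $ i \<bullet> W i})"
    by (intro open_INT) auto
  moreover have "U = (\<Inter>i. {z. 0 < z $ i \<bullet> W i}) \<inter> ?g -` {e. \<not> splits e}"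
    by (auto simp: U_def)
  ultimately have oU: "open U" by auto
  have gw0: "?g w0 = p" by (simp add: w0_def W vec_eq_iff)
  have w0U: "w0 \<in> U" using p'(2) W(3) gw0 by (simp add: U_def) (simp add: w0_def)
  have sF: "smooth_map_on U ?F"
    by (intro smooth_map_on_Pair smooth_map_on_vec_lambda smooth_map_on_diff smooth_map_on_inner
        smooth_map_on_const smooth_map_on_sum smooth_map_on_rank_one smooth_map_on_vec_nth smooth_map_on_ident)
  have nth: "((\<lambda>z. z $ i) has_derivative (\<lambda>v. v $ i)) (at z)" for i and z :: "complex^'d^'n"
    by (rule bounded_linear_imp_has_derivative[OF bounded_linear_vec_nth])
  have DF: "(?F has_derivative ?D) (at w0)"
    unfolding moment_derivative_def rank_one_outer
  proof (intro has_derivative_Pair has_derivative_vec_lambda)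
    show "((\<lambda>z. z $ i \<bullet> z $ i - r $ i) has_derivative (\<lambda>v. 2 * (v $ i \<bullet> W i))) (at w0)" for i
      by (rule has_derivative_eq_rhs[OF has_derivative_diff[OF
            bounded_bilinear.FDERIV[OF bounded_bilinear_inner nth nth] has_derivative_const]])
         (auto simp: w0_def inner_commute)
    show "((\<lambda>z. z $ i \<bullet> (\<i> *s W i)) has_derivative (\<lambda>v. v $ i \<bullet> (\<i> *s W i))) (at w0)" for i
      by (rule bounded_linear.has_derivative[OF bounded_linear_inner_left nth])
    show "((\<lambda>z. (\<Sum>i\<in>UNIV. outer (z $ i) (z $ i)) - (mat (of_real \<Lambda>) :: complex^'d^'d)) has_derivative
       (\<lambda>v. \<Sum>i\<in>UNIV. outer (W i) (v $ i) + outer (v $ i) (W i))) (at w0)"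
      by (rule has_derivative_eq_rhs[OF has_derivative_diff[OF has_derivative_sum[OF
            bounded_bilinear.FDERIV[OF bounded_bilinear_outer nth nth]] has_derivative_const]])
         (auto simp: w0_def)
  qed
  have lD: "linear ?D" using DF by (rule has_derivative_linear)
  have rD: "range ?D = moment_range" by (rule range_moment_derivative[OF r p W(1,3) lD])
  \<comment> \<open>The trace of the closing equation is the sum of the norm equations, because
    \<open>CARD('d)\<close> times \<open>\<Lambda>\<close> is the sum of the side-lengths.\<close>
  have F_range: "?F z \<in> range ?D" for z
  proof -
    have "trace (rank_one v) = of_real (v \<bullet> v)" for v :: "complex^'d"
      by (simp add: rank_one_outer trace_outer herm_inner_self power2_norm_eq_inner)
    moreover have "of_nat CARD('d) * complex_of_real \<Lambda> = (\<Sum>i\<in>UNIV. of_real (r $ i))"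
      by (simp add: \<Lambda>_def)
    ultimately show ?thesis unfolding rD
      by (simp add: moment_range_def linear_diff[OF linear_conj_transpose]
          linear_sum[OF linear_conj_transpose] trace_sub trace_sum trace_mat sum_subtractf)
  qed
  define Z where "Z = {z \<in> U. ?F z = 0}"
  have F0: "?F z = 0 \<longleftrightarrow> (\<forall>i. (norm (z $ i))\<^sup>2 = r $ i \<and> Im (herm_inner (z $ i) (W i)) = 0) \<and>
      (\<Sum>i\<in>UNIV. rank_one (z $ i)) = mat (of_real \<Lambda>)" for z
    by (auto simp: zero_prod_def vec_eq_iff[where 'a=real] power2_norm_eq_inner Im_herm_inner) 
  have w0Z: "w0 \<in> Z"
    using w0U p'(1) W(2) unfolding Z_def F0
    by (simp add: w0_def W(1)[symmetric] closed_polygons_def \<Lambda>_def herm_inner_self)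
  have ch: "chart_at {v. ?D v = 0} Z w0"
    by (rule chart_at_level_set[OF oU w0U sF DF F_range w0Z]) (simp add: Z_def)
  let ?q = "\<lambda>e i. (e $ i *v W i) \<bullet> W i"
  \<comment> \<open>If \<open>e $ i = rank_one u\<close>, then \<open>e $ i *v W i\<close> is
    \<open>herm_inner (W i) u\<close> times \<open>u\<close>, and \<open>?q e i\<close> is the
    squared modulus of that factor. Dividing by its root gives the lift with the right norm and
    phase, smoothly in \<open>e\<close> and without choosing \<open>u\<close>.\<close>
  let ?f = "\<lambda>e. \<chi> i. inverse (sqrt (?q e i)) *\<^sub>R (e $ i *v W i)"
  let ?E = "nondecomposable_polygons r \<inter> {e. \<forall>i. 0 < ?q e i}"
  have qu: "?q e i = (cmod (herm_inner (W i) u))\<^sup>2" if "e $ i = rank_one u" for e i u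
    by (simp add: that rank_one_mult Re_herm_inner[symmetric] cnj_herm_inner[symmetric, of u]
        complex_norm_square[symmetric] del: of_real_power)
  have fe: "rank_one (?f e $ i) = e $ i \<and> (norm (?f e $ i))\<^sup>2 = r $ i \<and> 0 < ?f e $ i \<bullet> W i \<and>
      Im (herm_inner (?f e $ i) (W i)) = 0" if e: "e \<in> ?E" for e i
  proof -
    have "e \<in> closed_polygons r" using e ndp by blast
    then obtain u' where u': "\<And>i. e $ i = rank_one (u' i)" "\<And>i. (norm (u' i))\<^sup>2 = r $ i"
      using closed_polygonsE[OF r] by metis
    define u where "u = u' i"
    have u: "e $ i = rank_one u" "(norm u)\<^sup>2 = r $ i" using u' by (simp_all add: u_def)
    define \<alpha> where "\<alpha> = herm_inner (W i) u"
    have q: "?q e i = (cmod \<alpha>)\<^sup>2" unfolding \<alpha>_def by (rule qu[OF u(1)])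
    have "0 < ?q e i" using e by simp
    then have \<alpha>0: "cmod \<alpha> > 0" unfolding q by simp
    have f: "?f e $ i = (of_real (inverse (cmod \<alpha>)) * \<alpha>) *s u"
      using q by (simp add: u(1) rank_one_mult \<alpha>_def vec_eq_iff scaleR_conv_of_real[where 'a=complex])
    have "cmod (of_real (inverse (cmod \<alpha>)) * \<alpha>) = 1"
      using \<alpha>0 by (simp add: norm_mult norm_inverse)
    then have 1: "rank_one (?f e $ i) = e $ i" unfolding f rank_one_scale u(1) by simp
    have 2: "(norm (?f e $ i))\<^sup>2 = r $ i"
      unfolding f norm_vec_scale \<open>cmod _ = 1\<close> using u(2) by simp
    have "herm_inner (?f e $ i) (W i) = of_real (inverse (cmod \<alpha>)) * (\<alpha> * cnj \<alpha>)"
      unfolding f by (simp add: \<alpha>_def cnj_herm_inner)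
    also have "\<dots> = of_real (cmod \<alpha>)"
      using \<alpha>0 by (simp only: complex_norm_square[symmetric]) (simp add: power2_eq_square)
    finally have 3: "herm_inner (?f e $ i) (W i) = of_real (cmod \<alpha>)" .
    show ?thesis using 1 2 3 \<alpha>0 by (simp add: Re_herm_inner[symmetric])
  qed
  have gZ: "?g z \<in> ?E \<and> ?f (?g z) = z" if z: "z \<in> Z" for z
  proof -
    have z': "\<not> splits (?g z)" "\<And>i. 0 < z $ i \<bullet> W i" "\<And>i. (norm (z $ i))\<^sup>2 = r $ i"
      "\<And>i. Im (herm_inner (z $ i) (W i)) = 0" "(\<Sum>i\<in>UNIV. rank_one (z $ i)) = mat (of_real \<Lambda>)"
      using z unfolding Z_def mem_Collect_eq F0 U_def by auto
    have "?g z \<in> polygons r" using z'(3) unfolding polygons_rank_one[OF r] by auto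
    then have "?g z \<in> closed_polygons r" using z'(5) by (simp add: closed_polygons_def \<Lambda>_def)
    then have 1: "?g z \<in> nondecomposable_polygons r" using z'(1) ndp by blast
    have h: "herm_inner (W i) (z $ i) = of_real (z $ i \<bullet> W i)" for i
      by (rule complex_eqI)
         (use z'(4)[of i] in \<open>simp_all add: Re_herm_inner inner_commute flip: cnj_herm_inner[of "z $ i"]\<close>)
    have q: "?q (?g z) i = (z $ i \<bullet> W i)\<^sup>2" for i
      using qu[of "?g z" i "z $ i"] by (simp add: h)
    have "?f (?g z) = z"
    proof (subst vec_eq_iff, rule)
      fix i
      have a: "rank_one (z $ i) *v W i = of_real (z $ i \<bullet> W i) *s z $ i"
        by (simp add: rank_one_mult h)
      have b: "(rank_one (z $ i) *v W i) \<bullet> W i = (z $ i \<bullet> W i)\<^sup>2" using q[of i] by simp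
      have "?f (?g z) $ i = inverse (sqrt ((z $ i \<bullet> W i)\<^sup>2)) *\<^sub>R (of_real (z $ i \<bullet> W i) *s z $ i)"
        by (simp only: vec_lambda_beta b) (simp only: a)
      then show "?f (?g z) $ i = z $ i"
        using z'(2)[of i] by (simp add: vec_eq_iff scaleR_conv_of_real[where 'a=complex])
    qed
    moreover have "0 < ?q (?g z) i" for i unfolding q using z'(2)[of i] by simp
    ultimately show ?thesis using 1 by blast
  qed
  have "chart_at {v. ?D v = 0} (nondecomposable_polygons r) p"
  proof (rule chart_at_transfer[of _ Z ?f p _ ?E ?g])
    have p_in: "p \<in> ?E" using gZ[OF w0Z] gw0 by simp
    then show "p \<in> ?E" .
    have "?f p = w0" using gZ[OF w0Z] unfolding gw0 by blast
    then show "chart_at {v. ?D v = 0} Z (?f p)" using ch by simp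
    have "open (\<Inter>i. {e :: complex^'d^'d^'n. 0 < ?q e i})"
      by (intro open_INT ballI open_Collect_less continuous_intros
          smooth_map_on_continuous smooth_map_on_inner smooth_map_on_matrix_vector_mult
          smooth_map_on_vec_nth smooth_map_on_ident smooth_map_on_const) auto
    moreover have "(\<Inter>i. {e. 0 < ?q e i}) = {e. \<forall>i. 0 < ?q e i}" by auto
    ultimately show "openin (top_of_set (nondecomposable_polygons r)) ?E"
      by (intro openin_open_Int) simp
    show "smooth_map_on ?E ?f"
      by (intro smooth_map_on_vec_lambda smooth_map_on_scaleR smooth_map_on_inverse smooth_map_on_sqrt
          smooth_map_on_inner smooth_map_on_matrix_vector_mult
          smooth_map_on_vec_nth smooth_map_on_ident smooth_map_on_const) (auto, metis less_irrefl)
    show "smooth_map_on Z ?g" by (rule sg)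
    show "?f ` ?E \<subseteq> Z"
    proof (rule image_subsetI)
      fix e assume e: "e \<in> ?E"
      have ge: "?g (?f e) = e" using fe[OF e] by (simp add: vec_eq_iff)
      have "\<not> splits e" "e \<in> closed_polygons r" using e ndp by blast+
      then show "?f e \<in> Z" unfolding Z_def F0 mem_Collect_eq U_def ge
        using fe[OF e] by (auto simp: closed_polygons_def \<Lambda>_def)
    qed
    show "?g (?f e) = e" if "e \<in> ?E" for e using fe[OF that] by (simp add: vec_eq_iff)
  qed (use gZ in auto)
  moreover have "subspace {v. ?D v = 0}" by (rule linear_subspace_kernel[OF lD])
  moreover have "dim (moment_range :: ((real^'n) \<times> (real^'n) \<times> (complex^'d^'d)) set) + dim {v. ?D v = 0}
      = DIM(complex^'d^'n)"
    using dim_image_kernel_subspace[OF lD subspace_UNIV] by (simp add: rD)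
  ultimately show thesis using that by blast
qed

section \<open>Unitary orbits and Gram-Schmidt orthonormalisation\<close>

lemma vector_scale_scaleR: "c *s (a *\<^sub>R v) = a *\<^sub>R (c *s (v :: complex^'d))"
  by (rule bounded_bilinear.scaleR_right[OF bounded_bilinear_vec_scale])

lemma matrix_vector_scaleR: "A *v (a *\<^sub>R v) = a *\<^sub>R (A *v (v :: complex^'d))" for A :: "complex^'d^'d"
  by (rule bounded_bilinear.scaleR_right[OF bounded_bilinear_matrix_vector_mult])

text \<open>The Lie algebra of the unitary group: the velocities at the identity of unitary
  curves.\<close>

definition skew_hermitian :: "(complex^'d^'d) set" where
  "skew_hermitian = {X. conj_transpose X = - X}"

lemma subspace_skew_hermitian: "subspace skew_hermitian"
  by (auto simp: skew_hermitian_def subspace_def linear_add[OF linear_conj_transpose]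
      linear_scale[OF linear_conj_transpose] linear_0[OF linear_conj_transpose])

lemma outer_mult: "outer v w *v x = herm_inner x w *s v"
  by (simp add: outer_def herm_inner_def matrix_vector_mult_def vec_eq_iff sum_distrib_left mult_ac)

text \<open>Generators whose one-parameter groups are elementary, so that no matrix exponential is
  required.\<close>

definition skew_rank_one :: "(complex^'d^'d) set" where
  "skew_rank_one = {outer (\<i> *s w) w | w. norm w = 1}"

text \<open>For a skew-Hermitian \<open>Y\<close> orthogonal to the generators, the real form of
  \<open>\<i> *s u\<close> and \<open>Y *v v\<close> is symmetric and vanishes on the diagonal,
  hence vanishes by polarisation.\<close>

lemma span_skew_rank_one: "span skew_rank_one = (skew_hermitian :: (complex^'d^'d) set)"
proof (rule ccontr)
  assume ne: "span skew_rank_one \<noteq> (skew_hermitian :: (complex^'d^'d) set)"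
  note span_skew = span_eq_iff[THEN iffD2, OF subspace_skew_hermitian]
  have "skew_rank_one \<subseteq> (skew_hermitian :: (complex^'d^'d) set)"
    by (auto simp: skew_rank_one_def skew_hermitian_def conj_transpose_def outer_def vec_eq_iff mult.commute)
  then have "span skew_rank_one \<subseteq> (skew_hermitian :: (complex^'d^'d) set)"
    using subspace_skew_hermitian by (rule span_minimal)
  with ne have "span skew_rank_one \<subset> span (skew_hermitian :: (complex^'d^'d) set)"
    unfolding span_skew by blast
  then obtain Y :: "complex^'d^'d" where Y: "Y \<noteq> 0" "Y \<in> span skew_hermitian"
    "\<And>x. x \<in> span skew_rank_one \<Longrightarrow> orthogonal Y x"
    by (rule orthogonal_to_subspace_exists_gen) blast
  have Y': "conj_transpose Y = - Y" using Y(2) unfolding span_skew by (simp add: skew_hermitian_def)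
  have unit: "(\<i> *s w) \<bullet> (Y *v w) = 0" if "norm w = 1" for w
  proof -
    have "outer (\<i> *s w) w \<in> span skew_rank_one"
      using that by (auto simp: skew_rank_one_def intro: span_base)
    from Y(3)[OF this] show ?thesis unfolding orthogonal_def inner_outer .
  qed
  have quad: "(\<i> *s w) \<bullet> (Y *v w) = 0" for w
  proof (cases "w = 0")
    case False
    define v where "v = inverse (norm w) *\<^sub>R w"
    have v: "w = norm w *\<^sub>R v" "norm v = 1" using False by (simp_all add: v_def)
    have "(\<i> *s (a *\<^sub>R v)) \<bullet> (Y *v (a *\<^sub>R v)) = 0" for a
      using unit[OF v(2)] by (simp add: vector_scale_scaleR matrix_vector_scaleR)
    then show ?thesis using v(1) by metis
  qed simp
  have "(\<i> *s u) \<bullet> (Y *v v) = 0" for u v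
  proof -
    have "(\<i> *s v) \<bullet> (Y *v u) = (\<i> *s u) \<bullet> (Y *v v)"
    proof -
      have "herm_inner (Y *v u) (\<i> *s v) = herm_inner u (- Y *v (\<i> *s v))"
        unfolding herm_inner_adjoint Y' ..
      also have "\<dots> = herm_inner (\<i> *s u) (Y *v v)"
        by (simp add: bounded_bilinear.minus_left[OF bounded_bilinear_matrix_vector_mult] vector_scalar_commute
            flip: herm_inner_scale(1) vec.scale_minus_left)
      finally have "Re (herm_inner (Y *v u) (\<i> *s v)) = Re (herm_inner (\<i> *s u) (Y *v v))" by (rule arg_cong)
      then show ?thesis unfolding Re_herm_inner inner_commute[of "\<i> *s v"] .
    qed
    then show ?thesis using quad[of "u + v"] quad[of u] quad[of v]
      by (simp add: vector_add_ldistrib matrix_vector_right_distrib inner_add_left inner_add_right)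
  qed
  \<comment> \<open>This choice of \<open>u\<close> turns the form into the squared norm of
    \<open>Y *v v\<close>.\<close>
  from this[of "(- \<i>) *s (Y *v v)" v for v] have "Y *v v = 0" for v by simp
  then have "Y = 0" by (simp add: matrix_eq)
  with Y(1) show False by simp
qed

text \<open>The derivative at the identity of \<open>A \<mapsto> act A q\<close> in a skew-Hermitian
  direction \<open>X\<close>.\<close>

definition commutator :: "complex^'d^'d^'n \<Rightarrow> complex^'d^'d \<Rightarrow> complex^'d^'d^'n" where
  "commutator q X = (\<chi> i. X ** q $ i - q $ i ** X)"

lemma linear_commutator: "linear (commutator q)"
proof (rule linearI)
  note b = bounded_bilinear_matrix_mult
  show "commutator q (X + Y) = commutator q X + commutator q Y" for X Y
    by (simp add: commutator_def vec_eq_iff bounded_bilinear.add_left[OF b] bounded_bilinear.add_right[OF b])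
  show "commutator q (c *\<^sub>R X) = c *\<^sub>R commutator q X" for c X
    by (simp add: commutator_def vec_eq_iff bounded_bilinear.scaleR_left[OF b]
        bounded_bilinear.scaleR_right[OF b] scaleR_diff_right)
qed

text \<open>By Schur's lemma the directions that fix \<open>q\<close> are the skew-Hermitian
  scalars, so the dimension of the tangent space to the orbit does not depend on
  \<open>q\<close>.\<close>

lemma dim_commutator:
  fixes q :: "complex^'d^'d^'n"
  assumes r: "\<And>i. r $ i > 0" and q: "q \<in> nondecomposable_polygons r"
  shows "dim (commutator q ` skew_rank_one) + dim (skew_hermitian \<inter> range mat :: (complex^'d^'d) set) =
    dim (skew_hermitian :: (complex^'d^'d) set)"
proof -
  have "{X \<in> skew_hermitian. commutator q X = 0} = skew_hermitian \<inter> range mat"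
  proof (intro equalityI subsetI)
    fix X :: "complex^'d^'d" assume "X \<in> {X \<in> skew_hermitian. commutator q X = 0}"
    then have "X \<in> skew_hermitian" and "commutator q X $ i = 0" for i by simp_all
    then have "X \<in> skew_hermitian" "X ** q $ i = q $ i ** X" for i by (simp_all add: commutator_def)
    then show "X \<in> skew_hermitian \<inter> range mat" using schur_polygon[OF r q, of X] by (metis IntI rangeI)
  next
    fix X :: "complex^'d^'d" assume "X \<in> skew_hermitian \<inter> range mat"
    then show "X \<in> {X \<in> skew_hermitian. commutator q X = 0}"
      by (auto simp: commutator_def mat_mult_commute zero_vec_def)
  qed
  moreover have "span (commutator q ` skew_rank_one) = commutator q ` skew_hermitian"
    by (simp add: linear_span_image[OF linear_commutator] span_skew_rank_one)
  then have "dim (commutator q ` skew_rank_one) = dim (commutator q ` skew_hermitian)"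
    by (metis dim_span)
  ultimately show ?thesis
    using dim_image_kernel_subspace[OF linear_commutator subspace_skew_hermitian, of q] by simp
qed

text \<open>The condition on \<open>a\<close> says that \<open>1 + a\<close> has modulus 1: the
  matrix multiplies \<open>w\<close> by \<open>1 + a\<close> and is the identity on the orthogonal
  complement.\<close>

lemma unitary_1_plus_outer:
  fixes w :: "complex^'d"
  assumes "norm w = 1" and a: "a + cnj a + a * cnj a = 0"
  shows "unitary (mat 1 + outer (a *s w) w)"
proof (rule unitaryI)
  let ?R = "mat 1 + outer (a *s w) w"
  have w: "herm_inner w w = 1" using assms by (simp add: herm_inner_self)
  have "?R *v (conj_transpose ?R *v x) = x" for x
  proof -
    have ct: "conj_transpose ?R *v x = x + (cnj a * herm_inner x w) *s w"
      by (simp add: linear_add[OF linear_conj_transpose] conj_transpose_outer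
          matrix_vector_mult_add_rdistrib outer_mult mat_vector_mult)
    have "?R *v (conj_transpose ?R *v x) = x + ((a + cnj a + a * cnj a) * herm_inner x w) *s w"
      unfolding ct using w
      by (simp add: matrix_vector_mult_add_rdistrib outer_mult mat_vector_mult
          herm_inner_add) (simp add: vec_eq_iff algebra_simps)
    then show ?thesis unfolding a by simp
  qed
  then show "?R ** conj_transpose ?R = mat 1"
    by (simp add: matrix_eq matrix_vector_mul_assoc[symmetric] mat_vector_mult)
qed

text \<open>The curve is the exponential of \<open>t\<close> times the generator, in closed form:
  multiplication by \<open>cis t\<close> on the line of \<open>w\<close>, identity on its
  complement.\<close>

lemma unitary_curve:
  fixes w :: "complex^'d"
  assumes "norm w = 1"
  obtains R :: "real \<Rightarrow> complex^'d^'d" where "\<And>t. unitary (R t)" "R 0 = mat 1"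
    "(R has_vector_derivative outer (\<i> *s w) w) (at 0)" "continuous_on UNIV R"
proof
  let ?R = "\<lambda>t. mat 1 + outer ((cis t - 1) *s w) w"
  have lin: "bounded_linear (\<lambda>a. outer (a *s w) w)"
    using bounded_linear_compose[OF bounded_bilinear.bounded_linear_left[OF bounded_bilinear_outer]
        bounded_bilinear.bounded_linear_left[OF bounded_bilinear_vec_scale]] .
  show "unitary (?R t)" for t
    by (rule unitary_1_plus_outer[OF assms]) (simp add: algebra_simps cis_cnj cis_mult)
  show "?R 0 = mat 1" by (simp add: outer_def vec_eq_iff)
  have "((\<lambda>t. cis t - 1) has_vector_derivative \<i>) (at 0)"
    unfolding has_vector_derivative_def
    by (rule has_derivative_eq_rhs, (rule derivative_intros)+) (auto simp: scaleR_conv_of_real)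
  from bounded_linear.has_vector_derivative[OF lin this]
  show "(?R has_vector_derivative outer (\<i> *s w) w) (at 0)"
    using has_vector_derivative_add[OF has_vector_derivative_const, of _ _ _ "mat 1"] by fastforce
  show "continuous_on UNIV ?R"
    by (intro continuous_intros bounded_linear.continuous_on[OF lin] continuous_on_cis)
qed

section \<open>Gram-Schmidt: equivariance, smoothness and regularity\<close>

fun gram_schmidt :: "(nat \<Rightarrow> complex^'d) \<Rightarrow> nat \<Rightarrow> complex^'d" where
  "gram_schmidt b k =
     (let v = b k - (\<Sum>l<k. herm_inner (b k) (gram_schmidt b l) *s gram_schmidt b l)
      in inverse (norm v) *\<^sub>R v)"

declare gram_schmidt.simps [simp del]

text \<open>Names the vector before normalisation. Where it vanishes, \<open>gram_schmidt\<close>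
  silently returns 0, as \<open>inverse 0 = 0\<close>; regularity is therefore stated through
  residuals.\<close>

definition gs_residual :: "(nat \<Rightarrow> complex^'d) \<Rightarrow> nat \<Rightarrow> complex^'d" where
  "gs_residual b k = b k - (\<Sum>l<k. herm_inner (b k) (gram_schmidt b l) *s gram_schmidt b l)"

lemma gram_schmidt_residual:
  "gram_schmidt b k = inverse (norm (gs_residual b k)) *\<^sub>R gs_residual b k"
  by (subst gram_schmidt.simps) (simp add: gs_residual_def Let_def)

lemma herm_inner_scaleR: "herm_inner (a *\<^sub>R v) w = of_real a * herm_inner v w"
  "herm_inner v (a *\<^sub>R w) = of_real a * herm_inner v w"
  by (simp_all add: bounded_bilinear.scaleR_left[OF bounded_bilinear_herm_inner]
      bounded_bilinear.scaleR_right[OF bounded_bilinear_herm_inner] scaleR_conv_of_real[where 'a=complex])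

lemma gram_schmidt_orthonormal_aux:
  assumes "\<And>k. k < d \<Longrightarrow> gs_residual b k \<noteq> 0" "k < d"
  shows "herm_inner (gram_schmidt b k) (gram_schmidt b k) = 1 \<and>
    (\<forall>l<k. herm_inner (gram_schmidt b k) (gram_schmidt b l) = 0)"
  using assms(2)
proof (induction k rule: less_induct)
  case (less k)
  let ?u = "gram_schmidt b"
  have u: "herm_inner (?u m) (?u l) = (if m = l then 1 else 0)" if "m < k" "l < k" for m l
    using less.IH[of m] less.IH[of l] less.prems that herm_inner_eq_0_commute
    by (cases m l rule: linorder_cases) auto
  have "herm_inner (gs_residual b k) (?u l) = 0" if "l < k" for l
  proof -
    have "(\<Sum>m<k. herm_inner (b k) (?u m) * herm_inner (?u m) (?u l)) =
        (\<Sum>m<k. if m = l then herm_inner (b k) (?u m) else 0)"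
      by (rule sum.cong) (use u that in auto)
    then show ?thesis using that by (simp add: gs_residual_def herm_inner_diff herm_inner_sum)
  qed
  moreover have "herm_inner (?u k) (?u k) = 1"
    using assms(1)[OF less.prems]
    by (simp add: gram_schmidt_residual herm_inner_scaleR herm_inner_self power2_eq_square field_simps)
  ultimately show ?case by (simp add: gram_schmidt_residual[of b k] herm_inner_scaleR)
qed

lemma gram_schmidt_orthonormal:
  assumes "\<And>k. k < d \<Longrightarrow> gs_residual b k \<noteq> 0" "k < d" "l < d"
  shows "herm_inner (gram_schmidt b k) (gram_schmidt b l) = (if k = l then 1 else 0)"
  using gram_schmidt_orthonormal_aux[OF assms(1), of d k] gram_schmidt_orthonormal_aux[OF assms(1), of d l]
    assms(2,3) herm_inner_eq_0_commute
  by (cases k l rule: linorder_cases) auto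

lemma matrix_vector_sum: "A *v (\<Sum>i\<in>I. f i) = (\<Sum>i\<in>I. A *v f i)"
  for A :: "complex^'d^'d" and f :: "'i \<Rightarrow> complex^'d"
  by (rule bounded_bilinear.sum_right[OF bounded_bilinear_matrix_vector_mult])

text \<open>Gram-Schmidt uses only the inner product and linear combinations, so it commutes with
  unitary maps.\<close>

lemma gs_unitary:
  assumes g: "unitary g"
  shows "gs_residual (\<lambda>k. g *v b k) k = g *v gs_residual b k"
    and "gram_schmidt (\<lambda>k. g *v b k) k = g *v gram_schmidt b k"
proof -
  have *: "gs_residual (\<lambda>k. g *v b k) k = g *v gs_residual b k"
    if "\<And>l. l < k \<Longrightarrow> gram_schmidt (\<lambda>k. g *v b k) l = g *v gram_schmidt b l" for k
    unfolding gs_residual_def using that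
    by (simp add: unitary_herm_inner[OF g] matrix_vector_mult_diff_distrib matrix_vector_sum
        vector_scalar_commute)
  have **: "gram_schmidt (\<lambda>k. g *v b k) k = g *v gram_schmidt b k" for k
  proof (induction k rule: less_induct)
    case (less k)
    then show ?case using *[of k]
      by (simp add: gram_schmidt_residual[of _ k] unitary_norm[OF g] matrix_vector_scaleR)
  qed
  show "gs_residual (\<lambda>k. g *v b k) k = g *v gs_residual b k"
    and "gram_schmidt (\<lambda>k. g *v b k) k = g *v gram_schmidt b k"
    using * ** by auto
qed

text \<open>Normalisation removes the modulus of \<open>c\<close> and keeps its phase. Needed
  because the frame of a polygon is defined only up to a common scalar.\<close>

lemma gs_scale:
  assumes c: "c \<noteq> 0"
  shows "gs_residual (\<lambda>k. c *s b k) k = c *s gs_residual b k"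
    and "gram_schmidt (\<lambda>k. c *s b k) k = sgn c *s gram_schmidt b k"
proof -
  have sgn: "sgn c * cnj (sgn c) = 1"
    using c by (simp add: complex_norm_square[symmetric] norm_sgn)
  have *: "gs_residual (\<lambda>k. c *s b k) k = c *s gs_residual b k"
    if "\<And>l. l < k \<Longrightarrow> gram_schmidt (\<lambda>k. c *s b k) l = sgn c *s gram_schmidt b l" for k
  proof -
    have "herm_inner (c *s b k) (sgn c *s u) *s (sgn c *s u) = c *s (herm_inner (b k) u *s u)" for u
    proof -
      have "herm_inner (c *s b k) (sgn c *s u) *s (sgn c *s u) =
          ((sgn c * cnj (sgn c)) * c * herm_inner (b k) u) *s u"
        by (simp add: mult_ac)
      then show ?thesis unfolding sgn by simp
    qed
    then have "(\<Sum>l<k. herm_inner (c *s b k) (gram_schmidt (\<lambda>k. c *s b k) l) *s gram_schmidt (\<lambda>k. c *s b k) l)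
      = (\<Sum>l<k. c *s (herm_inner (b k) (gram_schmidt b l) *s gram_schmidt b l))"
      using that by (intro sum.cong) auto
    also have "\<dots> = c *s (\<Sum>l<k. herm_inner (b k) (gram_schmidt b l) *s gram_schmidt b l)"
      by (rule bounded_bilinear.sum_right[OF bounded_bilinear_vec_scale, symmetric])
    finally show ?thesis unfolding gs_residual_def by (simp only: vec.scale_right_diff_distrib)
  qed
  have **: "gram_schmidt (\<lambda>k. c *s b k) k = sgn c *s gram_schmidt b k" for k
  proof (induction k rule: less_induct)
    case (less k)
    have "sgn c = inverse (cmod c) *\<^sub>R c" by (simp add: sgn_div_norm)
    then have "sgn c *s v = inverse (cmod c) *\<^sub>R (c *s v)" for v :: "complex^'a"
      by (simp add: vec_eq_iff)
    then show ?case using *[of k] less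
      by (simp add: gram_schmidt_residual[of _ k] norm_vec_scale vector_scale_scaleR mult.commute)
  qed
  show "gs_residual (\<lambda>k. c *s b k) k = c *s gs_residual b k"
    and "gram_schmidt (\<lambda>k. c *s b k) k = sgn c *s gram_schmidt b k"
    using * ** by auto
qed

text \<open>Residuals are smooth one step further than the normalised vectors
  (\<open>k \<le> d\<close> against \<open>k < d\<close>), since they involve only earlier
  normalisations. The proof of openness uses \<open>k = d\<close>.\<close>

lemma smooth_gram_schmidt:
  assumes "\<And>k. smooth_map_on S (\<lambda>e. b e k)" "\<And>e l. e \<in> S \<Longrightarrow> l < d \<Longrightarrow> gs_residual (b e) l \<noteq> 0"
  shows "k \<le> d \<Longrightarrow> smooth_map_on S (\<lambda>e. gs_residual (b e) k)"
    and "k < d \<Longrightarrow> smooth_map_on S (\<lambda>e. gram_schmidt (b e) k)"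
proof -
  have *: "smooth_map_on S (\<lambda>e. gs_residual (b e) k)"
    if "\<And>l. l < k \<Longrightarrow> smooth_map_on S (\<lambda>e. gram_schmidt (b e) l)" for k
    unfolding gs_residual_def using that
    by (intro smooth_map_on_diff smooth_map_on_sum smooth_map_on_vec_scale smooth_map_on_herm_inner assms(1)) auto
  have **: "k < d \<Longrightarrow> smooth_map_on S (\<lambda>e. gram_schmidt (b e) k)" for k
  proof (induction k rule: less_induct)
    case (less k)
    then have "smooth_map_on S (\<lambda>e. gs_residual (b e) k)" using * by simp
    then show ?case unfolding gram_schmidt_residual
      using assms(2) less.prems
      by (intro smooth_map_on_scaleR smooth_map_on_inverse smooth_map_on_norm) auto
  qed
  show "k \<le> d \<Longrightarrow> smooth_map_on S (\<lambda>e. gs_residual (b e) k)"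
    and "k < d \<Longrightarrow> smooth_map_on S (\<lambda>e. gram_schmidt (b e) k)"
    using * ** by auto
qed

text \<open>Residual number \<open>d\<close> is known to be smooth only where the earlier ones do
  not vanish, so openness is gained one residual at a time.\<close>

lemma open_gs_residual:
  fixes b :: "'a::euclidean_space \<Rightarrow> nat \<Rightarrow> complex^'d"
  assumes b: "\<And>k S. smooth_map_on S (\<lambda>e. b e k)"
  shows "open {e. \<forall>l<d. gs_residual (b e) l \<noteq> 0}"
proof (induction d)
  case (Suc d)
  let ?X = "{e. \<forall>l<d. gs_residual (b e) l \<noteq> 0}"
  have "smooth_map_on ?X (\<lambda>e. gs_residual (b e) d)"
    by (rule smooth_gram_schmidt(1)[where d = d]) (use b in auto)
  then have "open (?X \<inter> (\<lambda>e. gs_residual (b e) d) -` (- {0}))"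
    by (intro continuous_open_preimage smooth_map_on_continuous Suc) auto
  moreover have "?X \<inter> (\<lambda>e. gs_residual (b e) d) -` (- {0}) = {e. \<forall>l<Suc d. gs_residual (b e) l \<noteq> 0}"
    by (auto simp: less_Suc_eq)
  ultimately show ?case by simp
qed auto

lemma gram_schmidt_in_span: "gram_schmidt b k \<in> vec.span (b ` {..k})"
proof (induction k rule: less_induct)
  case (less k)
  have "gram_schmidt b l \<in> vec.span (b ` {..k})" if "l < k" for l
    using less[OF that] vec.span_mono[of "b ` {..l}" "b ` {..k}"] that by force
  then have "gs_residual b k \<in> vec.span (b ` {..k})" unfolding gs_residual_def
    by (intro vec.span_diff vec.span_sum vec.span_scale) (auto intro: vec.span_base)
  moreover have "a *\<^sub>R v = of_real a *s v" for a and v :: "complex^'a"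
    by (simp add: vec_eq_iff scaleR_conv_of_real[where 'a=complex])
  ultimately show ?case by (simp add: gram_schmidt_residual vec.span_scale)
qed

lemma gs_residual_nonzero:
  fixes b :: "nat \<Rightarrow> complex^'d"
  assumes ind: "vec.independent (b ` {..<d})" and inj: "inj_on b {..<d}" and k: "k < d"
  shows "gs_residual b k \<noteq> 0"
proof
  assume 0: "gs_residual b k = 0"
  have "gram_schmidt b l \<in> vec.span (b ` {..<k})" if "l < k" for l
    using gram_schmidt_in_span[of b l] vec.span_mono[of "b ` {..l}" "b ` {..<k}"] that by force
  then have "(\<Sum>l<k. herm_inner (b k) (gram_schmidt b l) *s gram_schmidt b l) \<in> vec.span (b ` {..<k})"
    by (intro vec.span_sum vec.span_scale) auto
  then have "b k \<in> vec.span (b ` {..<k})" using 0 by (simp add: gs_residual_def)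
  moreover have "b ` {..<k} \<subseteq> b ` {..<d} - {b k}"
    using inj k by (auto simp: inj_on_def)
  ultimately have "b k \<in> vec.span (b ` {..<d} - {b k})" using vec.span_mono by blast
  then show False using ind k unfolding vec.dependent_def by blast
qed

section \<open>Slices for the unitary action\<close>

text \<open>Orders the coordinate type, on which the recursion of Gram-Schmidt over
  \<open>nat\<close> depends.\<close>

definition index_nat :: "'d::finite \<Rightarrow> nat" where
  "index_nat = (SOME h. bij_betw h UNIV {..<CARD('d)})"

lemma bij_index_nat: "bij_betw (index_nat :: 'd::finite \<Rightarrow> nat) UNIV {..<CARD('d)}"
proof -
  have "\<exists>h :: 'd \<Rightarrow> nat. bij_betw h UNIV {..<CARD('d)}"
    using ex_bij_betw_finite_nat[of "UNIV :: 'd set"] by (simp add: atLeast0LessThan)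
  then show ?thesis unfolding index_nat_def by (rule someI_ex)
qed

lemma index_nat_less: "index_nat (i :: 'd::finite) < CARD('d)"
  using bij_betwE[OF bij_index_nat] by blast

lemma index_nat_inject [simp]: "index_nat i = index_nat j \<longleftrightarrow> i = j"
  using bij_betw_imp_inj_on[OF bij_index_nat] by (auto dest: injD)

text \<open>The conjugates make it the coordinate map of the orthonormal basis: for regular
  \<open>b\<close> it sends the vector numbered \<open>index_nat i\<close> to the standard basis
  vector \<open>i\<close>.\<close>

definition gs_matrix :: "(nat \<Rightarrow> complex^'d) \<Rightarrow> complex^'d^'d" where
  "gs_matrix b = (\<chi> i j. cnj (gram_schmidt b (index_nat i) $ j))"

definition gs_regular :: "(nat \<Rightarrow> complex^'d) \<Rightarrow> bool" where
  "gs_regular b \<longleftrightarrow> (\<forall>k<CARD('d). gs_residual b k \<noteq> 0)"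

lemma unitary_gs_matrix:
  fixes b :: "nat \<Rightarrow> complex^'d"
  assumes "gs_regular b" shows "unitary (gs_matrix b)"
proof (rule unitaryI)
  have "(gs_matrix b ** conj_transpose (gs_matrix b)) $ i $ j =
      herm_inner (gram_schmidt b (index_nat j)) (gram_schmidt b (index_nat i))" for i j
    by (simp add: gs_matrix_def matrix_matrix_mult_def conj_transpose_def herm_inner_def mult.commute)
  also have "\<dots> i j = (if i = j then 1 else 0)" for i j
    using gram_schmidt_orthonormal[of "CARD('d)" b "index_nat j" "index_nat i"] assms
    by (auto simp: gs_regular_def index_nat_less)
  finally show "gs_matrix b ** conj_transpose (gs_matrix b) = mat 1"
    by (simp add: vec_eq_iff mat_def)
qed

lemma gs_matrix_unitary:
  assumes "unitary g"
  shows "gs_matrix (\<lambda>k. g *v b k) = gs_matrix b ** conj_transpose g"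
  by (simp only: gs_matrix_def gs_unitary[OF assms])
     (simp add: matrix_matrix_mult_def conj_transpose_def matrix_vector_mult_def vec_eq_iff mult.commute)

lemma gs_matrix_scale:
  fixes b :: "nat \<Rightarrow> complex^'d"
  assumes "c \<noteq> 0"
  shows "gs_matrix (\<lambda>k. c *s b k) = mat (cnj (sgn c)) ** gs_matrix b"
proof -
  have "(mat a ** A) $ i $ j = a * A $ i $ j" for a and A :: "complex^'d^'d" and i j
    by (simp add: matrix_matrix_mult_def mat_def if_distrib[of "\<lambda>x. x * _"] cong: if_cong)
  then show ?thesis by (simp add: gs_matrix_def gs_scale[OF assms] vec_eq_iff)
qed

lemma unitary_cancel:
  "unitary g \<Longrightarrow> conj_transpose g ** (g ** X) = X" "unitary g \<Longrightarrow> g ** (conj_transpose g ** X) = X"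
  by (simp_all add: matrix_mul_assoc unitary_def)

lemma unitary_cancel_vector: "unitary g \<Longrightarrow> conj_transpose g *v (g *v x) = x"
  by (simp add: matrix_vector_mul_assoc unitary_def)

lemma smooth_gs_matrix:
  fixes b :: "'a::euclidean_space \<Rightarrow> nat \<Rightarrow> complex^'d"
  assumes "\<And>k. smooth_map_on S (\<lambda>e. b e k)" "\<And>e. e \<in> S \<Longrightarrow> gs_regular (b e)"
  shows "smooth_map_on S (\<lambda>e. gs_matrix (b e))"
proof -
  have "linear cnj" by (rule linearI) auto
  then show ?thesis unfolding gs_matrix_def
    by (intro smooth_map_on_vec_lambda smooth_map_on_linear_compose[of cnj] smooth_map_on_vec_nth
        smooth_gram_schmidt(2)[where d = "CARD('d)"] assms(1))
      (use assms(2) in \<open>auto simp: gs_regular_def index_nat_less\<close>)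
qed

lemma act_scalar:
  fixes e :: "complex^'d^'d^'n"
  assumes "c * cnj c = 1" shows "act (mat c ** A) e = act A e"
proof -
  have "mat c ** X ** mat (cnj c) = X" for X :: "complex^'d^'d"
    using assms by (simp add: mat_mult_commute[of c X] matrix_mul_assoc[symmetric] mat_mult_mat)
  then have "act (mat c) e' = e'" for e' :: "complex^'d^'d^'n" by (simp add: act_def vec_eq_iff[where 'a="complex^'d^'d"])
  then show ?thesis by (metis act_act)
qed

section \<open>Words in the edges and normal forms\<close>

primrec word :: "complex^'d^'d^'n \<Rightarrow> 'n list \<Rightarrow> complex^'d^'d" where
  "word e [] = mat 1"
| "word e (i # l) = e $ i ** word e l"

lemma word_act:
  assumes "unitary g" shows "word (act g e) l = g ** word e l ** conj_transpose g"
proof (induction l)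
  case Nil
  then show ?case using assms by (simp add: unitary_def)
next
  case (Cons i l)
  then show ?case using assms
    by (simp add: act_nth matrix_mul_assoc[symmetric] unitary_cancel)
qed

text \<open>A vector \<open>x\<close> outside the kernel of \<open>e $ i\<close> determines \<open>e $ i *v x\<close> in the line that is
  the range of \<open>e $ i\<close>, up to a scalar factor; the words in the matrices of \<open>e\<close> turn it into a
  frame of the whole space.\<close>

definition frame :: "'n \<Rightarrow> (nat \<Rightarrow> 'n list) \<Rightarrow> complex^'d^'d^'n \<Rightarrow> complex^'d \<Rightarrow> nat \<Rightarrow> complex^'d" where
  "frame i ls e x k = word e (ls k) *v (e $ i *v x)"

abbreviation regular_frame :: "'n \<Rightarrow> (nat \<Rightarrow> 'n list) \<Rightarrow> complex^'d^'d^'n \<Rightarrow> complex^'d \<Rightarrow> bool" where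
  "regular_frame i ls e x \<equiv> gs_regular (frame i ls e x)"

definition normal_form :: "'n \<Rightarrow> (nat \<Rightarrow> 'n list) \<Rightarrow> complex^'d^'d^'n \<Rightarrow> complex^'d \<Rightarrow> complex^'d^'d^'n" where
  "normal_form i ls e x = act (gs_matrix (frame i ls e x)) e"

text \<open>The value does not depend on which regular \<open>x\<close> is selected
  (\<open>slice_map_eq\<close>), so near a given polygon one \<open>x\<close> may be kept
  fixed.\<close>

definition slice_map :: "'n \<Rightarrow> (nat \<Rightarrow> 'n list) \<Rightarrow> complex^'d^'d^'n \<Rightarrow> complex^'d^'d^'n" where
  "slice_map i ls e = normal_form i ls e (SOME x. regular_frame i ls e x)"

definition slice_domain :: "real^'n \<Rightarrow> 'n \<Rightarrow> (nat \<Rightarrow> 'n list) \<Rightarrow> (complex^'d^'d^'n) set" where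
  "slice_domain r i ls = {e \<in> nondecomposable_polygons r. \<exists>x. regular_frame i ls e x}"

lemma smooth_frame: "smooth_map_on S (\<lambda>e. frame i ls e x k)"
proof -
  have "smooth_map_on S (\<lambda>e. word e l)" for l
    by (induction l) (auto intro!: smooth_map_on_const smooth_map_on_matrix_mult smooth_map_on_vec_nth smooth_map_on_ident)
  then show ?thesis unfolding frame_def
    by (intro smooth_map_on_matrix_vector_mult smooth_map_on_vec_nth smooth_map_on_ident smooth_map_on_const)
qed

lemma open_regular_frame: "open {e :: complex^'d^'d^'n. regular_frame i ls e x}"
  unfolding gs_regular_def by (rule open_gs_residual) (rule smooth_frame)

lemma regular_frame_nonzero:
  fixes e :: "complex^'d^'d^'n"
  assumes "regular_frame i ls e x" shows "e $ i *v x \<noteq> 0"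
proof
  assume "e $ i *v x = 0"
  then have "gs_residual (frame i ls e x) 0 = 0" by (simp add: gs_residual_def frame_def)
  then show False using assms by (auto simp: gs_regular_def)
qed

lemma gs_regular_scale: "c \<noteq> 0 \<Longrightarrow> gs_regular (\<lambda>k. c *s b k) \<longleftrightarrow> gs_regular b"
  by (simp add: gs_regular_def gs_scale)

text \<open>As \<open>e $ i\<close> has rank one, replacing \<open>x\<close> by \<open>y\<close>
  multiplies the whole frame by one scalar; the Gram-Schmidt matrix changes by a phase, which acts
  trivially.\<close>

lemma regular_frame_change:
  fixes e :: "complex^'d^'d^'n"
  assumes r: "\<And>i. r $ i > 0" and e: "e \<in> closed_polygons r"
    and x: "regular_frame i ls e x" and y: "e $ i *v y \<noteq> 0"
  shows "regular_frame i ls e y" "normal_form i ls e y = normal_form i ls e x"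
proof -
  obtain u where u: "e $ i = rank_one u" using closed_polygonsE[OF r e] by metis
  define c where "c = herm_inner y u / herm_inner x u"
  have h: "herm_inner x u \<noteq> 0" "herm_inner y u \<noteq> 0"
    using y regular_frame_nonzero[OF x] by (auto simp: u rank_one_mult)
  have c: "c \<noteq> 0" using h by (simp add: c_def)
  have "e $ i *v y = c *s (e $ i *v x)" using h by (simp add: u rank_one_mult c_def)
  then have f: "frame i ls e y = (\<lambda>k. c *s frame i ls e x k)"
    by (simp add: frame_def fun_eq_iff vector_scalar_commute)
  show "regular_frame i ls e y" using x c by (simp add: f gs_regular_scale)
  have "cnj (sgn c) * cnj (cnj (sgn c)) = 1"
    using c by (simp add: complex_norm_square[symmetric] norm_sgn mult.commute)
  then show "normal_form i ls e y = normal_form i ls e x"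
    unfolding normal_form_def f gs_matrix_scale[OF c] by (rule act_scalar)
qed

lemma slice_map_eq:
  assumes r: "\<And>i. r $ i > 0" and e: "e \<in> closed_polygons r" and x: "regular_frame i ls e x"
  shows "slice_map i ls e = normal_form i ls e x"
  unfolding slice_map_def
  using regular_frame_change(2)[OF r e x, of "SOME x. regular_frame i ls e x"]
    regular_frame_nonzero[of i ls e "SOME x. regular_frame i ls e x"] x someI_ex[of "regular_frame i ls e"]
  by blast

lemma frame_act:
  assumes "unitary g"
  shows "frame i ls (act g e) (g *v x) = (\<lambda>k. g *v frame i ls e x k)"
  using assms
  by (simp add: fun_eq_iff frame_def word_act act_nth matrix_vector_mul_assoc[symmetric] unitary_cancel_vector)

text \<open>The frame moves with \<open>g\<close>, so its Gram-Schmidt matrix gains the adjoint of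
  \<open>g\<close> on the right, which cancels \<open>g\<close> in the action.\<close>

lemma regular_frame_act:
  fixes g :: "complex^'d^'d"
  assumes g: "unitary g" and x: "regular_frame i ls e x"
  shows "regular_frame i ls (act g e) (g *v x)"
    "normal_form i ls (act g e) (g *v x) = normal_form i ls e x"
proof -
  have "g *v v = 0 \<Longrightarrow> v = 0" for v using unitary_norm[OF g, of v] by simp
  then show "regular_frame i ls (act g e) (g *v x)"
    using x by (auto simp: gs_regular_def frame_act[OF g] gs_unitary[OF g])
  have "normal_form i ls (act g e) (g *v x) =
      act (gs_matrix (frame i ls e x) ** (conj_transpose g ** g)) e"
    by (simp add: normal_form_def frame_act[OF g] gs_matrix_unitary[OF g] act_act matrix_mul_assoc)
  then show "normal_form i ls (act g e) (g *v x) = normal_form i ls e x"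
    using g by (simp add: unitary_def normal_form_def)
qed

lemma slice_map_orbit:
  assumes r: "\<And>i. r $ i > 0" and e: "e \<in> slice_domain r i ls"
  obtains g where "unitary g" "slice_map i ls e = act g e"
proof -
  obtain x where x: "e \<in> closed_polygons r" "regular_frame i ls e x"
    using e by (auto simp: slice_domain_def)
  show thesis
    by (rule that[OF unitary_gs_matrix[OF x(2)]]) (simp add: slice_map_eq[OF r x] normal_form_def)
qed

lemma slice_domain_act:
  assumes r: "\<And>i. r $ i > 0" and e: "e \<in> slice_domain r i ls" and g: "unitary g"
  shows "act g e \<in> slice_domain r i ls" "slice_map i ls (act g e) = slice_map i ls e"
proof -
  obtain x where x: "e \<in> nondecomposable_polygons r" "e \<in> closed_polygons r" "regular_frame i ls e x"
    using e by (auto simp: slice_domain_def)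
  note ge = regular_frame_act[OF g x(3)]
  show "act g e \<in> slice_domain r i ls"
    using act_nondecomposable_polygons[OF r g x(1)] ge(1) by (auto simp: slice_domain_def)
  show "slice_map i ls (act g e) = slice_map i ls e"
    by (simp add: slice_map_eq[OF r x(2,3)] slice_map_eq[OF r act_closed_polygons[OF r g x(2)] ge(1)] ge(2))
qed

lemma slice_map_slice_domain:
  assumes r: "\<And>i. r $ i > 0" and e: "e \<in> slice_domain r i ls"
  shows "slice_map i ls e \<in> slice_domain r i ls" "slice_map i ls (slice_map i ls e) = slice_map i ls e"
  using slice_map_orbit[OF r e] slice_domain_act[OF r e] by metis+

lemma slice_map_eq_iff:
  assumes r: "\<And>i. r $ i > 0" and e: "e \<in> slice_domain r i ls" "e' \<in> slice_domain r i ls"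
  shows "slice_map i ls e = slice_map i ls e' \<longleftrightarrow> (\<exists>g. unitary g \<and> e' = act g e)"
proof
  assume eq: "slice_map i ls e = slice_map i ls e'"
  obtain g where g: "unitary g" "slice_map i ls e = act g e" by (rule slice_map_orbit[OF r e(1)])
  obtain h where h: "unitary h" "slice_map i ls e' = act h e'" by (rule slice_map_orbit[OF r e(2)])
  have "e' = act (conj_transpose h) (act h e')" using h(1) by (simp add: act_inverse)
  also have "\<dots> = act (conj_transpose h) (act g e)" using eq g(2) h(2) by simp
  also have "\<dots> = act (conj_transpose h ** g) e" by (rule act_act)
  finally show "\<exists>g. unitary g \<and> e' = act g e" using g h unitary_mult unitary_conj_transpose by blast
qed (use slice_domain_act(2)[OF r e(1)] in auto)

lemma openin_slice_domain:
  "openin (top_of_set (nondecomposable_polygons r)) (slice_domain r i ls)"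
proof -
  have "slice_domain r i ls = nondecomposable_polygons r \<inter> (\<Union>x. {e. regular_frame i ls e x})"
    by (auto simp: slice_domain_def)
  then show ?thesis by (metis open_UN open_regular_frame openin_open_Int)
qed

text \<open>The \<open>x\<close> selected by \<open>SOME\<close> may jump with \<open>e\<close>, but
  regularity of a fixed \<open>x\<close> persists on an open set, where the normal form is computed
  with that \<open>x\<close>.\<close>

lemma smooth_slice_map:
  fixes i :: "'n::finite"
  assumes r: "\<And>i. r $ i > 0"
  shows "smooth_map_on (slice_domain r i ls :: (complex^'d^'d^'n) set) (slice_map i ls)"
proof (rule smooth_map_on_locally)
  fix e :: "complex^'d^'d^'n" assume "e \<in> slice_domain r i ls"
  then obtain x where x: "regular_frame i ls e x" by (auto simp: slice_domain_def)
  let ?U = "{e :: complex^'d^'d^'n. regular_frame i ls e x}"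
  have "smooth_map_on ?U (\<lambda>e. gs_matrix (frame i ls e x))"
    by (rule smooth_gs_matrix) (auto intro: smooth_frame)
  then have "smooth_map_on ?U (\<lambda>e. normal_form i ls e x)"
    unfolding normal_form_def act_def
    by (intro smooth_map_on_vec_lambda smooth_map_on_matrix_mult smooth_map_on_conj_transpose
        smooth_map_on_vec_nth smooth_map_on_ident)
  then have "smooth_map_on (slice_domain r i ls \<inter> ?U) (\<lambda>e. normal_form i ls e x)"
    by (rule smooth_map_on_subset) auto
  then have "smooth_map_on (slice_domain r i ls \<inter> ?U) (slice_map i ls)"
    by (rule smooth_map_on_cong[rotated]) (auto simp: slice_domain_def slice_map_eq[OF r])
  then show "\<exists>U. open U \<and> e \<in> U \<and> smooth_map_on (slice_domain r i ls \<inter> U) (slice_map i ls)"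
    using x open_regular_frame[of i ls x] by blast
qed

text \<open>The words applied to \<open>v\<close> span a nonzero subspace invariant under all edges,
  hence everything by irreducibility; a basis among them supplies the list \<open>ls\<close>. Any
  index \<open>i\<close> will do.\<close>

lemma ex_slice_domain:
  fixes q :: "complex^'d^'d^'n"
  assumes r: "\<And>i. r $ i > 0" and q: "q \<in> nondecomposable_polygons r"
  obtains i ls where "q \<in> slice_domain r i ls"
proof -
  fix i :: 'n
  have q': "q \<in> closed_polygons r" using q by simp
  obtain w where w: "\<And>i. q $ i = rank_one (w i)" "\<And>i. w i \<noteq> 0"
    using closed_polygonsE[OF r q'] by metis
  define v where "v = q $ i *v w i"
  have v: "v \<noteq> 0" using w(2)[of i] by (simp add: v_def w(1) rank_one_mult vec.scale_eq_0_iff)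
  let ?S = "range (\<lambda>l. word q l *v v)"
  have inv: "q $ j *v u \<in> vec.span ?S" if "u \<in> vec.span ?S" for j u
  proof -
    have "q $ j *v (word q l *v v) \<in> vec.span ?S" for l
      by (rule vec.span_base) (auto simp: matrix_vector_mul_assoc intro!: image_eqI[of _ _ "j # l"])
    then have "?S \<subseteq> {u. q $ j *v u \<in> vec.span ?S}" by auto
    moreover have "vec.subspace {u. q $ j *v u \<in> vec.span ?S}"
      by (auto simp: vec.subspace_def matrix_vector_right_distrib vector_scalar_commute
          intro: vec.span_add vec.span_scale vec.span_zero)
    ultimately have "vec.span ?S \<subseteq> {u. q $ j *v u \<in> vec.span ?S}" by (rule vec.span_minimal)
    then show ?thesis using that by blast
  qed
  have "v \<in> vec.span ?S"
    by (rule vec.span_base) (auto intro!: image_eqI[of _ _ "[]"])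
  then have full: "vec.span ?S = UNIV"
    using invariant_subspace_polygon[OF r q vec.subspace_span inv _ v] by blast
  obtain B where B: "B \<subseteq> ?S" "vec.independent B" "?S \<subseteq> vec.span B"
    using vec.maximal_independent_subset by blast
  have "vec.span B = UNIV" using full vec.span_minimal[OF B(3) vec.subspace_span] by blast
  then have card: "card B = CARD('d)"
    using vec.dim_eq_card[of B UNIV] B(2) by (simp add: card_cart_basis)
  have "finite B" using B(2) vec.independent_bound_general by (metis vec.finiteI_independent)
  then obtain b where b: "bij_betw b {0..<card B} B" using ex_bij_betw_nat_finite by blast
  \<comment> \<open>Beyond \<open>CARD('d)\<close> the word is arbitrary; regularity looks only at
    smaller indices.\<close>
  have "\<forall>k. \<exists>l. k < CARD('d) \<longrightarrow> word q l *v v = b k"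
  proof
    fix k
    show "\<exists>l. k < CARD('d) \<longrightarrow> word q l *v v = b k"
    proof (cases "k < CARD('d)")
      case True
      then have "b k \<in> ?S" using B(1) bij_betwE[OF b] card by auto
      then show ?thesis by auto
    qed auto
  qed
  then obtain ls where ls: "\<And>k. k < CARD('d) \<Longrightarrow> word q (ls k) *v v = b k" by metis
  have fb: "frame i ls q (w i) k = b k" if "k < CARD('d)" for k
    using ls[OF that] by (simp add: frame_def v_def)
  have im: "frame i ls q (w i) ` {..<CARD('d)} = B"
    using b fb card by (simp add: bij_betw_def lessThan_atLeast0)
  moreover have "inj_on (frame i ls q (w i)) {..<CARD('d)}"
    by (rule eq_card_imp_inj_on) (simp_all add: im card)
  ultimately have "regular_frame i ls q (w i)"
    using gs_residual_nonzero[of "frame i ls q (w i)" "CARD('d)"] B(2) by (auto simp: gs_regular_def)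
  then show thesis using that q by (auto simp: slice_domain_def)
qed

section \<open>Velocities along orbits and along slices\<close>

lemma has_vector_derivative_act:
  fixes R :: "real \<Rightarrow> complex^'d^'d" and y :: "real \<Rightarrow> complex^'d^'d^'n"
  assumes R: "(R has_vector_derivative R') (at t)" and y: "(y has_vector_derivative y') (at t)"
  shows "((\<lambda>t. act (R t) (y t)) has_vector_derivative
    (\<chi> i. (R t ** y t $ i) ** conj_transpose R' + (R t ** y' $ i + R' ** y t $ i) ** conj_transpose (R t))) (at t)"
proof -
  have "bounded_linear (conj_transpose :: complex^'d^'d \<Rightarrow> _)"
    using linear_conj_transpose linear_conv_bounded_linear by blast
  note ct = bounded_linear.has_vector_derivative[OF this R]
  have yi: "((\<lambda>t. y t $ i) has_vector_derivative y' $ i) (at t)" for i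
    by (rule bounded_linear.has_vector_derivative[OF bounded_linear_vec_nth y])
  note mm = bounded_bilinear.has_vector_derivative[OF bounded_bilinear_matrix_mult]
  have "((\<lambda>t. R t ** y t $ i ** conj_transpose (R t)) has_vector_derivative
      (R t ** y t $ i) ** conj_transpose R' + (R t ** y' $ i + R' ** y t $ i) ** conj_transpose (R t)) (at t)" for i
    by (rule mm[OF mm[OF R yi] ct])
  then have "((\<lambda>t. \<chi> i. R t ** y t $ i ** conj_transpose (R t)) has_derivative
     (\<lambda>h. \<chi> i. h *\<^sub>R ((R t ** y t $ i) ** conj_transpose R' + (R t ** y' $ i + R' ** y t $ i) ** conj_transpose (R t)))) (at t)"
    unfolding has_vector_derivative_def by (rule has_derivative_vec_lambda)
  then show ?thesis unfolding act_def has_vector_derivative_def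
    by (rule has_derivative_eq_rhs) (simp add: fun_eq_iff vec_eq_iff[where 'a="complex^'d^'d"])
qed


text \<open>Moving \<open>q\<close> by the explicit unitary curve of a generator stays in the orbit,
  on which \<open>slice_map\<close> is constant.\<close>

lemma orbit_curve_in_fibre:
  fixes q :: "complex^'d^'d^'n"
  assumes r: "\<And>i. r $ i > 0" and q: "q \<in> slice_domain r i ls" and v: "v \<in> commutator q ` skew_rank_one"
  shows "\<exists>c. continuous_on UNIV c \<and> range c \<subseteq> slice_domain r i ls \<and> c (0::real) = q \<and>
    (\<forall>t. slice_map i ls (c t) = slice_map i ls q) \<and> (c has_vector_derivative v) (at 0)"
proof -
  obtain w :: "complex^'d" where w: "norm w = 1" "v = commutator q (outer (\<i> *s w) w)"
    using v by (auto simp: skew_rank_one_def)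
  obtain R :: "real \<Rightarrow> complex^'d^'d" where R: "\<And>t. unitary (R t)" "R 0 = mat 1"
    "(R has_vector_derivative outer (\<i> *s w) w) (at 0)" "continuous_on UNIV R"
    using unitary_curve[OF w(1)] by metis
  have ct: "conj_transpose (outer (\<i> *s w) w) = - outer (\<i> *s w) w"
    by (simp add: conj_transpose_def outer_def vec_eq_iff)
  have "v = (\<chi> j. (R 0 ** q $ j) ** conj_transpose (outer (\<i> *s w) w)
      + (R 0 ** 0 $ j + outer (\<i> *s w) w ** q $ j) ** conj_transpose (R 0))"
    unfolding w(2) commutator_def ct R(2)
    by (simp add: bounded_bilinear.minus_right[OF bounded_bilinear_matrix_mult] vec_eq_iff[where 'a="complex^'d^'d"])
  with has_vector_derivative_act[OF R(3) has_vector_derivative_const, of q]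
  have "((\<lambda>t. act (R t) q) has_vector_derivative v) (at 0)" by (simp only:)
  moreover have "continuous_on UNIV (\<lambda>t. act (R t) q)"
    unfolding act_def
    by (intro continuous_on_vec_lambda bounded_bilinear.continuous_on[OF bounded_bilinear_matrix_mult]
        continuous_on_const R(4) linear_continuous_on_compose[OF R(4)] linear_conj_transpose)
  ultimately show ?thesis
    using slice_domain_act[OF r q R(1)] R(2) by (intro exI[of _ "\<lambda>t. act (R t) q"]) auto
qed

text \<open>Near 0 the slice map is conjugation of \<open>y t\<close> by a smooth unitary
  \<open>A t\<close>, and \<open>A 0\<close> is scalar. A vanishing derivative then makes
  \<open>v\<close> cancel the velocity of conjugation, that is, makes it tangent to the
  orbit.\<close>

lemma kernel_slice_map:
  fixes q :: "complex^'d^'d^'n"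
  assumes r: "\<And>i. r $ i > 0" and q: "q \<in> slice_domain r i ls" "slice_map i ls q = q"
    and y: "\<epsilon> > (0::real)" "smooth_map_on {-\<epsilon><..<\<epsilon>} y" "y ` {-\<epsilon><..<\<epsilon>} \<subseteq> slice_domain r i ls" "y 0 = q"
      "(y has_vector_derivative v) (at 0)"
      "((\<lambda>t. slice_map i ls (y t)) has_vector_derivative 0) (at 0)"
  shows "v \<in> commutator q ` skew_hermitian"
proof -
  obtain x where x: "q \<in> nondecomposable_polygons r" "q \<in> closed_polygons r" "regular_frame i ls q x"
    using q(1) by (auto simp: slice_domain_def)
  let ?U = "{e :: complex^'d^'d^'n. regular_frame i ls e x}"
  let ?J = "{-\<epsilon><..<\<epsilon>} \<inter> y -` ?U"
  have J: "open ?J" "0 \<in> ?J"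
    using continuous_open_preimage[OF smooth_map_on_continuous[OF y(2)] _ open_regular_frame] y(1,4) x(3) by auto
  define A where "A t = gs_matrix (frame i ls (y t) x)" for t
  have sU: "smooth_map_on ?U (\<lambda>e. gs_matrix (frame i ls e x))"
    by (rule smooth_gs_matrix) (auto intro: smooth_frame)
  have "smooth_map_on ?J A" unfolding A_def
    by (rule smooth_map_on_compose[OF smooth_map_on_subset[OF y(2)] sU]) auto
  then obtain D where "(A has_derivative D) (at 0)"
    using smooth_map_on_imp_has_derivative[OF J(1) _ J(2)] by blast
  then obtain A' where A': "(A has_vector_derivative A') (at 0)"
    using has_vector_derivative_def differentiableI vector_derivative_works by metis
  have yJ: "slice_map i ls (y t) = act (A t) (y t)" "unitary (A t)" if "t \<in> ?J" for t
  proof -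
    have "y t \<in> slice_domain r i ls" using that y(3) by blast
    then have "y t \<in> closed_polygons r" "regular_frame i ls (y t) x" using that by (auto simp: slice_domain_def)
    then show "slice_map i ls (y t) = act (A t) (y t)" "unitary (A t)"
      by (simp_all add: slice_map_eq[OF r] normal_form_def A_def unitary_gs_matrix)
  qed
  note mm = bounded_bilinear_matrix_mult
  \<comment> \<open>\<open>q\<close> is its own normal form, so \<open>A 0\<close> stabilises it and
    Schur's lemma applies.\<close>
  have "A 0 ** q $ j = q $ j ** A 0" for j
  proof -
    have "act (A 0) q $ j ** A 0 = q $ j ** A 0" using yJ(1)[OF J(2)] q(2) y(4) by simp
    then show ?thesis using yJ(2)[OF J(2)]
      by (simp add: act_nth matrix_mul_assoc[symmetric] unitary_def)
  qed
  then obtain c where c: "A 0 = mat c" using schur_polygon[OF r x(1)] by blast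
  have cc: "cnj c * c = 1"
    using yJ(2)[OF J(2)] by (simp add: c unitary_def mat_mult_mat mat_inject)
  \<comment> \<open>Dividing by the phase \<open>c\<close> brings the velocity of \<open>A\<close>
    to the identity, where differentiating unitarity makes it skew-Hermitian.\<close>
  define B where "B = mat (cnj c) ** A'"
  have "((\<lambda>t. A t ** conj_transpose (A t)) has_vector_derivative
      A 0 ** conj_transpose A' + A' ** conj_transpose (A 0)) (at 0)"
    by (rule bounded_bilinear.has_vector_derivative[OF mm A' bounded_linear.has_vector_derivative[OF _ A']])
       (simp add: linear_conj_transpose flip: linear_conv_bounded_linear)
  then have "((\<lambda>t. mat 1) has_vector_derivative A 0 ** conj_transpose A' + A' ** conj_transpose (A 0)) (at 0)"
    by (rule has_vector_derivative_transform_within_open[OF _ J]) (use yJ(2) in \<open>auto simp: unitary_def\<close>)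
  then have "A 0 ** conj_transpose A' + A' ** conj_transpose (A 0) = 0"
    using has_vector_derivative_const vector_derivative_unique_at by blast
  then have B: "conj_transpose B = - B"
    by (simp add: c B_def conj_transpose_mult mat_mult_commute eq_neg_iff_add_eq_0)
  have "((\<lambda>t. act (A t) (y t)) has_vector_derivative 0) (at 0)"
    by (rule has_vector_derivative_transform_within_open[OF y(6) J]) (rule yJ(1))
  then have 0: "(\<chi> j. (A 0 ** y 0 $ j) ** conj_transpose A' + (A 0 ** v $ j + A' ** y 0 $ j) ** conj_transpose (A 0)) = 0"
    using has_vector_derivative_act[OF A' y(5)] vector_derivative_unique_at by blast
  have "v $ j = commutator q (- B) $ j" for j
  proof -
    have "(A 0 ** q $ j) ** conj_transpose A' + (A 0 ** v $ j + A' ** q $ j) ** conj_transpose (A 0) = 0"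
      using arg_cong[OF 0, of "\<lambda>z. z $ j"] by (simp add: y(4))
    moreover have "(A 0 ** q $ j) ** conj_transpose A' = q $ j ** conj_transpose B"
      by (simp add: c B_def conj_transpose_mult mat_mult_commute[of c] matrix_mul_assoc[symmetric])
    moreover have "(A 0 ** v $ j) ** conj_transpose (A 0) = v $ j"
      using cc by (simp add: c mat_mult_commute[of c] matrix_mul_assoc[symmetric] mat_mult_mat mult.commute)
    moreover have "(A' ** q $ j) ** conj_transpose (A 0) = B ** q $ j"
      by (simp add: c B_def mat_mult_commute[of "cnj c"] matrix_mul_assoc[symmetric])
    ultimately have "v $ j + B ** q $ j = q $ j ** B"
      by (simp add: B bounded_bilinear.minus_right[OF mm] bounded_bilinear.add_left[OF mm] algebra_simps)
    then show ?thesis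
      by (simp add: commutator_def bounded_bilinear.minus_left[OF mm] bounded_bilinear.minus_right[OF mm] algebra_simps)
  qed
  then have "v = commutator q (- B)" by (simp add: vec_eq_iff[where 'a="complex^'d^'d"])
  moreover have "- B \<in> skew_hermitian"
    using B by (simp add: skew_hermitian_def linear_neg[OF linear_conj_transpose])
  ultimately show ?thesis by blast
qed

text \<open>The prescribed dimension is that of the polygon space less that of an orbit. Neither
  depends on \<open>q\<close>, \<open>i\<close> or \<open>ls\<close>, so one \<open>L\<close> serves
  all slices.\<close>

lemma slice_chart:
  fixes q :: "complex^'d^'d^'n" and L :: "'c::euclidean_space set"
  assumes r: "\<And>i. r $ i > 0" and q: "q \<in> slice_domain r i ls" "slice_map i ls q = q"
    and L: "subspace L" "dim L = DIM(complex^'d^'n)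
      - dim (moment_range :: ((real^'n) \<times> (real^'n) \<times> (complex^'d^'d)) set)
      - (dim (skew_hermitian :: (complex^'d^'d) set) - dim (skew_hermitian \<inter> range mat :: (complex^'d^'d) set))"
  shows "chart_at L {e \<in> slice_domain r i ls. slice_map i ls e = e} q"
proof -
  have q': "q \<in> nondecomposable_polygons r" using q(1) by (simp add: slice_domain_def)
  obtain K :: "(complex^'d^'n) set" where K: "subspace K" "chart_at K (nondecomposable_polygons r) q"
    "dim (moment_range :: ((real^'n) \<times> (real^'n) \<times> (complex^'d^'d)) set) + dim K = DIM(complex^'d^'n)"
    by (rule nondecomposable_polygons_chart[OF r q'])
  have span: "span (commutator q ` skew_rank_one) = commutator q ` skew_hermitian"
    by (simp add: linear_span_image[OF linear_commutator] span_skew_rank_one)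
  show ?thesis
  proof (rule chart_at_slice[OF K(2,1) openin_slice_domain q(1) smooth_slice_map[OF r], where G = "commutator q ` skew_rank_one"])
    show "slice_map i ls ` slice_domain r i ls \<subseteq> slice_domain r i ls"
      using slice_map_slice_domain(1)[OF r] by blast
    show "slice_map i ls (slice_map i ls x) = slice_map i ls x" if "x \<in> slice_domain r i ls" for x
      using slice_map_slice_domain(2)[OF r that] .
    show "dim L = dim K - dim (commutator q ` skew_rank_one)"
      using L(2) K(3) dim_commutator[OF r q'] by linarith
    fix v assume "v \<in> commutator q ` skew_rank_one"
    from orbit_curve_in_fibre[OF r q(1) this] obtain c where
      "continuous_on UNIV c" "range c \<subseteq> slice_domain r i ls" "c (0::real) = q"
      "\<And>t. slice_map i ls (c t) = slice_map i ls q" "(c has_vector_derivative v) (at 0)" by blast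
    then show "\<exists>c \<epsilon>. (0::real) < \<epsilon> \<and> continuous_on {-\<epsilon><..<\<epsilon>} c \<and> c ` {-\<epsilon><..<\<epsilon>} \<subseteq> slice_domain r i ls \<and>
        c 0 = q \<and> (\<forall>t\<in>{-\<epsilon><..<\<epsilon>}. slice_map i ls (c t) = q) \<and> (c has_vector_derivative v) (at 0)"
      using q(2) by (intro exI[of _ c] exI[of _ 1]) (auto intro: continuous_on_subset)
  next
    show "v \<in> span (commutator q ` skew_rank_one)"
      if "0 < \<epsilon>" "smooth_map_on {-\<epsilon><..<\<epsilon>} y" "y ` {-\<epsilon><..<\<epsilon>} \<subseteq> slice_domain r i ls" "y 0 = q"
        "(y has_vector_derivative v) (at 0)" "((\<lambda>t. slice_map i ls (y t)) has_vector_derivative 0) (at 0)"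
      for y and \<epsilon> :: real and v
      unfolding span by (rule kernel_slice_map[OF r q that])
  qed (use q L in auto)
qed

section \<open>Quotient manifolds\<close>

text \<open>\<open>Y\<close> is open and saturated, \<open>h\<close> is the chart read upstairs and
  \<open>g\<close> a smooth local section. Smoothness on the quotient is handled through
  \<open>h\<close> and \<open>g\<close> alone.\<close>

definition quotient_chart ::
    "'a::euclidean_space set \<Rightarrow> 'b::euclidean_space set \<Rightarrow> ('a \<Rightarrow> 'x) \<Rightarrow> 'x set \<Rightarrow> ('x \<Rightarrow> 'b) \<Rightarrow>
     'a set \<Rightarrow> 'b set \<Rightarrow> ('a \<Rightarrow> 'b) \<Rightarrow> ('b \<Rightarrow> 'a) \<Rightarrow> bool" where
  "quotient_chart E L \<pi> U \<phi> Y V h g \<longleftrightarrow>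
     openin (top_of_set E) Y \<and> (\<forall>x\<in>E. \<pi> x \<in> U \<longrightarrow> x \<in> Y) \<and> U = \<pi> ` Y \<and>
     openin (top_of_set L) V \<and> smooth_map_on Y h \<and> h ` Y \<subseteq> V \<and> smooth_map_on V g \<and> g ` V \<subseteq> Y \<and>
     (\<forall>y\<in>V. h (g y) = y) \<and> (\<forall>x\<in>Y. \<pi> (g (h x)) = \<pi> x) \<and> (\<forall>x\<in>Y. \<phi> (\<pi> x) = h x)"

text \<open>The retraction \<open>s\<close> is constant on classes, so a chart of the slice composed
  with \<open>s\<close> descends to the quotient, and the inverse chart serves as section.\<close>

lemma quotient_chart_exists:
  assumes U: "p \<in> U" "openin (top_of_set E) U" "\<And>x. x \<in> E \<Longrightarrow> \<pi> x \<in> \<pi> ` U \<Longrightarrow> x \<in> U"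
    and s: "smooth_map_on U s" "s ` U \<subseteq> U" "\<And>x. x \<in> U \<Longrightarrow> \<pi> (s x) = \<pi> x"
      "\<And>x y. x \<in> U \<Longrightarrow> y \<in> U \<Longrightarrow> \<pi> x = \<pi> y \<Longrightarrow> s x = s y"
    and chart: "chart_at L {x \<in> U. s x = x} (s p)"
  shows "\<exists>O' \<phi> Y V h g. p \<in> Y \<and> quotient_chart E L \<pi> O' \<phi> Y V h g"
proof -
  let ?S = "{x \<in> U. s x = x}"
  obtain W V f g where c: "s p \<in> W" "openin (top_of_set ?S) W" "openin (top_of_set L) V"
    "smooth_map_on W f" "smooth_map_on V g" "f ` W \<subseteq> V" "g ` V \<subseteq> W"
    "\<And>x. x \<in> W \<Longrightarrow> g (f x) = x" "\<And>y. y \<in> V \<Longrightarrow> f (g y) = y"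
    using chart_atE[OF chart] by blast
  have WS: "W \<subseteq> ?S" using c(2) openin_imp_subset by blast
  define Y where "Y = U \<inter> s -` W"
  have UE: "U \<subseteq> E" using U(2) openin_imp_subset by blast
  have ss: "s x \<in> ?S" if "x \<in> U" for x
    using s(2) s(4)[OF _ that s(3)[OF that]] that by blast
  have "openin (top_of_set U) Y" unfolding Y_def
    by (rule continuous_openin_preimage[OF smooth_map_on_continuous[OF s(1)] _ c(2)]) (use ss in auto)
  then have oY: "openin (top_of_set E) Y" using U(2) openin_trans by blast
  define \<phi> where "\<phi> = (\<lambda>c. f (s (SOME x. x \<in> Y \<and> \<pi> x = c)))"
  have phi: "\<phi> (\<pi> x) = f (s x)" if "x \<in> Y" for x
  proof -
    have "(SOME z. z \<in> Y \<and> \<pi> z = \<pi> x) \<in> Y \<and> \<pi> (SOME z. z \<in> Y \<and> \<pi> z = \<pi> x) = \<pi> x"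
      by (rule someI[of _ x]) (use that in simp)
    then have "s (SOME z. z \<in> Y \<and> \<pi> z = \<pi> x) = s x"
      by (intro s(4)) (use that in \<open>auto simp: Y_def\<close>)
    then show ?thesis by (simp add: \<phi>_def)
  qed
  have "quotient_chart E L \<pi> (\<pi> ` Y) \<phi> Y V (\<lambda>x. f (s x)) g"
    unfolding quotient_chart_def
  proof (intro conjI ballI impI oY refl c(3,5) phi)
    show "x \<in> Y" if x: "x \<in> E" "\<pi> x \<in> \<pi> ` Y" for x
    proof -
      obtain y where y: "y \<in> Y" "\<pi> x = \<pi> y" using x(2) by blast
      then have "x \<in> U" using U(3)[OF x(1)] by (auto simp: Y_def)
      moreover have "y \<in> U" using y(1) by (simp add: Y_def)
      ultimately have "s x = s y" using y(2) by (rule s(4))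
      then show ?thesis using y \<open>x \<in> U\<close> by (simp add: Y_def)
    qed
    show "smooth_map_on Y (\<lambda>x. f (s x))"
      by (rule smooth_map_on_compose[OF smooth_map_on_subset[OF s(1)] c(4)]) (auto simp: Y_def)
    show "(\<lambda>x. f (s x)) ` Y \<subseteq> V" using c(6) by (auto simp: Y_def)
    have gW: "g y \<in> W" if "y \<in> V" for y using c(7) that by blast
    have gy: "g y \<in> W" "s (g y) = g y" "g y \<in> U" if "y \<in> V" for y
      using gW[OF that] subsetD[OF WS gW[OF that]] by simp_all
    then show "g ` V \<subseteq> Y" by (auto simp: Y_def)
    show "f (s (g y)) = y" if "y \<in> V" for y using gy[OF that] c(9)[OF that] by simp
    show "\<pi> (g (f (s x))) = \<pi> x" if "x \<in> Y" for x using that c(8) s(3) by (simp add: Y_def)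
  qed
  moreover have "p \<in> Y" using U(1) c(1) by (simp add: Y_def)
  ultimately show ?thesis by blast
qed

text \<open>\<open>\<phi>\<close> is continuous because \<open>\<phi>\<close> after
  \<open>\<pi>\<close> is \<open>h\<close>, and \<open>\<pi>\<close> restricted to the saturated
  open set \<open>Y\<close> is still a quotient map; its inverse is \<open>\<pi>\<close> after
  \<open>g\<close>.\<close>

lemma quotient_chart_homeomorphic:
  assumes qm: "quotient_map (top_of_set E) X \<pi>" and q: "quotient_chart E L \<pi> U \<phi> Y V h g"
  shows "openin X U" "\<phi> ` U = V" "homeomorphic_map (subtopology X U) (top_of_set V) \<phi>"
    "\<And>y. y \<in> V \<Longrightarrow> inv_into U \<phi> y = \<pi> (g y)"
proof -
  have Y: "openin (top_of_set E) Y" "\<And>x. x \<in> E \<Longrightarrow> \<pi> x \<in> U \<Longrightarrow> x \<in> Y" "U = \<pi> ` Y"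
    "openin (top_of_set L) V" "smooth_map_on Y h" "h ` Y \<subseteq> V" "smooth_map_on V g" "g ` V \<subseteq> Y"
    "\<And>y. y \<in> V \<Longrightarrow> h (g y) = y" "\<And>x. x \<in> Y \<Longrightarrow> \<pi> (g (h x)) = \<pi> x" "\<And>x. x \<in> Y \<Longrightarrow> \<phi> (\<pi> x) = h x"
    using q by (auto simp: quotient_chart_def)
  have YE: "Y \<subseteq> E" using Y(1) openin_imp_subset by blast
  have pre: "{x \<in> topspace (top_of_set E). \<pi> x \<in> U} = Y" using Y(2,3) YE by auto
  have top: "topspace X = \<pi> ` E" using quotient_imp_surjective_map[OF qm] by simp
  then have "U \<subseteq> topspace X" using Y(3) YE by auto
  then show oU: "openin X U"
    using qm pre Y(1) unfolding quotient_map_def by metis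
  have gV: "g y \<in> Y" if "y \<in> V" for y using Y(8) that by blast
  have hY: "h x \<in> V" if "x \<in> Y" for x using Y(6) that by blast
  have phig: "\<phi> (\<pi> (g y)) = y" if "y \<in> V" for y using Y(9,11) gV[OF that] that by simp
  show im: "\<phi> ` U = V"
  proof
    show "\<phi> ` U \<subseteq> V" using Y(3,11) hY by auto
    show "V \<subseteq> \<phi> ` U" using phig gV Y(3) by (metis imageI subsetI)
  qed
  have "quotient_map (subtopology (top_of_set E) Y) (subtopology X U) \<pi>"
    by (rule quotient_map_restriction[OF qm pre]) (use oU in simp)
  moreover have "subtopology (top_of_set E) Y = top_of_set Y"
    using YE by (simp add: subtopology_subtopology Int_absorb1)
  ultimately have qY: "quotient_map (top_of_set Y) (subtopology X U) \<pi>" by simp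
  have "continuous_map (top_of_set Y) (top_of_set V) h"
    using smooth_map_on_continuous[OF Y(5)] hY by (auto simp: image_subset_iff)
  then have "continuous_map (top_of_set Y) (top_of_set V) (\<phi> \<circ> \<pi>)"
    by (rule continuous_map_eq) (simp add: Y(11))
  then have c1: "continuous_map (subtopology X U) (top_of_set V) \<phi>"
    using continuous_compose_quotient_map_eq[OF qY] by blast
  have "continuous_map (top_of_set V) (top_of_set Y) g"
    using smooth_map_on_continuous[OF Y(7)] gV by (auto simp: image_subset_iff)
  then have c2: "continuous_map (top_of_set V) (subtopology X U) (\<pi> \<circ> g)"
    using quotient_imp_continuous_map[OF qY] by (rule continuous_map_compose)
  have "homeomorphic_maps (subtopology X U) (top_of_set V) \<phi> (\<pi> \<circ> g)"
    unfolding homeomorphic_maps_def using c1 c2 Y(3,10,11) phig by auto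
  then show "homeomorphic_map (subtopology X U) (top_of_set V) \<phi>" by (rule homeomorphic_maps_imp_map)
  have inj: "inj_on \<phi> U"
    by (rule inj_on_inverseI[of _ "\<pi> \<circ> g"]) (use Y(3,10,11) in auto)
  show "inv_into U \<phi> y = \<pi> (g y)" if "y \<in> V" for y
    using inv_into_f_eq[OF inj, of "\<pi> (g y)" y] phig[OF that] gV[OF that] Y(3) by blast
qed

lemma second_countable_euclidean: "second_countable (euclidean :: 'a::second_countable_topology topology)"
proof -
  obtain B :: "'a set set" where B: "countable B" "topological_basis B"
    using ex_countable_basis by blast
  have "\<exists>V\<in>B. x \<in> V \<and> V \<subseteq> U" if "open U" "x \<in> U" for U x
    by (rule topological_basisE[OF B(2) that]) blast
  moreover have "open V" if "V \<in> B" for V using topological_basis_open[OF B(2) that] .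
  ultimately show ?thesis unfolding second_countable_def using B(1) by auto
qed

text \<open>A change of quotient charts is \<open>h'\<close> after a section \<open>g\<close>, hence
  smooth. Openness of \<open>\<pi>\<close> gives second countability. A section meets each class at
  most once, so the maps \<open>\<tau>\<close> are needed to lift curves through the other
  points.\<close>

lemma smooth_quotient_manifold:
  fixes E :: "'a::euclidean_space set" and L :: "'b::euclidean_space set" and \<pi> :: "'a \<Rightarrow> 'x"
  assumes qm: "quotient_map (top_of_set E) X \<pi>" and om: "open_map (top_of_set E) X \<pi>"
    and H: "Hausdorff_space X" and L: "subspace L"
    and chart: "\<And>p. p \<in> E \<Longrightarrow> \<exists>O' \<phi> Y V h g. p \<in> Y \<and> quotient_chart E L \<pi> O' \<phi> Y V h g"
    and transl: "\<And>x y. x \<in> E \<Longrightarrow> y \<in> E \<Longrightarrow> \<pi> x = \<pi> y \<Longrightarrow>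
      \<exists>\<tau>. smooth_map_on E \<tau> \<and> \<tau> ` E \<subseteq> E \<and> \<tau> y = x \<and> (\<forall>z\<in>E. \<pi> (\<tau> z) = \<pi> z)"
  shows "\<exists>\<A>. smooth_manifold L X \<A> \<and> smooth_submersion E L \<A> \<pi>"
proof -
  define \<A> where "\<A> = {(U, \<phi>). \<exists>Y V h g. quotient_chart E L \<pi> U \<phi> Y V h g}"
  have top: "topspace X = \<pi> ` E" using quotient_imp_surjective_map[OF qm] by simp
  have "second_countable X"
    by (rule second_countable_open_map_image[OF quotient_imp_continuous_map[OF qm] om])
       (use quotient_imp_surjective_map[OF qm] second_countable_subtopology[OF second_countable_euclidean] in auto)
  have cover: "(\<Union>(U, \<phi>)\<in>\<A>. U) = topspace X"
  proof
    show "(\<Union>(U, \<phi>)\<in>\<A>. U) \<subseteq> topspace X"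
    proof
      fix c assume "c \<in> (\<Union>(U, \<phi>)\<in>\<A>. U)"
      then obtain U \<phi> Y V h g where c: "c \<in> U" and q: "quotient_chart E L \<pi> U \<phi> Y V h g"
        by (auto simp: \<A>_def)
      show "c \<in> topspace X" using openin_subset[OF quotient_chart_homeomorphic(1)[OF qm q]] c by blast
    qed
    show "topspace X \<subseteq> (\<Union>(U, \<phi>)\<in>\<A>. U)"
    proof
      fix c assume "c \<in> topspace X"
      then obtain p where p: "p \<in> E" "c = \<pi> p" using top by auto
      obtain U \<phi> Y V h g where "p \<in> Y" and q: "quotient_chart E L \<pi> U \<phi> Y V h g"
        using chart[OF p(1)] by blast
      then have "(U, \<phi>) \<in> \<A>" "c \<in> U" using p by (auto simp: \<A>_def quotient_chart_def)
      then show "c \<in> (\<Union>(U, \<phi>)\<in>\<A>. U)" by blast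
    qed
  qed
  have "smooth_atlas L X \<A>"
    unfolding smooth_atlas_def
  proof (intro conjI L cover ballI)
    fix a assume "a \<in> \<A>"
    then obtain U \<phi> Y V h g where a: "a = (U, \<phi>)" and q: "quotient_chart E L \<pi> U \<phi> Y V h g"
      by (auto simp: \<A>_def)
    note qq = quotient_chart_homeomorphic[OF qm q]
    have "openin (top_of_set L) V" using q by (simp add: quotient_chart_def)
    then show "case a of (U, \<phi>) \<Rightarrow> openin X U \<and> openin (top_of_set L) (\<phi> ` U) \<and>
        homeomorphic_map (subtopology X U) (top_of_set (\<phi> ` U)) \<phi>"
      using qq by (simp add: a)
    show "case a of (U, \<phi>) \<Rightarrow> \<forall>(V, \<psi>)\<in>\<A>. smooth_map_on (\<phi> ` (U \<inter> V)) (\<lambda>y. \<psi> (inv_into U \<phi> y))"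
      unfolding a prod.case
    proof (rule ballI)
      fix b assume "b \<in> \<A>"
      then obtain U' \<psi> Y' V' h' g' where b: "b = (U', \<psi>)" and q': "quotient_chart E L \<pi> U' \<psi> Y' V' h' g'"
        by (auto simp: \<A>_def)
      have gY: "y \<in> V \<and> g y \<in> Y'" if y_in: "y \<in> \<phi> ` (U \<inter> U')" for y
      proof -
        obtain c where c: "y = \<phi> c" "c \<in> U" "c \<in> U'" using y_in by blast
        then obtain x where x: "x \<in> Y" "c = \<pi> x" using q by (auto simp: quotient_chart_def)
        then have y: "y = h x" using c q by (simp add: quotient_chart_def)
        then have "y \<in> V" "\<pi> (g y) = c" using x q by (auto simp: quotient_chart_def)
        moreover have "g y \<in> E"
          using \<open>y \<in> V\<close> q openin_imp_subset by (fastforce simp: quotient_chart_def)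
        ultimately show ?thesis using c(3) q' by (auto simp: quotient_chart_def)
      qed
      have sg: "smooth_map_on V g" and sh: "smooth_map_on Y' h'"
        using q q' by (simp_all add: quotient_chart_def)
      have "smooth_map_on (\<phi> ` (U \<inter> U')) (\<lambda>y. h' (g y))"
        by (rule smooth_map_on_compose[OF smooth_map_on_subset[OF sg] sh]) (use gY in auto)
      then have "smooth_map_on (\<phi> ` (U \<inter> U')) (\<lambda>y. \<psi> (inv_into U \<phi> y))"
      proof (rule smooth_map_on_cong[rotated])
        fix y assume "y \<in> \<phi> ` (U \<inter> U')"
        from gY[OF this] show "h' (g y) = \<psi> (inv_into U \<phi> y)"
          using qq(4) q' by (simp add: quotient_chart_def)
      qed
      then show "case b of (V, \<psi>) \<Rightarrow> smooth_map_on (\<phi> ` (U \<inter> V)) (\<lambda>y. \<psi> (inv_into U \<phi> y))"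
        by (simp add: b)
    qed
  qed
  then have "smooth_manifold L X \<A>"
    using H \<open>second_countable X\<close> by (simp add: smooth_manifold_def)
  moreover have "smooth_submersion E L \<A> \<pi>"
    unfolding smooth_submersion_def
  proof (intro conjI ballI)
    show "\<pi> ` E \<subseteq> (\<Union>(U, \<phi>)\<in>\<A>. U)" using cover top by simp
    fix a assume "a \<in> \<A>"
    then obtain U \<phi> Y V h g where a: "a = (U, \<phi>)" and q: "quotient_chart E L \<pi> U \<phi> Y V h g"
      by (auto simp: \<A>_def)
    have Y: "openin (top_of_set E) Y" "\<And>x. x \<in> E \<Longrightarrow> \<pi> x \<in> U \<Longrightarrow> x \<in> Y" "U = \<pi> ` Y"
      "openin (top_of_set L) V" "smooth_map_on Y h" "h ` Y \<subseteq> V" "smooth_map_on V g" "g ` V \<subseteq> Y"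
      "\<And>y. y \<in> V \<Longrightarrow> h (g y) = y" "\<And>x. x \<in> Y \<Longrightarrow> \<pi> (g (h x)) = \<pi> x" "\<And>x. x \<in> Y \<Longrightarrow> \<phi> (\<pi> x) = h x"
      using q by (auto simp: quotient_chart_def)
    have YE: "Y \<subseteq> E" using Y(1) openin_imp_subset by blast
    have pre: "E \<inter> \<pi> -` U = Y" using Y(2,3) YE by auto
    \<comment> \<open>A straight line in the chart, lifted by \<open>g\<close>, starts at
      \<open>g (h p)\<close>; the map \<open>\<tau>\<close> moves it within the classes so that it
      starts at \<open>p\<close>.\<close>
    have curve: "\<exists>\<gamma> \<epsilon>. \<epsilon> > (0::real) \<and> \<gamma> 0 = p \<and> smooth_map_on {-\<epsilon><..<\<epsilon>} \<gamma> \<and>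
        \<gamma> ` {-\<epsilon><..<\<epsilon>} \<subseteq> Y \<and> ((\<lambda>t. \<phi> (\<pi> (\<gamma> t))) has_vector_derivative v) (at 0)"
      if p: "p \<in> Y" and v: "v \<in> L" for p v
    proof -
      have hp: "h p \<in> V" using p Y(6) by blast
      have gV: "g y \<in> Y" if "y \<in> V" for y using Y(8) that by blast
      have "p \<in> E" "g (h p) \<in> E" "\<pi> p = \<pi> (g (h p))" using p YE gV[OF hp] Y(10) by auto
      then obtain \<tau> where \<tau>: "smooth_map_on E \<tau>" "\<tau> ` E \<subseteq> E" "\<tau> (g (h p)) = p" "\<And>z. z \<in> E \<Longrightarrow> \<pi> (\<tau> z) = \<pi> z"
        using transl by metis
      let ?l = "\<lambda>t::real. h p + t *\<^sub>R v"
      obtain O' where O': "open O'" "V = L \<inter> O'" using Y(4) by (auto simp: openin_open)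
      have "open (?l -` O')" by (rule open_vimage[OF O'(1)]) (intro continuous_intros)
      moreover have "0 \<in> ?l -` O'" using hp O'(2) by simp
      ultimately obtain \<epsilon> where e: "\<epsilon> > 0" "{-\<epsilon><..<\<epsilon>} \<subseteq> ?l -` O'" by (rule real_open_interval_0)
      have lV: "?l t \<in> V" if "t \<in> {-\<epsilon><..<\<epsilon>}" for t
        using e(2) that O'(2) hp v L by (auto intro: subspace_add subspace_scale)
      have gE: "g y \<in> E" if "y \<in> V" for y using gV[OF that] YE by blast
      have pi: "\<pi> (\<tau> (g (?l t))) = \<pi> (g (?l t))" if "t \<in> {-\<epsilon><..<\<epsilon>}" for t
        using \<tau>(4) gE[OF lV[OF that]] .
      have "\<tau> (g (?l t)) \<in> Y" if "t \<in> {-\<epsilon><..<\<epsilon>}" for t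
      proof (rule Y(2))
        show "\<tau> (g (?l t)) \<in> E" using \<tau>(2) gE[OF lV[OF that]] by blast
        show "\<pi> (\<tau> (g (?l t))) \<in> U" unfolding pi[OF that] Y(3) using gV[OF lV[OF that]] by blast
      qed
      moreover have "smooth_map_on {-\<epsilon><..<\<epsilon>} (\<lambda>t. \<tau> (g (?l t)))"
      proof (rule smooth_map_on_compose[OF _ \<tau>(1)], rule smooth_map_on_compose[OF _ Y(7)])
        show "smooth_map_on {-\<epsilon><..<\<epsilon>} ?l"
          by (intro smooth_map_on_add smooth_map_on_scaleR smooth_map_on_const smooth_map_on_ident)
      qed (use lV gE in auto)
      moreover have "((\<lambda>t. \<phi> (\<pi> (\<tau> (g (?l t))))) has_vector_derivative v) (at 0)"
      proof (rule has_vector_derivative_transform_within_open)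
        show "(?l has_vector_derivative v) (at 0)" by (auto intro!: derivative_eq_intros)
        show "?l t = \<phi> (\<pi> (\<tau> (g (?l t))))" if "t \<in> {-\<epsilon><..<\<epsilon>}" for t
          unfolding pi[OF that] using Y(9,11) lV[OF that] gV[OF lV[OF that]] by simp
      qed (use e in auto)
      ultimately show ?thesis
        using e(1) \<tau>(3) by (intro exI[of _ "\<lambda>t. \<tau> (g (?l t))"] exI[of _ \<epsilon>]) auto
    qed
    have "smooth_map_on Y (\<lambda>x. \<phi> (\<pi> x))"
      by (rule smooth_map_on_cong[OF _ Y(5)]) (simp add: Y(11))
    then show "case a of (U, \<phi>) \<Rightarrow> openin (top_of_set E) (E \<inter> \<pi> -` U) \<and>
        smooth_map_on (E \<inter> \<pi> -` U) (\<lambda>x. \<phi> (\<pi> x)) \<and>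
        (\<forall>p\<in>E \<inter> \<pi> -` U. \<forall>v\<in>L. \<exists>\<gamma> \<epsilon>. \<epsilon> > (0::real) \<and> \<gamma> 0 = p \<and>
           smooth_map_on {-\<epsilon><..<\<epsilon>} \<gamma> \<and> \<gamma> ` {-\<epsilon><..<\<epsilon>} \<subseteq> E \<inter> \<pi> -` U \<and>
           ((\<lambda>t. \<phi> (\<pi> (\<gamma> t))) has_vector_derivative v) (at 0))"
      unfolding a prod.case pre using Y(1) curve by blast
  qed
  ultimately show ?thesis by blast
qed

section \<open>The moduli space\<close>

lemma polygon_class_eq:
  "e \<in> closed_polygons r \<Longrightarrow> polygon_class r e = {act A e | A. unitary A}"
  by (simp add: polygon_class_def orbit_def unitary_group_def conj_action_def act_def)

lemma polygon_class_eq_iff: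
  assumes "e \<in> closed_polygons r" "e' \<in> closed_polygons r"
  shows "polygon_class r e = polygon_class r e' \<longleftrightarrow> (\<exists>g. unitary g \<and> e' = act g e)"
proof
  assume "polygon_class r e = polygon_class r e'"
  moreover have "e' \<in> polygon_class r e'"
    unfolding polygon_class_eq[OF assms(2)] using unitary_1 by (metis (mono_tags, lifting) act_1 mem_Collect_eq)
  ultimately show "\<exists>g. unitary g \<and> e' = act g e"
    unfolding polygon_class_eq[OF assms(1)] by auto
next
  assume "\<exists>g. unitary g \<and> e' = act g e"
  then obtain g where g: "unitary g" "e' = act g e" by blast
  have "{act A e' | A. unitary A} = {act A e | A. unitary A}"
  proof (intro equalityI subsetI)
    fix x assume "x \<in> {act A e' | A. unitary A}"
    then obtain A where "unitary A" "x = act (A ** g) e" using g(2) by (auto simp: act_act)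
    then show "x \<in> {act A e | A. unitary A}" using unitary_mult[OF _ g(1)] by blast
  next
    fix x assume "x \<in> {act A e | A. unitary A}"
    then obtain A where A: "unitary A" "x = act A e" by blast
    then have "x = act (A ** conj_transpose g) e'"
      using act_inverse(1)[OF g(1), of e] by (simp add: g(2) flip: act_act)
    then show "x \<in> {act A e' | A. unitary A}"
      using unitary_mult[OF A(1) unitary_conj_transpose[OF g(1)]] by blast
  qed
  then show "polygon_class r e = polygon_class r e'" by (simp add: polygon_class_eq assms)
qed

section \<open>Invariant distance and closedness of orbits\<close>

lemma norm_act:
  fixes e :: "complex^'d^'d^'n"
  assumes "unitary A" shows "norm (act A e) = norm e"
proof -
  have inner_trace: "X \<bullet> Y = Re (trace (X ** conj_transpose Y))" for X Y :: "complex^'d^'d"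
    by (simp add: inner_vec_def inner_complex_def trace_def matrix_matrix_mult_def conj_transpose_def)
  have "(A ** X ** conj_transpose A) \<bullet> (A ** X ** conj_transpose A) = X \<bullet> X" for X :: "complex^'d^'d"
  proof -
    have e: "(A ** X ** conj_transpose A) ** conj_transpose (A ** X ** conj_transpose A)
        = A ** ((X ** conj_transpose X) ** conj_transpose A)"
      using assms by (simp add: conj_transpose_mult matrix_mul_assoc[symmetric] unitary_cancel)
    have "trace ((A ** X ** conj_transpose A) ** conj_transpose (A ** X ** conj_transpose A))
        = trace ((X ** conj_transpose X ** conj_transpose A) ** A)"
      unfolding e by (rule trace_mul_sym)
    also have "\<dots> = trace (X ** conj_transpose X)"
      using assms by (simp add: matrix_mul_assoc[symmetric] unitary_def)
    finally show ?thesis by (simp add: inner_trace)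
  qed
  then have "act A e \<bullet> act A e = e \<bullet> e"
    by (simp add: inner_vec_def[of "act A e"] inner_vec_def[of e] act_nth)
  then show ?thesis by (simp add: norm_eq_sqrt_inner)
qed

lemma act_diff: "act A (x - y) = act A x - act A y"
  by (simp add: act_def vec_eq_iff[where 'a="complex^'a^'a"]
      bounded_bilinear.diff_left[OF bounded_bilinear_matrix_mult]
      bounded_bilinear.diff_right[OF bounded_bilinear_matrix_mult])

lemma dist_act: "unitary A \<Longrightarrow> dist (act A x) (act A y) = dist x y"
  by (simp add: dist_norm norm_act flip: act_diff)

lemma smooth_act:
  assumes "smooth_map_on S A" "smooth_map_on S e"
  shows "smooth_map_on S (\<lambda>x. act (A x) (e x))"
  unfolding act_def using assms
  by (intro smooth_map_on_vec_lambda smooth_map_on_matrix_mult smooth_map_on_conj_transpose smooth_map_on_vec_nth)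

lemma compact_unitary: "compact {A :: complex^'d^'d. unitary A}"
proof -
  have "closed ((\<lambda>A :: complex^'d^'d. A ** conj_transpose A) -` {mat 1})"
    by (rule closed_vimage[OF closed_singleton])
       (intro smooth_map_on_continuous smooth_map_on_matrix_mult smooth_map_on_conj_transpose smooth_map_on_ident)
  moreover have "{A :: complex^'d^'d. unitary A} = (\<lambda>A. A ** conj_transpose A) -` {mat 1}"
    using unitaryI by (fastforce simp: unitary_def)
  moreover have "norm A = sqrt (real CARD('d))" if "unitary A" for A :: "complex^'d^'d"
  proof -
    have "A \<bullet> A = Re (trace (A ** conj_transpose A))"
      by (simp add: inner_vec_def inner_complex_def trace_def matrix_matrix_mult_def conj_transpose_def)
    also have "\<dots> = real CARD('d)" using that by (simp add: unitary_def trace_mat)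
    finally show ?thesis by (simp add: norm_eq_sqrt_inner)
  qed
  then have "bounded {A :: complex^'d^'d. unitary A}" by (intro boundedI) auto
  ultimately show ?thesis by (simp add: compact_eq_bounded_closed)
qed

text \<open>A continuous image of the compact unitary group. Closedness makes the distance to the
  orbit positive off the orbit.\<close>

lemma closed_unitary_orbit: "closed {act A e | A. unitary A}" for e :: "complex^'d^'d^'n"
proof -
  have "compact ((\<lambda>A. act A e) ` {A. unitary A})"
    by (intro compact_continuous_image compact_unitary smooth_map_on_continuous smooth_act
        smooth_map_on_ident smooth_map_on_const)
  then have "closed ((\<lambda>A. act A e) ` {A. unitary A})" by (rule compact_imp_closed)
  moreover have "(\<lambda>A. act A e) ` {A. unitary A} = {act A e | A. unitary A}" by auto
  ultimately show ?thesis by simp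
qed

lemma infdist_act_le:
  fixes S :: "(complex^'d^'d^'n) set"
  assumes S: "closed S" "S \<noteq> {}" "\<And>x. x \<in> S \<Longrightarrow> act A x \<in> S" and A: "unitary A"
  shows "infdist (act A x) S \<le> infdist x S"
proof -
  obtain y where y: "y \<in> S" "infdist x S = dist x y"
    using infdist_attains_inf[OF S(1,2)] by blast
  have "infdist (act A x) S \<le> dist (act A x) (act A y)" by (rule infdist_le[OF S(3)[OF y(1)]])
  then show ?thesis using y(2) by (simp add: dist_act[OF A])
qed

text \<open>\<open>A\<close> and its adjoint are isometries that preserve the orbit, and each gives
  one inequality.\<close>

lemma infdist_act_orbit:
  fixes e :: "complex^'d^'d^'n"
  assumes A: "unitary A" and S: "S = {act B e | B. unitary B}"
  shows "infdist (act A x) S = infdist x S"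
proof -
  have *: "act B y \<in> S" if "unitary B" "y \<in> S" for B y
  proof -
    obtain C where "unitary C" "y = act C e" using \<open>y \<in> S\<close> S by auto
    then show ?thesis using unitary_mult[OF \<open>unitary B\<close>, of C] unfolding S by (auto simp: act_act)
  qed
  have ne: "S \<noteq> {}" using unitary_1 by (auto simp: S)
  have cl: "closed S" unfolding S by (rule closed_unitary_orbit)
  have "infdist (act (conj_transpose A) (act A x)) S \<le> infdist (act A x) S"
    by (rule infdist_act_le[OF cl ne *[OF unitary_conj_transpose[OF A]] unitary_conj_transpose[OF A]])
  moreover have "infdist (act A x) S \<le> infdist x S"
    by (rule infdist_act_le[OF cl ne *[OF A] A])
  ultimately show ?thesis using A by (simp add: act_inverse)
qed

section \<open>Topology of the nondecomposable moduli\<close>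

lemma polygon_class_nondecomposable:
  assumes r: "\<And>i. r $ i > 0" and e: "e \<in> closed_polygons r" "e' \<in> nondecomposable_polygons r"
    and eq: "polygon_class r e = polygon_class r e'"
  shows "e \<in> nondecomposable_polygons r"
proof -
  obtain g where "unitary g" "e = act g e'" using polygon_class_eq_iff[of e' r e] e eq by auto
  then show ?thesis using act_nondecomposable_polygons[OF r _ e(2)] by simp
qed

text \<open>Decomposability is constant on orbits, so the images of the two kinds of polygons do not
  meet and the difference may be taken upstairs.\<close>

lemma moduli_diff_decomposable:
  assumes r: "\<And>i. r $ i > 0"
  shows "moduli r - decomposable_moduli r = polygon_class r ` nondecomposable_polygons r"
proof -
  have diff: "A - C = B" if "A = B \<union> C" "B \<inter> C = {}" for A B C :: "'x set" using that by blast
  have "moduli r = polygon_class r ` closed_polygons r"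
    by (auto simp: moduli_def orbits_def polygon_class_def)
  also have "closed_polygons r = nondecomposable_polygons r \<union> decomposable_polygons r"
    by (auto simp: decomposable_polygons_def)
  finally have 1: "moduli r = polygon_class r ` nondecomposable_polygons r \<union> decomposable_moduli r"
    unfolding image_Un decomposable_moduli_def .
  have "polygon_class r e \<notin> decomposable_moduli r" if "e \<in> nondecomposable_polygons r" for e
  proof
    assume "polygon_class r e \<in> decomposable_moduli r"
    then obtain e' where e': "e' \<in> decomposable_polygons r" "polygon_class r e' = polygon_class r e"
      unfolding decomposable_moduli_def by auto
    then have "e' \<in> closed_polygons r" by (simp add: decomposable_polygons_def)
    then show False using polygon_class_nondecomposable[OF r _ that e'(2)] e'(1) by blast
  qed
  then have "polygon_class r ` nondecomposable_polygons r \<inter> decomposable_moduli r = {}" by auto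
  with 1 show ?thesis by (rule diff)
qed

abbreviation nondecomposable_moduli_topology :: "real^'n \<Rightarrow> (complex^'d^'d^'n) set topology" where
  "nondecomposable_moduli_topology r \<equiv>
     subtopology (moduli_topology r) (moduli r - decomposable_moduli r)"

text \<open>The nondecomposable polygons form an open saturated set, and a quotient map restricts to
  such sets.\<close>

lemma quotient_map_polygon_class:
  fixes r :: "real^'n"
  assumes r: "\<And>i. r $ i > 0"
  shows "quotient_map (top_of_set (nondecomposable_polygons r :: (complex^'d^'d^'n) set))
    (nondecomposable_moduli_topology r) (polygon_class r)"
proof -
  let ?E = "nondecomposable_polygons r :: (complex^'d^'d^'n) set"
  let ?CP = "closed_polygons r :: (complex^'d^'d^'n) set"
  let ?V = "moduli r - decomposable_moduli r :: (complex^'d^'d^'n) set set"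
  have qm: "quotient_map (top_of_set ?CP) (moduli_topology r) (polygon_class r)"
    unfolding moduli_topology_def by (rule quotient_map_quotient_topology)
  have pre: "{x \<in> topspace (top_of_set ?CP). polygon_class r x \<in> ?V} = ?E"
    unfolding moduli_diff_decomposable[OF r]
    using polygon_class_nondecomposable[OF r] by auto
  have "?E = ?CP \<inter> {e. \<not> splits e}" using nondecomposable_polygons_iff[OF r] by blast
  then have oE: "openin (top_of_set ?CP) ?E" using open_not_splits by (metis openin_open_Int)
  have "?V \<subseteq> topspace (moduli_topology r)" by (auto simp: topspace_moduli_topology)
  moreover have "openin (top_of_set ?CP) {x \<in> topspace (top_of_set ?CP). polygon_class r x \<in> ?V}"
    unfolding pre by (rule oE)
  ultimately have "openin (moduli_topology r) ?V" using qm unfolding quotient_map_def by blast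
  then have "quotient_map (subtopology (top_of_set ?CP) ?E) (nondecomposable_moduli_topology r) (polygon_class r)"
    by (intro quotient_map_restriction[OF qm pre]) simp
  moreover have "subtopology (top_of_set ?CP) ?E = top_of_set ?E"
    by (simp add: subtopology_subtopology Int_absorb1 Diff_subset)
  ultimately show ?thesis by simp
qed

text \<open>The saturation of an open set is a union of its translates by unitary matrices, each of
  them open.\<close>

lemma open_map_polygon_class:
  fixes r :: "real^'n"
  assumes r: "\<And>i. r $ i > 0"
  shows "open_map (top_of_set (nondecomposable_polygons r :: (complex^'d^'d^'n) set))
    (nondecomposable_moduli_topology r) (polygon_class r)"
  unfolding open_map_def
proof (intro allI impI)
  let ?E = "nondecomposable_polygons r :: (complex^'d^'d^'n) set"
  fix U assume U: "openin (top_of_set ?E) U"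
  then have UE: "U \<subseteq> ?E" by (rule openin_imp_subset)
  have eq: "{x \<in> ?E. polygon_class r x \<in> polygon_class r ` U} = (\<Union>g\<in>{g. unitary g}. ?E \<inter> act g -` U)"
  proof (intro equalityI subsetI)
    fix x assume "x \<in> {x \<in> ?E. polygon_class r x \<in> polygon_class r ` U}"
    then obtain y where y: "x \<in> ?E" "y \<in> U" "polygon_class r x = polygon_class r y" by auto
    then obtain g where "unitary g" "y = act g x" using polygon_class_eq_iff[of x r y] UE by auto
    then show "x \<in> (\<Union>g\<in>{g. unitary g}. ?E \<inter> act g -` U)" using y by auto
  next
    fix x assume "x \<in> (\<Union>g\<in>{g. unitary g}. ?E \<inter> act g -` U)"
    then obtain g where g: "unitary g" "x \<in> ?E" "act g x \<in> U" by auto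
    then have "polygon_class r x = polygon_class r (act g x)"
      using polygon_class_eq_iff[of x r "act g x"] UE by auto
    then show "x \<in> {x \<in> ?E. polygon_class r x \<in> polygon_class r ` U}" using g by auto
  qed
  have "openin (top_of_set ?E) (?E \<inter> act g -` U)" if "unitary g" for g
    by (rule continuous_openin_preimage[OF _ _ U])
       (use act_nondecomposable_polygons[OF r that] in
         \<open>auto intro!: smooth_map_on_continuous smooth_act smooth_map_on_const smooth_map_on_ident\<close>)
  then have "openin (top_of_set ?E) {x \<in> topspace (top_of_set ?E). polygon_class r x \<in> polygon_class r ` U}"
    unfolding topspace_euclidean_subtopology eq by (intro openin_Union) auto
  moreover have "polygon_class r ` U \<subseteq> topspace (nondecomposable_moduli_topology r)"
    using quotient_imp_surjective_map[OF quotient_map_polygon_class[OF r, where 'd='d]] UE by auto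
  ultimately show "openin (nondecomposable_moduli_topology r) (polygon_class r ` U)"
    using quotient_map_polygon_class[OF r, where 'd='d] unfolding quotient_map_def by blast
qed

text \<open>The distance to a fixed orbit is a continuous invariant function, so it separates this
  orbit from every other one in the quotient.\<close>

lemma Hausdorff_nondecomposable_moduli:
  fixes r :: "real^'n"
  assumes r: "\<And>i. r $ i > 0"
  shows "Hausdorff_space (nondecomposable_moduli_topology r :: (complex^'d^'d^'n) set topology)"
  unfolding Hausdorff_space_def
proof (intro allI impI)
  let ?E = "nondecomposable_polygons r :: (complex^'d^'d^'n) set"
  let ?X = "nondecomposable_moduli_topology r :: (complex^'d^'d^'n) set topology"
  note qm = quotient_map_polygon_class[OF r, where 'd='d]
  have top: "topspace ?X = polygon_class r ` ?E" using quotient_imp_surjective_map[OF qm] by simp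
  fix a b assume "a \<in> topspace ?X \<and> b \<in> topspace ?X \<and> a \<noteq> b"
  then obtain x y where xy: "x \<in> ?E" "y \<in> ?E" "a = polygon_class r x" "b = polygon_class r y" "a \<noteq> b"
    unfolding top by blast
  define S where "S = {act B y | B. unitary B}"
  \<comment> \<open>Descends the distance to the orbit of \<open>y\<close> to classes; invariance
    makes the chosen representative harmless.\<close>
  define f where "f c = infdist (SOME e. e \<in> ?E \<and> polygon_class r e = c) S" for c
  have f: "f (polygon_class r e) = infdist e S" if e: "e \<in> ?E" for e
  proof -
    let ?e = "SOME e'. e' \<in> ?E \<and> polygon_class r e' = polygon_class r e"
    have "?e \<in> ?E \<and> polygon_class r ?e = polygon_class r e"
      by (rule someI[of _ e]) (use e in simp)
    then obtain g where "unitary g" "?e = act g e" using polygon_class_eq_iff[of e r ?e] e by auto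
    then show ?thesis by (simp add: f_def infdist_act_orbit[OF _ S_def])
  qed
  have "continuous_map (top_of_set ?E) euclideanreal (\<lambda>e. infdist e S)"
    by (simp add: continuous_on_infdist continuous_on_id)
  then have "continuous_map (top_of_set ?E) euclideanreal (f \<circ> polygon_class r)"
    by (rule continuous_map_eq) (simp add: f)
  then have cf: "continuous_map ?X euclideanreal f"
    using continuous_compose_quotient_map_eq[OF qm] by blast
  have "y \<in> S" using unitary_1 unfolding S_def by (metis (mono_tags, lifting) act_1 mem_Collect_eq)
  then have fb: "f b = 0" using xy by (simp add: f)
  have "x \<notin> S"
  proof
    assume "x \<in> S"
    then obtain g where "unitary g" "x = act g y" by (auto simp: S_def)
    then show False using polygon_class_eq_iff[of y r x] xy by auto
  qed
  moreover have "closed S" unfolding S_def by (rule closed_unitary_orbit)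
  ultimately have "infdist x S \<noteq> 0" using in_closed_iff_infdist_zero \<open>y \<in> S\<close> by blast
  then have fa: "f a > 0" using xy infdist_nonneg[of x S] by (simp add: f)
  let ?U = "{c \<in> topspace ?X. f c \<in> {f a / 2<..}}" and ?V = "{c \<in> topspace ?X. f c \<in> {..<f a / 2}}"
  have "openin ?X ?U" "openin ?X ?V"
    by (rule openin_continuous_map_preimage[OF cf]; simp)+
  moreover have "a \<in> ?U" "b \<in> ?V" using fa fb xy top by auto
  moreover have "disjnt ?U ?V" by (auto simp: disjnt_iff)
  ultimately show "\<exists>U V. openin ?X U \<and> openin ?X V \<and> a \<in> U \<and> b \<in> V \<and> disjnt U V" by blast
qed

section \<open>The special unitary action\<close>

lemma group_special_unitary: "group (special_unitary_group :: (complex^'d^'d) monoid)"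
proof (rule groupI)
  fix x :: "complex^'d^'d" assume x: "x \<in> carrier special_unitary_group"
  have "cnj (det x) = det (conj_transpose x)"
  proof -
    have "cnj (det x) = det (\<chi> i j. cnj (x $ i $ j))" by (simp add: det_def)
    also have "\<dots> = det (transpose (\<chi> i j. cnj (x $ i $ j)))" by (rule det_transpose[symmetric])
    finally show ?thesis by (simp add: transpose_def conj_transpose_def)
  qed
  then show "\<exists>y\<in>carrier special_unitary_group. y \<otimes>\<^bsub>special_unitary_group\<^esub> x = \<one>\<^bsub>special_unitary_group\<^esub>"
    using x unitary_conj_transpose[of x]
    by (intro bexI[of _ "conj_transpose x"]) (auto simp: special_unitary_group_def unitary_group_def unitary_def)
qed (auto simp: special_unitary_group_def unitary_group_def unitary_mult unitary_1 det_mul matrix_mul_assoc)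

lemma conj_action_eq: "conj_action E A = (\<lambda>e\<in>E. act A e)"
  by (simp add: conj_action_def act_def)

text \<open>A stabilising matrix commutes with every edge, so Schur's lemma makes it scalar;
  conversely the phases of a scalar unitary cancel under conjugation. The stabiliser is thus the
  same group of scalars everywhere.\<close>

lemma acts_freely_special_unitary:
  fixes r :: "real^'n"
  assumes r: "\<And>i. r $ i > 0"
  shows "acts_freely_modulo special_unitary_group scalar_special_unitaries
    (nondecomposable_polygons r :: (complex^'d^'d^'n) set) (conj_action (nondecomposable_polygons r))"
proof -
  let ?E = "nondecomposable_polygons r :: (complex^'d^'d^'n) set"
  let ?G = "special_unitary_group :: (complex^'d^'d) monoid"
  have carrier: "A \<in> carrier ?G \<longleftrightarrow> unitary A \<and> det A = 1" for A
    by (simp add: special_unitary_group_def)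
  have actE: "act A e \<in> ?E" if "unitary A" "e \<in> ?E" for A e
    using act_nondecomposable_polygons[OF r that] .
  have Bij: "conj_action ?E A \<in> Bij ?E" if A: "unitary A" for A
  proof -
    have "bij_betw (\<lambda>e\<in>?E. act A e) ?E ?E"
      by (rule bij_betw_byWitness[where f' = "act (conj_transpose A)"])
         (use A actE unitary_conj_transpose[OF A] in \<open>auto simp: act_inverse\<close>)
    then show ?thesis by (simp add: Bij_def conj_action_eq)
  qed
  have "conj_action ?E (A ** B) = compose ?E (conj_action ?E A) (conj_action ?E B)" if "unitary B" for A B
    using actE[OF that] by (auto simp: conj_action_eq compose_def act_act fun_eq_iff)
  then have "conj_action ?E \<in> hom ?G (BijGroup ?E)"
    using Bij by (auto simp: hom_def carrier BijGroup_def special_unitary_group_def unitary_group_def)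
  then have "group_hom ?G (BijGroup ?E) (conj_action ?E)"
    by (intro group_hom.intro group_special_unitary group_BijGroup group_hom_axioms.intro)
  then have "group_action ?G ?E (conj_action ?E)" by (rule group_action.intro)
  moreover have "stabilizer ?G (conj_action ?E) e = scalar_special_unitaries" if e: "e \<in> ?E" for e
  proof (intro equalityI subsetI)
    fix A assume "A \<in> stabilizer ?G (conj_action ?E) e"
    then have A: "A \<in> carrier ?G" "unitary A" "act A e = e"
      using e by (auto simp: stabilizer_def conj_action_eq carrier)
    have "A ** e $ i = e $ i ** A" for i
    proof -
      have "act A e $ i ** A = e $ i ** A" using A(3) by simp
      then show ?thesis using A(2) by (simp add: act_nth matrix_mul_assoc[symmetric] unitary_def)
    qed
    then obtain c where "A = mat c" using schur_polygon[OF r e] by blast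
    then show "A \<in> scalar_special_unitaries" using A(1) by (auto simp: scalar_special_unitaries_def)
  next
    fix A :: "complex^'d^'d" assume "A \<in> scalar_special_unitaries"
    then obtain c where A: "A \<in> carrier ?G" "A = mat c" by (auto simp: scalar_special_unitaries_def)
    then have "unitary (mat c :: complex^'d^'d)" by (simp add: carrier)
    then have "c * cnj c = 1" by (simp add: unitary_def mat_mult_mat mat_inject)
    then have "act A e = e" using act_scalar[of c "mat 1" e] by (simp add: A(2))
    then show "A \<in> stabilizer ?G (conj_action ?E) e"
      using A(1) e by (simp add: stabilizer_def conj_action_eq)
  qed
  ultimately show ?thesis by (simp add: acts_freely_modulo_def)
qed

lemma ex_subspace_dim:
  assumes "k \<le> DIM('a::euclidean_space)"
  obtains L :: "'a::euclidean_space set" where "subspace L" "dim L = k"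
  using choose_subspace_of_subspace[of k "UNIV :: 'a set"] assms by (metis dim_UNIV)

text \<open>Leaves room for model spaces of the required dimension inside the type of matrix tuples,
  where both conclusions look for \<open>L\<close>.\<close>

lemma dim_euclidean_le: "DIM(complex^'d^'n) \<le> DIM(complex^'d^'d^'n)"
  by simp

lemma smooth_submanifold_nondecomposable:
  fixes r :: "real^'n"
  assumes r: "\<And>i. r $ i > 0"
  shows "\<exists>L :: (complex^'d^'d^'n) set. smooth_submanifold L (nondecomposable_polygons r :: (complex^'d^'d^'n) set)"
proof -
  let ?k = "DIM(complex^'d^'n) - dim (moment_range :: ((real^'n) \<times> (real^'n) \<times> (complex^'d^'d)) set)"
  have "?k \<le> DIM(complex^'d^'d^'n)" using dim_euclidean_le[where 'd='d and 'n='n] by linarith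
  then obtain L :: "(complex^'d^'d^'n) set" where L: "subspace L" "dim L = ?k"
    by (rule ex_subspace_dim)
  have "chart_at L (nondecomposable_polygons r) p" if p: "p \<in> nondecomposable_polygons r" for p :: "complex^'d^'d^'n"
  proof -
    obtain K :: "(complex^'d^'n) set" where K: "subspace K" "chart_at K (nondecomposable_polygons r) p"
      "dim (moment_range :: ((real^'n) \<times> (real^'n) \<times> (complex^'d^'d)) set) + dim K = DIM(complex^'d^'n)"
      by (rule nondecomposable_polygons_chart[OF r p])
    then show ?thesis using chart_at_change_space[OF K(2,1) L(1)] L(2) by linarith
  qed
  then show ?thesis using L(1) by (auto simp: smooth_submanifold_chart_at)
qed

text \<open>Slice domains are saturated and slice maps separate exactly the orbits, so slices supply
  the quotient charts.\<close>

lemma smooth_manifold_moduli: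
  fixes r :: "real^'n"
  assumes r: "\<And>i. r $ i > 0"
  shows "\<exists>(L :: (complex^'d^'d^'n) set) \<A>.
    smooth_manifold L (nondecomposable_moduli_topology r :: (complex^'d^'d^'n) set topology) \<A> \<and>
    smooth_submersion (nondecomposable_polygons r) L \<A> (polygon_class r)"
proof -
  let ?E = "nondecomposable_polygons r :: (complex^'d^'d^'n) set"
  let ?k = "DIM(complex^'d^'n) - dim (moment_range :: ((real^'n) \<times> (real^'n) \<times> (complex^'d^'d)) set)
      - (dim (skew_hermitian :: (complex^'d^'d) set) - dim (skew_hermitian \<inter> range mat :: (complex^'d^'d) set))"
  have "?k \<le> DIM(complex^'d^'d^'n)" using dim_euclidean_le[where 'd='d and 'n='n] by linarith
  then obtain L :: "(complex^'d^'d^'n) set" where L: "subspace L" "dim L = ?k"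
    by (rule ex_subspace_dim)
  have "\<exists>O' \<phi> Y V h g. p \<in> Y \<and> quotient_chart ?E L (polygon_class r) O' \<phi> Y V h g" if p: "p \<in> ?E" for p
  proof -
    obtain i ls where pU: "p \<in> slice_domain r i ls" using ex_slice_domain[OF r p] by blast
    let ?U = "slice_domain r i ls :: (complex^'d^'d^'n) set"
    have CP: "e \<in> closed_polygons r" if "e \<in> ?U" for e using that by (simp add: slice_domain_def)
    show ?thesis
    proof (rule quotient_chart_exists[OF pU openin_slice_domain _ smooth_slice_map[OF r]])
      show "x \<in> ?U" if x: "x \<in> ?E" "polygon_class r x \<in> polygon_class r ` ?U" for x
      proof -
        obtain y where y: "y \<in> ?U" "polygon_class r y = polygon_class r x" using x(2) by auto
        then obtain g where "unitary g" "x = act g y"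
          using polygon_class_eq_iff[OF CP[OF y(1)], of x] x(1) by auto
        then show ?thesis using slice_domain_act(1)[OF r y(1)] by simp
      qed
      show "slice_map i ls ` ?U \<subseteq> ?U" using slice_map_slice_domain(1)[OF r] by blast
      show "polygon_class r (slice_map i ls x) = polygon_class r x" if x: "x \<in> ?U" for x
      proof -
        obtain g where g: "unitary g" "slice_map i ls x = act g x" by (rule slice_map_orbit[OF r x])
        then show ?thesis
          using polygon_class_eq_iff[OF CP[OF x] CP[OF slice_map_slice_domain(1)[OF r x]]] by auto
      qed
      show "slice_map i ls x = slice_map i ls y"
        if "x \<in> ?U" "y \<in> ?U" "polygon_class r x = polygon_class r y" for x y
        using polygon_class_eq_iff[OF CP[OF that(1)] CP[OF that(2)]] slice_map_eq_iff[OF r that(1,2)] that(3)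
        by simp
      show "chart_at L {x \<in> ?U. slice_map i ls x = x} (slice_map i ls p)"
        by (rule slice_chart[OF r slice_map_slice_domain[OF r pU] L])
    qed
  qed
  \<comment> \<open>Two points of one class differ by a unitary \<open>g\<close>, and
    \<open>act g\<close> is a smooth map that preserves every class.\<close>
  moreover have "\<exists>\<tau>. smooth_map_on ?E \<tau> \<and> \<tau> ` ?E \<subseteq> ?E \<and> \<tau> y = x \<and> (\<forall>z\<in>?E. polygon_class r (\<tau> z) = polygon_class r z)"
    if xy: "x \<in> ?E" "y \<in> ?E" "polygon_class r x = polygon_class r y" for x y
  proof -
    obtain g where g: "unitary g" "x = act g y"
      using polygon_class_eq_iff[of y r x] xy by auto
    have "polygon_class r (act g z) = polygon_class r z" if "z \<in> ?E" for z
      using polygon_class_eq_iff[of z r "act g z"] act_nondecomposable_polygons[OF r g(1) that] that g(1) by auto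
    then show ?thesis
      using g act_nondecomposable_polygons[OF r g(1)]
      by (intro exI[of _ "act g"]) (auto intro: smooth_act smooth_map_on_const smooth_map_on_ident)
  qed
  ultimately show ?thesis
    using smooth_quotient_manifold[OF quotient_map_polygon_class[OF r] open_map_polygon_class[OF r]
        Hausdorff_nondecomposable_moduli[OF r] L(1)] by blast
qed

theorem theorem4p1p12:
  fixes m n :: nat and r :: "real^'n"
  assumes "m \<ge> 1" and "n \<ge> 1" and "CARD('d::finite) = m + 1" and "CARD('n) = n"
    and "\<And>i. r $ i > 0"
  shows
    "(\<exists>L :: (complex^'d^'d^'n) set.
        smooth_submanifold L (closed_polygons r - decomposable_polygons r :: (complex^'d^'d^'n) set)) \<and>
     acts_freely_modulo special_unitary_group scalar_special_unitaries
       (closed_polygons r - decomposable_polygons r :: (complex^'d^'d^'n) set)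
       (conj_action (closed_polygons r - decomposable_polygons r)) \<and>
     (\<exists>(L :: (complex^'d^'d^'n) set) \<A>.
        smooth_manifold L
          (subtopology (moduli_topology r)
             (moduli r - decomposable_moduli r :: (complex^'d^'d^'n) set set)) \<A> \<and>
        smooth_submersion (closed_polygons r - decomposable_polygons r) L \<A> (polygon_class r))"
  using smooth_submanifold_nondecomposable[OF assms(5)] acts_freely_special_unitary[OF assms(5)]
    smooth_manifold_moduli[OF assms(5)] by blast

end
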